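(* Let $A\in\mathscr{D}\mathrm{iag}$ with $L(A)>0$. There exist a neighborhood $\mathscr{N}_A$ of $A$ in $\mathrm{SL}_2(\mathbb{R})^k$ (on which $\rho_-$ is defined) and a constant $c=c(A)>0$ such that for every $B\in\mathscr{N}_A$ with $\rho_-(B)>0$, $$\mathbb{P}\Big[\Big|\tfrac1n\log\|B^{(n)}\|-L(B)\Big|>n^{-1/6}\Big]<e^{-n^{1/6}}$$ for all $n\ge\big[c^{-1}\log\rho_-(B)^{-1}\big]^{54}$.
   Context: $\mathrm{SL}_2(\mathbb{R})$ denotes real $2\times2$ matrices with determinant $\pm1$. $\Sigma=\{1,\dots,k\}$, $p$ a probability vector with positive entries, $X=\Sigma^{\mathbb{Z}}$, $\mathbb{P}=p^{\mathbb{Z}}$; a cocycle $B=(B_1,\dots,B_k)$ has iterates $B^{(n)}(x)=B_{x_{n-1}}\cdots B_{x_0}$ and Lyapunov exponent $L(B)$ (a.s. limit of $\frac1n\log\|B^{(n)}(x)\|$). $\mathscr{D}\mathrm{iag}$ is the set of cocycles with two transversal lines invariant under all matrices. Projective metric $d(\hat p,\hat q)=|\sin\angle(p,q)|$, $\hat g$ the projective action. For $A\in\mathscr{D}\mathrm{iag}$ with $L(A)>0$: $e_\pm(A)$ unit vectors spanning the invariant lines with restricted exponent $\pm L(A)$, $A_je_+(A)=a_je_+(A)$, $\Sigma_H(A)=\{i:|a_i|\ge e^{L(A)}\}$. For a hyperbolic matrix $g$ (real eigenvalues of modulus $>1$ and $<1$), $\hat e_-(g)$ is its contracting eigendirection.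 For $B$ with $B_i$ hyperbolic for all $i\in\Sigma_H(A)$: $\rho_-(B)=\max_{i\in\Sigma_H(A)}\max_{1\le j\le k}d(\hat B_j\hat e_-(B_i),\hat e_-(B_i))$. *)

theory Defs
  imports "HOL-Analysis.Analysis" "HOL-Probability.Probability"
begin

type_synonym mat2 = "real^2^2"

text \<open>SL_2(R) in the paper's convention: determinant +1 or -1.\<close>
definition SL2 :: "mat2 set" where
  "SL2 = {M. det M = 1 \<or> det M = -1}"

definition cocycles :: "('s \<Rightarrow> mat2) set" where
  "cocycles = {B. \<forall>i. B i \<in> SL2}"

fun cocycle_iter :: "('s \<Rightarrow> mat2) \<Rightarrow> (nat \<Rightarrow> 's) \<Rightarrow> nat \<Rightarrow> mat2" where
  "cocycle_iter B x 0 = mat 1"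
| "cocycle_iter B x (Suc n) = B (x n) ** cocycle_iter B x n"

definition opnorm :: "mat2 \<Rightarrow> real" where
  "opnorm M = onorm (\<lambda>v. M *v v)"

text \<open>Bernoulli measure p^N on sequences (the iterates only use nonnegative coordinates).\<close>
definition bernoulli :: "'s pmf \<Rightarrow> (nat \<Rightarrow> 's) measure" where
  "bernoulli p = Pi\<^sub>M UNIV (\<lambda>_. measure_pmf p)"

definition lyap :: "'s pmf \<Rightarrow> ('s \<Rightarrow> mat2) \<Rightarrow> real" where
  "lyap p B = (THE l. AE x in bernoulli p.
      (\<lambda>n. ln (opnorm (cocycle_iter B x n)) / real n) \<longlonglongrightarrow> l)"

definition inv_line :: "('s \<Rightarrow> mat2) \<Rightarrow> real^2 \<Rightarrow> bool" where
  "inv_line B u \<longleftrightarrow> u \<noteq> 0 \<and> (\<forall>i. \<exists>a. B i *v u = a *\<^sub>R u)"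

definition Diag :: "('s \<Rightarrow> mat2) set" where
  "Diag = {B. B \<in> cocycles \<and> (\<exists>u v. inv_line B u \<and> inv_line B v \<and> \<not> collinear {0, u, v})}"

definition restricted_exp :: "'s pmf \<Rightarrow> ('s \<Rightarrow> mat2) \<Rightarrow> real^2 \<Rightarrow> real" where
  "restricted_exp p B u = (THE l. AE x in bernoulli p.
      (\<lambda>n. ln (norm (cocycle_iter B x n *v u)) / real n) \<longlonglongrightarrow> l)"

definition e_plus :: "'s pmf \<Rightarrow> ('s \<Rightarrow> mat2) \<Rightarrow> real^2" where
  "e_plus p A = (SOME u. norm u = 1 \<and> inv_line A u \<and> restricted_exp p A u = lyap p A)"

definition a_coef :: "'s pmf \<Rightarrow> ('s \<Rightarrow> mat2) \<Rightarrow> 's \<Rightarrow> real" where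
  "a_coef p A j = (THE a. A j *v e_plus p A = a *\<^sub>R e_plus p A)"

definition Sigma_H :: "'s pmf \<Rightarrow> ('s \<Rightarrow> mat2) \<Rightarrow> 's set" where
  "Sigma_H p A = {i. \<bar>a_coef p A i\<bar> \<ge> exp (lyap p A)}"

definition hyperbolic :: "mat2 \<Rightarrow> bool" where
  "hyperbolic g \<longleftrightarrow> (\<exists>l \<mu> u v. u \<noteq> 0 \<and> v \<noteq> 0 \<and> g *v u = l *\<^sub>R u \<and> g *v v = \<mu> *\<^sub>R v
      \<and> \<bar>l\<bar> > 1 \<and> \<bar>\<mu>\<bar> < 1)"

definition e_minus :: "mat2 \<Rightarrow> real^2" where
  "e_minus g = (SOME v. norm v = 1 \<and> (\<exists>\<mu>. \<bar>\<mu>\<bar> < 1 \<and> g *v v = \<mu> *\<^sub>R v))"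

definition vec_angle :: "real^2 \<Rightarrow> real^2 \<Rightarrow> real" where
  "vec_angle p q = arccos ((p \<bullet> q) / (norm p * norm q))"

definition proj_dist :: "real^2 \<Rightarrow> real^2 \<Rightarrow> real" where
  "proj_dist p q = \<bar>sin (vec_angle p q)\<bar>"

text \<open>rho_-(B), relative to the base cocycle A (through Sigma_H(A)).
  d(g^ e^, e^) is computed with the representative g e of the image line.\<close>
definition rho_minus :: "'s pmf \<Rightarrow> ('s \<Rightarrow> mat2) \<Rightarrow> ('s \<Rightarrow> mat2) \<Rightarrow> real" where
  "rho_minus p A B = Max {proj_dist (B j *v e_minus (B i)) (e_minus (B i)) | i j. i \<in> Sigma_H p A}"

end

theory Submission
  imports Defs
begin

text \<open>
  In the basis \<open>u = e\<^sub>+(A)\<close>, \<open>w = e\<^sub>-(B\<^sub>i)\<close>, with \<open>i\<close> attaining the maximum \<open>\<rho> = \<rho>\<^sub>-(B)\<close> and the second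
  coordinate multiplied by \<open>\<rho>\<close>, all matrices \<open>B\<^sub>l\<close> become small perturbations of upper triangular
  matrices with the diagonal of \<open>A\<^sub>l\<close> and bounded off-diagonal entries, one of which is bounded away from
  0, while \<open>B\<^sub>i\<close> itself fixes the second axis and repels from it. The words \<open>i\<dots>i\<close> or \<open>j i\<dots>i\<close> therefore
  lead away from the second axis with probability bounded below, and a power of the slope is almost
  superharmonic elsewhere, so the expected time spent near that axis is bounded and log norms grow
  linearly in expectation, uniformly in \<open>\<rho>\<close>. Undoing the rescaling costs \<open>ln (1/\<rho>)\<close>: every vector has
  been expanded on average after \<open>\<tau> = O(ln (1/\<rho>))\<close> steps. As in Le Page's argument this makes the
  projective action contract a power \<open>O(\<tau>\<^sup>-\<^sup>2)\<close> of the distance in mean, so that the expected log growth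
  depends on the starting vector only up to \<open>K = O(\<tau>\<^sup>3)\<close>. Hence log norms have martingale differences
  bounded by \<open>O(K)\<close>, and an exponential moment bound yields the deviation estimate around the limit of
  the expectations; by Borel--Cantelli this limit is the Lyapunov exponent.
\<close>

section \<open>The Markov operator of a random action\<close>

text \<open>A diagonal cocycle has no projective contraction uniform in the starting direction:
  vectors on its second invariant line shrink at rate \<open>L\<close>. The constants for nearby
  \<open>B\<close> thus degenerate as \<rho> tends to 0, and the task is to show that they do so
  only through \<open>ln (1 / \<rho>)\<close>. A line \<open>e_minus (B i)\<close> attaining the
  maximum in \<open>rho_minus\<close> is used because this bounds all upper right entries above by a
  multiple of \<rho> and one of them below by another; dividing by \<rho> then removes \<rho> from
  every hypothesis of the escape argument. Contraction comes from area: since the determinants have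
  modulus 1, two vectors span a constant area, so their projective distance shrinks when their norms
  grow. The power of the distance is of order 1/\<tau>^2 because the log norm over \<tau> steps is
  only controlled by a multiple of \<tau> and the quadratic term of an exponential must stay below
  the linear one. Quasi-additivity of the mean log growth yields its limit with an explicit error of
  order \<open>K\<close>, so the deviations can be centred at the limit itself.\<close>

definition markov_op :: "'s::finite pmf \<Rightarrow> ('s \<Rightarrow> 'v \<Rightarrow> 'v) \<Rightarrow> ('v \<Rightarrow> real) \<Rightarrow> 'v \<Rightarrow> real" where
  "markov_op p T f v = (\<Sum>l\<in>UNIV. pmf p l * f (T l v))"

lemma sum_pmf_UNIV: "(\<Sum>l\<in>UNIV. pmf (p::'s::finite pmf) l) = 1"
  by (rule sum_pmf_eq_1) auto

lemma markov_iter_Suc: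
  "(markov_op p T ^^ Suc n) f v = (\<Sum>l\<in>UNIV. pmf p l * (markov_op p T ^^ n) f (T l v))"
  by (simp add: markov_op_def)

text \<open>Only points reached from \<open>v\<close> by words of length \<open>n\<close> matter, so
  deterministic bounds along orbits of a given length, such as \<open>ln_norm_fold\<close>, can be
  averaged.\<close>

lemma markov_iter_mono:
  fixes p :: "'s::finite pmf"
  assumes "\<And>xs. length xs = n \<Longrightarrow> f (fold T xs v) \<le> g (fold T xs v)"
  shows "(markov_op p T ^^ n) f v \<le> (markov_op p T ^^ n) g v"
  using assms
proof (induction n arbitrary: v)
  case 0
  from 0[of "[]"] show ?case by simp
next
  case (Suc n)
  have "(markov_op p T ^^ n) f (T l v) \<le> (markov_op p T ^^ n) g (T l v)" for l
    using Suc.prems[of "l # xs" for xs] by (intro Suc.IH) auto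
  then show ?case
    unfolding markov_iter_Suc by (intro sum_mono mult_left_mono) auto
qed

lemma markov_iter_cong:
  fixes p :: "'s::finite pmf"
  assumes "\<And>xs. length xs = n \<Longrightarrow> f (fold T xs v) = g (fold T xs v)"
  shows "(markov_op p T ^^ n) f v = (markov_op p T ^^ n) g v"
  by (intro antisym markov_iter_mono) (simp_all add: assms)

lemma markov_iter_const [simp]:
  "(markov_op (p::'s::finite pmf) T ^^ n) (\<lambda>_. c) v = c"
  by (induction n arbitrary: v)
     (simp_all add: markov_op_def sum_pmf_UNIV flip: sum_distrib_right)

lemma markov_iter_add:
  "(markov_op (p::'s::finite pmf) T ^^ n) (\<lambda>v. f v + g v) v
     = (markov_op p T ^^ n) f v + (markov_op p T ^^ n) g v"
  by (induction n arbitrary: v) (simp_all add: markov_op_def distrib_left sum.distrib)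

lemma markov_iter_cmult:
  "(markov_op (p::'s::finite pmf) T ^^ n) (\<lambda>v. c * f v) v = c * (markov_op p T ^^ n) f v"
  by (induction n arbitrary: v) (simp_all add: markov_op_def sum_distrib_left mult_ac)

lemma markov_iter_diff:
  "(markov_op (p::'s::finite pmf) T ^^ n) (\<lambda>v. f v - g v) v
     = (markov_op p T ^^ n) f v - (markov_op p T ^^ n) g v"
  using markov_iter_add[of n p T f "\<lambda>v. - 1 * g v" v] markov_iter_cmult[of n p T "-1" g v] by simp

text \<open>Needed to recover each single chain from a pair of vectors driven by the same
  letters.\<close>

lemma markov_iter_semiconj:
  fixes p :: "'s::finite pmf"
  assumes "\<And>l v. \<pi> (T l v) = T' l (\<pi> v)"
  shows "(markov_op p T ^^ n) (\<lambda>v. f (\<pi> v)) v = (markov_op p T' ^^ n) f (\<pi> v)"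
  by (induction n arbitrary: v) (simp_all add: markov_op_def assms)

lemma markov_iter_telescope:
  fixes p :: "'s::finite pmf"
  shows "(markov_op p T ^^ n) f v - f v
     = (\<Sum>j<n. (markov_op p T ^^ j) (\<lambda>v. markov_op p T f v - f v) v)"
proof (induction n)
  case (Suc n)
  have "(markov_op p T ^^ n) (\<lambda>v. markov_op p T f v - f v) v
      = (markov_op p T ^^ Suc n) f v - (markov_op p T ^^ n) f v"
    by (simp add: markov_iter_diff funpow_swap1)
  with Suc show ?case by simp
qed simp

lemma fold_invariant:
  assumes "\<And>l v. v \<in> S \<Longrightarrow> T l v \<in> S" "v \<in> S"
  shows "fold T xs v \<in> S"
  using assms(2) by (induction xs arbitrary: v) (auto intro: assms(1))

lemma markov_iter_mono_inv:
  fixes p :: "'s::finite pmf"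
  assumes "\<And>l v. v \<in> S \<Longrightarrow> T l v \<in> S" "v \<in> S" "\<And>v. v \<in> S \<Longrightarrow> f v \<le> g v"
  shows "(markov_op p T ^^ n) f v \<le> (markov_op p T ^^ n) g v"
  by (intro markov_iter_mono assms(3) fold_invariant[of S T v, OF assms(1,2)])

text \<open>If \<open>\<theta> k \<le> h - Q\<^sup>m h + \<epsilon>\<close>, summing along the chain telescopes to \<open>m\<close> copies of \<open>h \<le> 1\<close>.\<close>

lemma markov_occupation_bound:
  fixes p :: "'s::finite pmf"
  assumes inv: "\<And>l v. v \<in> S \<Longrightarrow> T l v \<in> S" "v \<in> S"
    and h: "\<And>v. v \<in> S \<Longrightarrow> 0 \<le> h v" "\<And>v. v \<in> S \<Longrightarrow> h v \<le> 1"
    and k: "\<And>v. v \<in> S \<Longrightarrow> \<theta> * k v \<le> h v - (markov_op p T ^^ m) h v + \<epsilon>"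
  shows "\<theta> * (\<Sum>j<n. (markov_op p T ^^ j) k v) \<le> real m + real n * \<epsilon>"
proof -
  let ?Q = "\<lambda>j. (markov_op p T ^^ j)"
  have step: "\<theta> * ?Q j k v \<le> ?Q j h v - ?Q (j + m) h v + \<epsilon>" for j
  proof -
    have "?Q j (\<lambda>v. \<theta> * k v) v \<le> ?Q j (\<lambda>v. (h v - ?Q m h v) + \<epsilon>) v"
      by (rule markov_iter_mono_inv[where S=S, OF inv]) (use k in auto)
    then show ?thesis
      by (simp add: markov_iter_cmult markov_iter_add markov_iter_diff funpow_add)
  qed
  have nn: "0 \<le> ?Q j h v" for j
    using markov_iter_mono_inv[where S=S and f="\<lambda>_. 0" and g=h and p=p and n=j, OF inv] h by simp
  have le1: "?Q j h v \<le> 1" for j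
    using markov_iter_mono_inv[where S=S and g="\<lambda>_. 1" and f=h and p=p and n=j, OF inv] h by simp
  have tel: "(\<Sum>j<n. ?Q j h v - ?Q (j + m) h v) = (\<Sum>j<m. ?Q j h v) - (\<Sum>j<m. ?Q (n + j) h v)"
  proof (induction n)
    case (Suc n)
    have "(\<Sum>j<m. ?Q (Suc n + j) h v) + ?Q n h v = (\<Sum>j<Suc m. ?Q (n + j) h v)"
      by (simp add: sum.lessThan_Suc_shift del: funpow.simps sum.lessThan_Suc)
    then have "(\<Sum>j<m. ?Q (Suc n + j) h v) + ?Q n h v = (\<Sum>j<m. ?Q (n + j) h v) + ?Q (n + m) h v"
      by (simp del: funpow.simps)
    with Suc show ?case by (simp del: funpow.simps)
  qed simp
  have "\<theta> * (\<Sum>j<n. ?Q j k v) \<le> (\<Sum>j<n. ?Q j h v - ?Q (j + m) h v + \<epsilon>)"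
    unfolding sum_distrib_left by (intro sum_mono step)
  also have "\<dots> = (\<Sum>j<m. ?Q j h v) - (\<Sum>j<m. ?Q (n + j) h v) + real n * \<epsilon>"
    by (simp add: sum.distrib tel)
  also have "\<dots> \<le> (\<Sum>j<m. 1) - 0 + real n * \<epsilon>"
    by (intro add_mono diff_mono sum_mono sum_nonneg le1 nn order_refl)
  finally show ?thesis by simp
qed

text \<open>The word \<open>xs\<close> is followed with probability at least \<open>q ^ n\<close>,
  and off this event \<open>f\<close> is at most 1.\<close>

lemma markov_iter_path_bound:
  fixes p :: "'s::finite pmf"
  assumes f: "\<And>v. f v \<le> 1" and q: "0 \<le> q" "\<And>l. q \<le> pmf p l"
    and len: "length xs = n"
  shows "(markov_op p T ^^ n) f v \<le> 1 - q ^ n * (1 - f (fold T xs v))"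
  using len
proof (induction n arbitrary: xs v)
  case (Suc n)
  then obtain x ys where xs: "xs = x # ys" "length ys = n" by (cases xs) auto
  have le1: "(markov_op p T ^^ n) f w \<le> 1" for w
    using markov_iter_mono[of n f T w "\<lambda>_. 1" p] f by simp
  let ?g = "\<lambda>l. (markov_op p T ^^ n) f (T l v)"
  have "1 - (markov_op p T ^^ Suc n) f v = (\<Sum>l\<in>UNIV. pmf p l * (1 - ?g l))"
    by (simp add: markov_op_def right_diff_distrib sum_subtractf sum_pmf_UNIV)
  also have "\<dots> \<ge> pmf p x * (1 - ?g x)"
    by (intro member_le_sum) (auto simp: le1)
  finally have 1: "pmf p x * (1 - ?g x) \<le> 1 - (markov_op p T ^^ Suc n) f v" .
  have "q ^ n * (1 - f (fold T ys (T x v))) \<le> 1 - ?g x"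
    using Suc.IH[OF xs(2), of "T x v"] by simp
  then have "q * (q ^ n * (1 - f (fold T ys (T x v)))) \<le> pmf p x * (1 - ?g x)"
    using q f le1[of "T x v"] by (intro mult_mono) auto
  with 1 xs(1) show ?case by (simp add: mult_ac)
qed simp

section \<open>Escape from an almost invariant line\<close>

text \<open>By homogeneity one may take \<open>x + y = 1\<close>, and on the unit interval
  \<open>t \<le> t powr \<theta>\<close>.\<close>

lemma powr_add_le:
  fixes x y \<theta> :: real
  assumes "0 \<le> x" "0 \<le> y" "0 < \<theta>" "\<theta> \<le> 1"
  shows "(x + y) powr \<theta> \<le> x powr \<theta> + y powr \<theta>"
proof (cases "x + y = 0")
  case False
  then have pos: "0 < x + y" using assms by auto
  have 1: "t \<le> t powr \<theta>" if "0 \<le> t" "t \<le> 1" for t :: real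
    using powr_mono'[of \<theta> 1 t] that assms by (cases "t = 0") auto
  have "1 = x / (x + y) + y / (x + y)" using False by (simp flip: add_divide_distrib)
  also have "\<dots> \<le> (x / (x + y)) powr \<theta> + (y / (x + y)) powr \<theta>"
    using assms pos by (intro add_mono 1) auto
  also have "\<dots> = (x powr \<theta> + y powr \<theta>) / (x + y) powr \<theta>"
    using assms pos by (simp add: powr_divide add_divide_distrib)
  finally show ?thesis using pos by (simp add: field_simps)
qed (use assms in auto)

text \<open>In the coordinates \<open>(X, Y)\<close> the action is by matrices with rows \<open>(\<alpha>, \<beta>)\<close> and \<open>(\<gamma>, \<delta>)\<close>, where \<open>lo\<close> and \<open>hi\<close>
  bound \<open>\<bar>\<alpha>\<bar>\<close> from below and \<open>\<bar>\<delta>\<bar>\<close> from above. The function \<open>h\<close> below is 1 on the bad cone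
  \<open>\<bar>X\<bar> \<le> R \<bar>Y\<bar>\<close>, increases in mean by at most \<open>\<zeta>\<close> per step, and drops by a fixed amount in \<open>m + 1\<close> steps when
  started in that cone.\<close>

locale escape =
  fixes p :: "'s::finite pmf" and T :: "'s \<Rightarrow> 'v \<Rightarrow> 'v" and X Y :: "'v \<Rightarrow> real"
    and \<alpha> \<beta> \<gamma> \<delta> lo hi :: "'s \<Rightarrow> real"
    and L C c c1 \<theta> R \<eta> \<kappa> M q r :: real and m :: nat and i j :: 's
  assumes X_T: "\<And>l v. X (T l v) = \<alpha> l * X v + \<beta> l * Y v"
    and Y_T: "\<And>l v. Y (T l v) = \<gamma> l * X v + \<delta> l * Y v"
    and q: "0 < q" "\<And>l. q \<le> pmf p l"
    and pos: "0 < L" "0 < C" "0 < c" "0 < c1" "c1 \<le> 1" "0 < \<theta>" "\<theta> \<le> 1" "0 < R" "0 < \<eta>" "0 < \<kappa>" "\<kappa> < 1"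
      "\<And>l. 0 < lo l" "1 \<le> M" "\<eta> \<le> 1"
    and \<alpha>: "\<And>l. lo l + C / R \<le> \<bar>\<alpha> l\<bar>" "\<And>l. \<bar>\<alpha> l\<bar> \<le> M"
    and \<delta>: "\<And>l. \<bar>\<delta> l\<bar> \<le> hi l" "\<And>l. hi l \<le> M"
    and \<beta>: "\<And>l. \<bar>\<beta> l\<bar> \<le> C" and \<gamma>: "\<And>l. \<bar>\<gamma> l\<bar> \<le> \<eta>"
    and dt: "\<And>l. 1 / 2 \<le> \<bar>\<alpha> l * \<delta> l - \<beta> l * \<gamma> l\<bar>"
    and sum_lo: "3 * L / 4 \<le> (\<Sum>l\<in>UNIV. pmf p l * ln (lo l))"
    and sum_quot: "(\<Sum>l\<in>UNIV. pmf p l * (hi l / lo l) powr \<theta>) \<le> 1"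
    and R_L: "1 / R \<le> L / 4"
    and i: "\<beta> i = 0" "hi i \<le> \<kappa> * lo i" and j: "c \<le> \<bar>\<beta> j\<bar>"
    and c1: "M * c1 \<le> c / 2" "c1 * (\<eta> * c1 + M) \<le> c / 2"
    and m: "\<kappa> ^ m * R / c1 \<le> r / 2" "R * (\<eta> / lo i) / (1 - \<kappa>) \<le> r / 2" "r powr \<theta> \<le> 1 / 2"
begin

abbreviation "Q \<equiv> markov_op p T"

definition "N v = \<bar>X v\<bar> + \<bar>Y v\<bar>"

definition "h v = (if \<bar>X v\<bar> \<le> R * \<bar>Y v\<bar> then 1 else (R * \<bar>Y v\<bar> / \<bar>X v\<bar>) powr \<theta>)"

text \<open>The effect of the lower left entries: a vector on the first axis acquires slope at most
  \<open>\<eta> / lo l\<close>, and this is the mean of the resulting bound on \<open>h\<close>. It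
  tends to 0 with \<eta>.\<close>

definition "\<zeta> = (\<Sum>l\<in>UNIV. pmf p l * (R * \<eta> / lo l) powr \<theta>)"

lemma h_nonneg: "0 \<le> h v"
  by (simp add: h_def)

lemma h_le_powr:
  assumes "X v \<noteq> 0"
  shows "h v \<le> (R * \<bar>Y v\<bar> / \<bar>X v\<bar>) powr \<theta>"
proof (cases "\<bar>X v\<bar> \<le> R * \<bar>Y v\<bar>")
  case True
  then have "1 \<le> R * \<bar>Y v\<bar> / \<bar>X v\<bar>" using assms by (simp add: field_simps)
  then show ?thesis using True pos by (simp add: h_def ge_one_powr_ge_zero)
qed (simp add: h_def)

lemma h_le_1: "h v \<le> 1"
proof (cases "\<bar>X v\<bar> \<le> R * \<bar>Y v\<bar>")
  case False
  then have "0 < \<bar>X v\<bar>" using pos(8) by (smt (verit) mult_nonneg_nonneg)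
  then have "R * \<bar>Y v\<bar> / \<bar>X v\<bar> \<le> 1" using False by (simp add: field_simps)
  then show ?thesis using False pos by (simp add: h_def powr_le1)
qed (simp add: h_def)

text \<open>Outside the bad cone \<open>\<beta> l * Y v\<close> is at most \<open>C / R\<close>
  times \<open>\<bar>X v\<bar>\<close>, exactly the margin kept between \<open>lo l\<close> and
  \<open>\<bar>\<alpha> l\<bar>\<close>.\<close>

lemma X_T_lower:
  assumes "R * \<bar>Y v\<bar> < \<bar>X v\<bar>"
  shows "lo l * \<bar>X v\<bar> \<le> \<bar>X (T l v)\<bar>"
proof -
  have "\<bar>\<beta> l * Y v\<bar> \<le> C * (\<bar>X v\<bar> / R)"
    unfolding abs_mult using assms pos by (intro mult_mono \<beta>) (auto simp: field_simps)
  moreover have "(lo l + C / R) * \<bar>X v\<bar> \<le> \<bar>\<alpha> l * X v\<bar>"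
    unfolding abs_mult by (intro mult_right_mono \<alpha>) auto
  ultimately show ?thesis unfolding X_T by (simp add: distrib_right)
qed

lemma Y_T_upper: "\<bar>Y (T l v)\<bar> \<le> \<eta> * \<bar>X v\<bar> + hi l * \<bar>Y v\<bar>"
proof -
  have "\<bar>Y (T l v)\<bar> \<le> \<bar>\<gamma> l\<bar> * \<bar>X v\<bar> + \<bar>\<delta> l\<bar> * \<bar>Y v\<bar>"
    unfolding Y_T abs_mult[symmetric] by (rule abs_triangle_ineq)
  also have "\<dots> \<le> \<eta> * \<bar>X v\<bar> + hi l * \<bar>Y v\<bar>"
    by (intro add_mono mult_right_mono \<gamma> \<delta>) auto
  finally show ?thesis .
qed

lemma hi_nonneg: "0 \<le> hi l"
  using \<delta>(1)[of l] by linarith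

lemma \<zeta>_nonneg: "0 \<le> \<zeta>"
  unfolding \<zeta>_def by (intro sum_nonneg) auto

text \<open>On the bad cone \<open>h\<close> has its maximum 1. Outside it the rescaled slope
  \<open>u\<close> becomes at most \<open>R * \<eta> / lo l + hi l / lo l * u\<close>; the power
  \<theta> splits this sum, and the mean multiplier of \<open>u powr \<theta>\<close> is at most 1
  by \<open>sum_quot\<close>.\<close>

lemma h_superharmonic: "Q h v \<le> h v + \<zeta>"
proof (cases "\<bar>X v\<bar> \<le> R * \<bar>Y v\<bar>")
  case True
  have "Q h v \<le> (\<Sum>l\<in>UNIV. pmf p l * 1)"
    unfolding markov_op_def by (intro sum_mono mult_left_mono h_le_1) auto
  with True \<zeta>_nonneg show ?thesis by (simp add: h_def sum_pmf_UNIV)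
next
  case False
  then have X0: "0 < \<bar>X v\<bar>" using pos(8) by (smt (verit) mult_nonneg_nonneg)
  define u where "u = R * \<bar>Y v\<bar> / \<bar>X v\<bar>"
  have u0: "0 \<le> u" unfolding u_def using pos by auto
  have hv: "h v = u powr \<theta>" using False by (simp add: h_def u_def)
  have step: "h (T l v) \<le> (R * \<eta> / lo l) powr \<theta> + (hi l / lo l) powr \<theta> * u powr \<theta>" for l
  proof -
    have XT: "lo l * \<bar>X v\<bar> \<le> \<bar>X (T l v)\<bar>" using X_T_lower False by simp
    then have XT0: "0 < \<bar>X (T l v)\<bar>" using X0 pos(12)[of l] by (smt (verit) mult_pos_pos)
    have "R * \<bar>Y (T l v)\<bar> / \<bar>X (T l v)\<bar> \<le> R * (\<eta> * \<bar>X v\<bar> + hi l * \<bar>Y v\<bar>) / (lo l * \<bar>X v\<bar>)"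
      using XT X0 pos hi_nonneg
      by (intro frac_le mult_left_mono Y_T_upper) (auto intro!: mult_nonneg_nonneg add_nonneg_nonneg)
    also have "\<dots> = R * \<eta> / lo l + hi l / lo l * u"
      using X0 pos(12)[of l] by (simp add: u_def field_simps)
    finally have le: "R * \<bar>Y (T l v)\<bar> / \<bar>X (T l v)\<bar> \<le> R * \<eta> / lo l + hi l / lo l * u" .
    have nn: "0 \<le> R * \<eta> / lo l" "0 \<le> hi l / lo l"
      using pos(8,9) pos(12)[of l] hi_nonneg[of l] by auto
    have "h (T l v) \<le> (R * \<bar>Y (T l v)\<bar> / \<bar>X (T l v)\<bar>) powr \<theta>"
      using XT0 by (intro h_le_powr) auto
    also have "\<dots> \<le> (R * \<eta> / lo l + hi l / lo l * u) powr \<theta>"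
      using le pos by (intro powr_mono2) auto
    also have "\<dots> \<le> (R * \<eta> / lo l) powr \<theta> + (hi l / lo l * u) powr \<theta>"
      by (intro powr_add_le nn mult_nonneg_nonneg u0 pos)
    also have "(hi l / lo l * u) powr \<theta> = (hi l / lo l) powr \<theta> * u powr \<theta>"
      using nn u0 by (simp add: powr_mult del: times_divide_eq_left)
    finally show ?thesis .
  qed
  have "Q h v \<le> (\<Sum>l\<in>UNIV. pmf p l * ((R * \<eta> / lo l) powr \<theta> + (hi l / lo l) powr \<theta> * u powr \<theta>))"
    unfolding markov_op_def by (intro sum_mono mult_left_mono step) auto
  also have "\<dots> = \<zeta> + (\<Sum>l\<in>UNIV. pmf p l * (hi l / lo l) powr \<theta>) * u powr \<theta>"
    by (simp add: \<zeta>_def distrib_left sum.distrib sum_distrib_right mult.assoc)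
  also have "\<dots> \<le> \<zeta> + 1 * u powr \<theta>"
    by (intro add_left_mono mult_right_mono sum_quot) auto
  finally show ?thesis by (simp add: hv)
qed

lemma h_superharmonic_iter: "(Q ^^ n) h v \<le> h v + real n * \<zeta>"
proof (induction n)
  case (Suc n)
  have "(Q ^^ Suc n) h v = (Q ^^ n) (Q h) v" by (simp add: funpow_swap1)
  also have "\<dots> \<le> (Q ^^ n) (\<lambda>v. h v + \<zeta>) v"
    by (intro markov_iter_mono h_superharmonic)
  also have "\<dots> = (Q ^^ n) h v + \<zeta>" by (simp add: markov_iter_add)
  finally show ?case using Suc by (simp add: distrib_right)
qed simp

text \<open>Since \<open>\<beta> i = 0\<close>, the letter \<open>i\<close> scales \<open>X\<close>
  without admixture of \<open>Y\<close>, so the slope obeys an affine recursion with factor \<kappa>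
  and increment \<open>\<eta> / lo i\<close>; the bound is its geometric series.\<close>

lemma fold_i_ratio:
  assumes "c1 * \<bar>Y v\<bar> \<le> \<bar>X v\<bar>" "X v \<noteq> 0"
  shows "X (fold T (replicate n i) v) \<noteq> 0 \<and>
    \<bar>Y (fold T (replicate n i) v)\<bar> / \<bar>X (fold T (replicate n i) v)\<bar>
      \<le> \<kappa> ^ n / c1 + (\<eta> / lo i) * (1 - \<kappa> ^ n) / (1 - \<kappa>)"
proof (induction n)
  case 0
  then show ?case using assms pos by (simp add: field_simps)
next
  case (Suc n)
  define w where "w = fold T (replicate n i) v"
  define e where "e = \<eta> / lo i"
  have w: "fold T (replicate (Suc n) i) v = T i w"
    by (simp add: w_def replicate_append_same[symmetric] del: replicate.simps(2))
  have X0: "X w \<noteq> 0" and IH: "\<bar>Y w\<bar> / \<bar>X w\<bar> \<le> \<kappa> ^ n / c1 + e * (1 - \<kappa> ^ n) / (1 - \<kappa>)"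
    using Suc by (auto simp: w_def e_def)
  have "0 < C / R" using pos by simp
  then have lo: "lo i \<le> \<bar>\<alpha> i\<bar>" using \<alpha>(1)[of i] by linarith
  then have \<alpha>0: "0 < \<bar>\<alpha> i\<bar>" using pos(12)[of i] by linarith
  have XT: "\<bar>X (T i w)\<bar> = \<bar>\<alpha> i\<bar> * \<bar>X w\<bar>" by (simp add: X_T i abs_mult)
  have "\<bar>Y (T i w)\<bar> / \<bar>X (T i w)\<bar> \<le> (\<eta> * \<bar>X w\<bar> + hi i * \<bar>Y w\<bar>) / (lo i * \<bar>X w\<bar>)"
    unfolding XT using X0 lo pos(12)[of i] pos(9) hi_nonneg[of i]
    by (intro frac_le Y_T_upper mult_right_mono) auto
  also have "\<dots> = e + (hi i / lo i) * (\<bar>Y w\<bar> / \<bar>X w\<bar>)"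
    using X0 pos(12)[of i] by (simp add: e_def field_simps)
  also have "\<dots> \<le> e + \<kappa> * (\<bar>Y w\<bar> / \<bar>X w\<bar>)"
    using i pos(12)[of i] by (intro add_left_mono mult_right_mono) (auto simp: field_simps)
  also have "\<dots> \<le> e + \<kappa> * (\<kappa> ^ n / c1 + e * (1 - \<kappa> ^ n) / (1 - \<kappa>))"
    using IH pos by (intro add_left_mono mult_left_mono) auto
  also have "\<dots> = \<kappa> ^ Suc n / c1 + e * (1 - \<kappa> ^ Suc n) / (1 - \<kappa>)"
    using pos(11) by (simp add: field_simps)
  finally show ?case using \<alpha>0 X0 XT unfolding w e_def by auto
qed

lemma h_fold_i:
  assumes "c1 * \<bar>Y v\<bar> \<le> \<bar>X v\<bar>" "X v \<noteq> 0" "m \<le> n"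
  shows "h (fold T (replicate n i) v) \<le> 1 / 2"
proof -
  let ?w = "fold T (replicate n i) v"
  have e0: "0 \<le> \<eta> / lo i" using pos(9) pos(12)[of i] by simp
  from fold_i_ratio[OF assms(1,2), of n] have X0: "X ?w \<noteq> 0"
    and le: "\<bar>Y ?w\<bar> / \<bar>X ?w\<bar> \<le> \<kappa> ^ n / c1 + (\<eta> / lo i) * (1 - \<kappa> ^ n) / (1 - \<kappa>)" by auto
  note le
  also have "\<dots> \<le> \<kappa> ^ m / c1 + (\<eta> / lo i) * 1 / (1 - \<kappa>)"
    using pos assms(3) e0
    by (intro add_mono divide_right_mono mult_left_mono power_decreasing) auto
  finally have "R * (\<bar>Y ?w\<bar> / \<bar>X ?w\<bar>) \<le> R * (\<kappa> ^ m / c1 + (\<eta> / lo i) * 1 / (1 - \<kappa>))"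
    using pos by (intro mult_left_mono) auto
  also have "\<dots> = \<kappa> ^ m * R / c1 + R * (\<eta> / lo i) / (1 - \<kappa>)"
    by (simp add: distrib_left)
  also have "\<dots> \<le> r" using m by linarith
  finally have "(R * \<bar>Y ?w\<bar> / \<bar>X ?w\<bar>) powr \<theta> \<le> r powr \<theta>"
    using pos by (intro powr_mono2) auto
  with h_le_powr[OF X0] m(3) show ?thesis by linarith
qed

text \<open>If the slope is at most \<open>1 / c1\<close>, repeating \<open>i\<close> flattens it.
  Otherwise \<open>v\<close> is too close to the second axis, and one letter \<open>j\<close> first
  kicks it into that cone. The first word has one extra \<open>i\<close> so that both have length
  \<open>Suc m\<close>.\<close>

lemma h_escape:
  assumes "0 < N v"
  shows "(Q ^^ Suc m) h v \<le> 1 - q ^ Suc m / 2"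
proof -
  have "\<exists>xs. length xs = Suc m \<and> h (fold T xs v) \<le> 1 / 2"
  proof (cases "c1 * \<bar>Y v\<bar> \<le> \<bar>X v\<bar>")
    case True
    then have "X v \<noteq> 0" using assms pos by (auto simp: N_def mult_le_0_iff)
    with True h_fold_i[of v "Suc m"] show ?thesis
      by (intro exI[of _ "replicate (Suc m) i"]) auto
  next
    case False
    then have less: "\<bar>X v\<bar> < c1 * \<bar>Y v\<bar>" by simp
    then have Y0: "0 < \<bar>Y v\<bar>" using pos by (cases "Y v = 0") auto
    have "\<bar>\<alpha> j * X v\<bar> \<le> M * (c1 * \<bar>Y v\<bar>)"
      unfolding abs_mult using less pos by (intro mult_mono \<alpha>) auto
    also have "\<dots> \<le> c / 2 * \<bar>Y v\<bar>"
      unfolding mult.assoc[symmetric] by (intro mult_right_mono c1) auto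
    finally have "\<bar>\<alpha> j * X v\<bar> \<le> c / 2 * \<bar>Y v\<bar>" .
    moreover have "c * \<bar>Y v\<bar> \<le> \<bar>\<beta> j * Y v\<bar>"
      unfolding abs_mult by (intro mult_right_mono j) auto
    \<comment> \<open>The smallness of \<open>c1\<close> makes the contribution of
      \<open>X v\<close> at most half of the kick \<open>\<beta> j * Y v\<close>, so the two cannot
      cancel.\<close>
    ultimately have XT: "c / 2 * \<bar>Y v\<bar> \<le> \<bar>X (T j v)\<bar>" unfolding X_T by linarith
    have "\<bar>Y (T j v)\<bar> \<le> \<eta> * \<bar>X v\<bar> + hi j * \<bar>Y v\<bar>" by (rule Y_T_upper)
    also have "\<dots> \<le> \<eta> * (c1 * \<bar>Y v\<bar>) + M * \<bar>Y v\<bar>"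
      using less pos by (intro add_mono mult_left_mono mult_right_mono \<delta>) auto
    finally have "c1 * \<bar>Y (T j v)\<bar> \<le> c1 * (\<eta> * (c1 * \<bar>Y v\<bar>) + M * \<bar>Y v\<bar>)"
      using pos by (intro mult_left_mono) auto
    also have "\<dots> = c1 * (\<eta> * c1 + M) * \<bar>Y v\<bar>" by (simp add: algebra_simps)
    also have "\<dots> \<le> c / 2 * \<bar>Y v\<bar>" by (intro mult_right_mono c1) auto
    finally have "c1 * \<bar>Y (T j v)\<bar> \<le> \<bar>X (T j v)\<bar>" using XT by linarith
    moreover have "X (T j v) \<noteq> 0" using XT Y0 pos(3) by (smt (verit) half_gt_zero mult_pos_pos)
    ultimately show ?thesis using h_fold_i[of "T j v" m]
      by (intro exI[of _ "j # replicate m i"]) auto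
  qed
  then obtain xs where xs: "length xs = Suc m" "h (fold T xs v) \<le> 1 / 2" by blast
  have "q ^ Suc m * (1 / 2) \<le> q ^ Suc m * (1 - h (fold T xs v))"
    using xs q by (intro mult_left_mono) auto
  moreover have "(Q ^^ Suc m) h v \<le> 1 - q ^ Suc m * (1 - h (fold T xs v))"
    using q xs(1) by (intro markov_iter_path_bound h_le_1) auto
  ultimately show ?thesis by linarith
qed

section \<open>Mean growth of the log norm\<close>

definition "M' = 2 * (2 * M + C + 1)"

lemma M'_pos: "1 \<le> M'" using pos by (simp add: M'_def)

text \<open>Cramer's rule expresses \<open>X v\<close> and \<open>Y v\<close> through the image
  vector; the determinant is at least 1/2 in modulus, whence the factor 2 in
  \<open>M'\<close>.\<close>

lemma N_T_lower: "N v / M' \<le> N (T l v)"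
proof -
  let ?X = "X (T l v)" and ?Y = "Y (T l v)"
  let ?d = "\<alpha> l * \<delta> l - \<beta> l * \<gamma> l"
  have "\<bar>?d * X v\<bar> = \<bar>\<delta> l * ?X - \<beta> l * ?Y\<bar>" "\<bar>?d * Y v\<bar> = \<bar>\<alpha> l * ?Y - \<gamma> l * ?X\<bar>"
    unfolding X_T Y_T by (simp_all add: algebra_simps)
  moreover have "\<bar>\<delta> l * ?X\<bar> \<le> M * \<bar>?X\<bar>" "\<bar>\<beta> l * ?Y\<bar> \<le> C * \<bar>?Y\<bar>" "\<bar>\<alpha> l * ?Y\<bar> \<le> M * \<bar>?Y\<bar>"
    "\<bar>\<gamma> l * ?X\<bar> \<le> 1 * \<bar>?X\<bar>"
    unfolding abs_mult using \<alpha>(2)[of l] \<delta>[of l] \<beta>[of l] \<gamma>[of l] pos(14)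
    by (intro mult_right_mono; linarith)+
  ultimately have "\<bar>?d\<bar> * \<bar>X v\<bar> \<le> M * \<bar>?X\<bar> + C * \<bar>?Y\<bar>" "\<bar>?d\<bar> * \<bar>Y v\<bar> \<le> M * \<bar>?Y\<bar> + 1 * \<bar>?X\<bar>"
    unfolding abs_mult[symmetric] by linarith+
  moreover have "1 / 2 * \<bar>X v\<bar> \<le> \<bar>?d\<bar> * \<bar>X v\<bar>" "1 / 2 * \<bar>Y v\<bar> \<le> \<bar>?d\<bar> * \<bar>Y v\<bar>"
    by (intro mult_right_mono dt; simp)+
  moreover have "x + y \<le> 2 * (A + B)" if "P \<le> A" "P' \<le> B" "1 / 2 * x \<le> P" "1 / 2 * y \<le> P'"
    for x y A B P P' :: real using that by argo
  ultimately have "N v \<le> 2 * ((M * \<bar>?X\<bar> + C * \<bar>?Y\<bar>) + (M * \<bar>?Y\<bar> + 1 * \<bar>?X\<bar>))"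
    unfolding N_def by blast
  also have "\<dots> \<le> M' * N (T l v)"
  proof -
    have "0 \<le> M * \<bar>?X\<bar>" "0 \<le> M * \<bar>?Y\<bar>" "0 \<le> C * \<bar>?X\<bar>" using pos by auto
    then show ?thesis unfolding M'_def N_def by (simp add: algebra_simps)
  qed
  finally show ?thesis using M'_pos by (simp add: field_simps)
qed

lemma N_T_pos: "0 < N v \<Longrightarrow> 0 < N (T l v)"
  using N_T_lower[of v l] M'_pos by (smt (verit) divide_pos_pos)

text \<open>Chosen so that \<open>L / 2 - D0 = - ln M'\<close>, the worst possible one-step change
  of the log norm.\<close>

definition "D0 = L / 2 + ln M'"

lemma D0_pos: "0 < D0" using pos M'_pos by (simp add: D0_def add_pos_nonneg)

definition "bad v = (if \<bar>X v\<bar> \<le> R * \<bar>Y v\<bar> then 1 else (0::real))"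

text \<open>Outside the bad cone \<open>N v\<close> exceeds \<open>\<bar>X v\<bar>\<close> by a
  factor of at most \<open>1 + 1 / R\<close>, which costs \<open>L / 4\<close> of the drift
  \<open>3 * L / 4\<close> of \<open>ln \<bar>X v\<bar>\<close>.\<close>

lemma log_norm_drift:
  assumes "0 < N v"
  shows "L / 2 - D0 * bad v \<le> Q (\<lambda>v. ln (N v)) v - ln (N v)"
proof (cases "\<bar>X v\<bar> \<le> R * \<bar>Y v\<bar>")
  case True
  have "ln (N v) - ln M' \<le> ln (N (T l v))" for l
  proof -
    have "ln (N v / M') \<le> ln (N (T l v))"
      using N_T_lower[of v l] assms M'_pos by (intro ln_mono) auto
    then show ?thesis using assms M'_pos by (simp add: ln_div)
  qed
  then have "(\<Sum>l\<in>UNIV. pmf p l * (ln (N v) - ln M')) \<le> Q (\<lambda>v. ln (N v)) v"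
    unfolding markov_op_def by (intro sum_mono mult_left_mono) auto
  then show ?thesis using True
    by (simp add: bad_def D0_def sum_pmf_UNIV flip: sum_distrib_right)
next
  case False
  then have X0: "0 < \<bar>X v\<bar>" using pos(8) by (smt (verit) mult_nonneg_nonneg)
  have "N v \<le> \<bar>X v\<bar> * (1 + 1 / R)" using False pos(8) by (simp add: N_def field_simps)
  then have "ln (N v) \<le> ln (\<bar>X v\<bar> * (1 + 1 / R))" using assms by (intro ln_mono) auto
  also have "\<dots> = ln \<bar>X v\<bar> + ln (1 + 1 / R)"
    using X0 pos(8) add_pos_pos[of 1 "1 / R"] by (intro ln_mult_pos) auto
  also have "ln (1 + 1 / R) \<le> 1 / R" using pos(8) by (intro ln_add_one_self_le_self) auto
  finally have N_le: "ln (N v) \<le> ln \<bar>X v\<bar> + L / 4" using R_L by linarith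
  have "ln \<bar>X v\<bar> + ln (lo l) \<le> ln (N (T l v))" for l
  proof -
    have 1: "lo l * \<bar>X v\<bar> \<le> N (T l v)" using X_T_lower[of v l] False by (simp add: N_def)
    have "ln \<bar>X v\<bar> + ln (lo l) = ln (lo l * \<bar>X v\<bar>)" using X0 pos(12)[of l] by (simp add: ln_mult)
    also have "\<dots> \<le> ln (N (T l v))" using 1 X0 pos(12)[of l] by (intro ln_mono) auto
    finally show ?thesis .
  qed
  then have "(\<Sum>l\<in>UNIV. pmf p l * (ln \<bar>X v\<bar> + ln (lo l))) \<le> Q (\<lambda>v. ln (N v)) v"
    unfolding markov_op_def by (intro sum_mono mult_left_mono) auto
  then have "ln \<bar>X v\<bar> + 3 * L / 4 \<le> Q (\<lambda>v. ln (N v)) v" using sum_lo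
    by (simp add: distrib_left sum.distrib sum_pmf_UNIV flip: sum_distrib_right)
  with N_le False show ?thesis by (simp add: bad_def)
qed

text \<open>Summing the drift leaves the expected number of visits to the bad cone. The occupation
  bound controls it, with gain \<open>q ^ Suc m / 2\<close> per visit from \<open>h_escape\<close>.
  What grows with \<open>n\<close> in the error is proportional to \<zeta> and will be absorbed in
  half of the drift.\<close>

lemma log_norm_growth:
  assumes "0 < N v"
  shows "ln (N v) + real n * (L / 2)
      - D0 * (2 / q ^ Suc m) * (real (Suc m) + real n * (real (Suc m) * \<zeta>)) \<le> (Q ^^ n) (\<lambda>v. ln (N v)) v"
proof -
  let ?S = "{v. 0 < N v}"
  have inv: "\<And>l v. v \<in> ?S \<Longrightarrow> T l v \<in> ?S" "v \<in> ?S" using N_T_pos assms by auto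
  define B where "B = (\<Sum>k<n. (Q ^^ k) bad v)"
  have "q ^ Suc m / 2 * B \<le> real (Suc m) + real n * (real (Suc m) * \<zeta>)"
    unfolding B_def
  proof (rule markov_occupation_bound[where S="?S" and h=h, OF inv])
    fix v assume v: "v \<in> ?S"
    show "q ^ Suc m / 2 * bad v \<le> h v - (Q ^^ Suc m) h v + real (Suc m) * \<zeta>"
    proof (cases "\<bar>X v\<bar> \<le> R * \<bar>Y v\<bar>")
      case True
      then have [simp]: "bad v = 1" "h v = 1" by (auto simp: bad_def h_def)
      from h_escape[of v] v have "(Q ^^ Suc m) h v \<le> 1 - q ^ Suc m / 2" by simp
      moreover have "0 \<le> real (Suc m) * \<zeta>" using \<zeta>_nonneg by simp
      ultimately show ?thesis unfolding \<open>bad v = 1\<close> \<open>h v = 1\<close> by linarith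
    next
      case False
      then show ?thesis using h_superharmonic_iter[of "Suc m" v] by (simp add: bad_def del: funpow.simps)
    qed
  qed (auto simp: h_nonneg h_le_1)
  then have "B \<le> (2 / q ^ Suc m) * (real (Suc m) + real n * (real (Suc m) * \<zeta>))"
    using q(1) by (simp add: field_simps)
  then have B: "D0 * B \<le> D0 * ((2 / q ^ Suc m) * (real (Suc m) + real n * (real (Suc m) * \<zeta>)))"
    using D0_pos by (intro mult_left_mono) auto
  have "real n * (L / 2) - D0 * B = (\<Sum>k<n. (Q ^^ k) (\<lambda>v. L / 2 - D0 * bad v) v)"
    by (simp add: B_def markov_iter_diff markov_iter_cmult sum_subtractf sum_distrib_left)
  also have "\<dots> \<le> (\<Sum>k<n. (Q ^^ k) (\<lambda>v. Q (\<lambda>v. ln (N v)) v - ln (N v)) v)"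
    by (intro sum_mono markov_iter_mono_inv[where S="?S", OF inv]) (auto intro: log_norm_drift)
  also have "\<dots> = (Q ^^ n) (\<lambda>v. ln (N v)) v - ln (N v)"
    by (rule markov_iter_telescope[symmetric])
  finally show ?thesis using B by (simp add: mult.assoc)
qed

end

section \<open>Constants uniform over the perturbations\<close>

lemma exists_contracting_moment:
  fixes p :: "'s::finite pmf" and a :: "'s \<Rightarrow> real"
  assumes L: "0 < (\<Sum>l\<in>UNIV. pmf p l * ln \<bar>a l\<bar>)"
  shows "\<exists>\<theta>. 0 < \<theta> \<and> \<theta> \<le> 1 \<and> (\<Sum>l\<in>UNIV. pmf p l * exp (- 2 * \<theta> * ln \<bar>a l\<bar>)) < 1"
proof -
  let ?F = "\<lambda>\<theta>. \<Sum>l\<in>UNIV. pmf p l * exp (- 2 * \<theta> * ln \<bar>a l\<bar>)"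
  \<comment> \<open>At 0 the sum equals 1 and its derivative is -2 times the positive mean of
    \<open>ln \<bar>a l\<bar>\<close>, so it falls below 1 immediately to the right of 0.\<close>
  have "(?F has_real_derivative (\<Sum>l\<in>UNIV. pmf p l * (- 2 * ln \<bar>a l\<bar>))) (at 0)"
    by (auto intro!: derivative_eq_intros sum.cong)
  moreover have "(\<Sum>l\<in>UNIV. pmf p l * (- 2 * ln \<bar>a l\<bar>)) = - 2 * (\<Sum>l\<in>UNIV. pmf p l * ln \<bar>a l\<bar>)"
    by (simp add: sum_distrib_left mult_ac sum_negf)
  ultimately obtain d where d: "0 < d" "\<And>h. 0 < h \<Longrightarrow> h < d \<Longrightarrow> ?F (0 + h) < ?F 0"
    using DERIV_neg_dec_right[of ?F "- 2 * (\<Sum>l\<in>UNIV. pmf p l * ln \<bar>a l\<bar>)" 0] L by auto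
  show ?thesis
    using d(1) d(2)[of "min 1 (d / 2)"] by (intro exI[of _ "min 1 (d / 2)"]) (auto simp: sum_pmf_UNIV)
qed

text \<open>Small constants are chosen below by letting finitely many inequalities, each strict at
  0, hold simultaneously near 0.\<close>

lemma eventually_at_right_cont_less:
  fixes f :: "real \<Rightarrow> real"
  assumes "isCont f 0" "f 0 < k"
  shows "\<forall>\<^sub>F t in at_right 0. f t < k"
proof -
  have "(f \<longlongrightarrow> f 0) (at_right 0)"
    using assms(1) unfolding isCont_def by (rule filterlim_at_split[THEN iffD1, THEN conjunct2])
  then show ?thesis using assms(2) by (rule order_tendstoD)
qed

text \<open>All conditions are strict at \<open>\<tau> = 0\<close>: the drift since
  \<open>3 * L / 4 < L\<close>, the quotient since
  \<open>\<bar>b l\<bar> / \<bar>a l\<bar> = 1 / \<bar>a l\<bar>^2\<close> turns it into the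
  contracting moment. Here \<tau> is the tolerance on diagonal entries, and the last condition keeps
  letters with \<open>exp L \<le> \<bar>a i\<bar>\<close> contracting on slopes.\<close>

lemma exists_drift_margin:
  fixes p :: "'s::finite pmf" and a b :: "'s \<Rightarrow> real"
  assumes ab: "\<And>l. \<bar>a l * b l\<bar> = 1"
    and L: "L = (\<Sum>l\<in>UNIV. pmf p l * ln \<bar>a l\<bar>)" "0 < L"
  shows "\<exists>\<theta> \<tau>. 0 < \<theta> \<and> \<theta> \<le> 1 \<and> 0 < \<tau> \<and> \<tau> < 1 \<and> (\<forall>l. \<tau> < \<bar>a l\<bar>) \<and>
    3 * L / 4 \<le> (\<Sum>l\<in>UNIV. pmf p l * ln (\<bar>a l\<bar> - \<tau>)) \<and>
    (\<Sum>l\<in>UNIV. pmf p l * ((\<bar>b l\<bar> + \<tau>) / (\<bar>a l\<bar> - \<tau>)) powr \<theta>) \<le> 1 \<and>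
    2 * \<tau> < exp L - exp (- L)"
proof -
  have a0: "0 < \<bar>a l\<bar>" and b0: "0 < \<bar>b l\<bar>" for l using ab[of l] by auto
  have b: "\<bar>b l\<bar> = 1 / \<bar>a l\<bar>" for l using ab[of l] a0[of l] by (simp add: abs_mult field_simps)
  obtain \<theta> where \<theta>: "0 < \<theta>" "\<theta> \<le> 1" "(\<Sum>l\<in>UNIV. pmf p l * exp (- 2 * \<theta> * ln \<bar>a l\<bar>)) < 1"
    using exists_contracting_moment[of p a] L by auto
  have pw: "(\<bar>b l\<bar> / \<bar>a l\<bar>) powr \<theta> = exp (- 2 * \<theta> * ln \<bar>a l\<bar>)" for l
  proof -
    have "ln \<bar>b l\<bar> = - ln \<bar>a l\<bar>" unfolding b using a0[of l] by (simp add: ln_div)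
    then have "ln (\<bar>b l\<bar> / \<bar>a l\<bar>) = - 2 * ln \<bar>a l\<bar>" using a0[of l] b0[of l] by (subst ln_div) auto
    then show ?thesis using a0[of l] b0[of l] by (simp add: powr_def)
  qed
  have 1: "\<forall>\<^sub>F \<tau> in at_right 0. - (\<Sum>l\<in>UNIV. pmf p l * ln (\<bar>a l\<bar> - \<tau>)) < - (3 * L / 4)"
    using a0 b0 L by (intro eventually_at_right_cont_less continuous_intros) (auto simp: less_imp_neq)
  have 2: "\<forall>\<^sub>F \<tau> in at_right 0. (\<Sum>l\<in>UNIV. pmf p l * ((\<bar>b l\<bar> + \<tau>) / (\<bar>a l\<bar> - \<tau>)) powr \<theta>) < 1"
    using a0 b0 \<theta>(3)
    by (intro eventually_at_right_cont_less continuous_intros) (auto simp: less_imp_neq pw)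
  have 3: "\<forall>\<^sub>F \<tau> in at_right 0. \<forall>l. \<tau> < \<bar>a l\<bar>"
    using a0 by (intro eventually_all_finite eventually_at_right_cont_less continuous_intros) auto
  have 4: "\<forall>\<^sub>F \<tau> in at_right 0. 2 * \<tau> < exp L - exp (- L)"
    using L by (intro eventually_at_right_cont_less continuous_intros) auto
  have 5: "\<forall>\<^sub>F \<tau> in at_right 0. \<tau> < (1::real)"
    by (intro eventually_at_right_cont_less continuous_intros) auto
  have "\<forall>\<^sub>F \<tau> in at_right (0::real). 0 < \<tau>" by (rule eventually_at_right_less)
  with 1 2 3 4 5 have "\<forall>\<^sub>F \<tau> in at_right 0. 0 < \<tau> \<and> \<tau> < 1 \<and> (\<forall>l. \<tau> < \<bar>a l\<bar>) \<and>
    3 * L / 4 \<le> (\<Sum>l\<in>UNIV. pmf p l * ln (\<bar>a l\<bar> - \<tau>)) \<and>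
    (\<Sum>l\<in>UNIV. pmf p l * ((\<bar>b l\<bar> + \<tau>) / (\<bar>a l\<bar> - \<tau>)) powr \<theta>) \<le> 1 \<and>
    2 * \<tau> < exp L - exp (- L)"
    by eventually_elim auto
  from eventually_happens[OF this] \<theta>(1,2) show ?thesis
    by (auto simp: trivial_limit_at_right_real)
qed

text \<open>The order of quantifiers is the point: \<eta> and \<open>D\<close> are fixed before the
  action and its coordinates, so they will not see the factor \<rho> that is later hidden in
  \<open>Y\<close>.\<close>

lemma uniform_drift:
  fixes p :: "'s::finite pmf" and a b :: "'s \<Rightarrow> real" and C c :: real
  assumes supp: "set_pmf p = UNIV"
    and ab: "\<And>l. \<bar>a l * b l\<bar> = 1"
    and L: "L = (\<Sum>l\<in>UNIV. pmf p l * ln \<bar>a l\<bar>)" "0 < L"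
    and C: "0 < C" and c: "0 < c"
  shows "\<exists>\<eta> D. 0 < \<eta> \<and> (\<forall>(T::'s \<Rightarrow> 'v \<Rightarrow> 'v) X Y \<alpha> \<beta> \<gamma> \<delta> i j.
     (\<forall>l v. X (T l v) = \<alpha> l * X v + \<beta> l * Y v) \<longrightarrow> (\<forall>l v. Y (T l v) = \<gamma> l * X v + \<delta> l * Y v) \<longrightarrow>
     (\<forall>l. \<bar>\<alpha> l - a l\<bar> \<le> \<eta> \<and> \<bar>\<delta> l - b l\<bar> \<le> \<eta> \<and> \<bar>\<gamma> l\<bar> \<le> \<eta> \<and> \<bar>\<beta> l\<bar> \<le> C) \<longrightarrow>
     \<beta> i = 0 \<longrightarrow> exp L \<le> \<bar>a i\<bar> \<longrightarrow> c \<le> \<bar>\<beta> j\<bar> \<longrightarrow>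
     (\<forall>n v. 0 < \<bar>X v\<bar> + \<bar>Y v\<bar> \<longrightarrow>
        ln (\<bar>X v\<bar> + \<bar>Y v\<bar>) + real n * (L / 4) - D \<le> (markov_op p T ^^ n) (\<lambda>v. ln (\<bar>X v\<bar> + \<bar>Y v\<bar>)) v))"
proof -
  have a0: "0 < \<bar>a l\<bar>" and b0: "0 < \<bar>b l\<bar>" for l using ab[of l] by auto
  have b: "\<bar>b l\<bar> = 1 / \<bar>a l\<bar>" for l using ab[of l] a0[of l] by (simp add: abs_mult field_simps)
  obtain \<theta> \<tau> where \<theta>: "0 < \<theta>" "\<theta> \<le> 1" and \<tau>: "0 < \<tau>" "\<tau> < 1" "\<And>l. \<tau> < \<bar>a l\<bar>"
    and sum_lo: "3 * L / 4 \<le> (\<Sum>l\<in>UNIV. pmf p l * ln (\<bar>a l\<bar> - \<tau>))"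
    and sum_quot: "(\<Sum>l\<in>UNIV. pmf p l * ((\<bar>b l\<bar> + \<tau>) / (\<bar>a l\<bar> - \<tau>)) powr \<theta>) \<le> 1"
    and \<tau>L: "2 * \<tau> < exp L - exp (- L)"
    using exists_drift_margin[of a b L p, OF ab L] by blast
  define lo where "lo l = \<bar>a l\<bar> - \<tau>" for l
  define hi where "hi l = \<bar>b l\<bar> + \<tau>" for l
  have lo0: "0 < lo l" for l using \<tau>(3)[of l] by (simp add: lo_def)
  then have lo_neq: "lo l \<noteq> 0" for l by (metis less_irrefl)
  define M where "M = 1 + (\<Sum>l\<in>UNIV. \<bar>a l\<bar> + \<bar>b l\<bar>)"
  have M: "\<bar>a l\<bar> + 1 \<le> M" "\<bar>b l\<bar> + 1 \<le> M" for l
    using member_le_sum[of l UNIV "\<lambda>l. \<bar>a l\<bar> + \<bar>b l\<bar>"] by (auto simp: M_def)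
  have M1: "1 \<le> M" using M[of undefined] by linarith
  \<comment> \<open>The first entry makes \<open>C / R\<close> at most half of the tolerance \<tau>,
    the other half being reserved for \<eta>; the second yields \<open>R_L\<close>.\<close>
  define R where "R = max (2 * C / \<tau>) (4 / L)"
  have R0: "0 < R" using C \<tau> L by (simp add: R_def less_max_iff_disj)
  have "4 / L \<le> R" "2 * C / \<tau> \<le> R" by (simp_all add: R_def)
  then have R: "1 / R \<le> L / 4" "C / R \<le> \<tau> / 2"
    using R0 L(2) \<tau>(1) C by (simp_all add: field_simps)
  define q where "q = Min (range (pmf p))"
  have q: "0 < q" "\<And>l. q \<le> pmf p l"
  proof -
    have "0 < pmf p l" for l using supp by (intro pmf_positive) auto
    then show "0 < q" unfolding q_def by (subst Min_gr_iff) auto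
  qed (auto simp: q_def)
  define c1 where "c1 = min 1 (c / (2 * (M + 1)))"
  have c1: "0 < c1" "c1 \<le> 1" using c M1 by (auto simp: c1_def)
  have "c1 * (M + 1) \<le> c / (2 * (M + 1)) * (M + 1)"
    using M1 by (intro mult_right_mono) (auto simp: c1_def)
  also have "\<dots> = c / 2" using M1 by (simp add: field_simps)
  finally have c1': "c1 * (M + 1) \<le> c / 2" .
  \<comment> \<open>Bounds \<open>hi i / lo i\<close> for every letter with
    \<open>exp L \<le> \<bar>a i\<bar>\<close>, where
    \<open>\<bar>b i\<bar> \<le> exp (- L)\<close>.\<close>
  define \<kappa> where "\<kappa> = (exp (- L) + \<tau>) / (exp L - \<tau>)"
  have eL: "0 < exp L - \<tau>" using \<tau>L \<tau>(1) exp_gt_zero[of "- L"] by linarith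
  have \<kappa>: "0 < \<kappa>" "\<kappa> < 1" using \<tau>L \<tau>(1) eL by (auto simp: \<kappa>_def add_pos_pos)
  have \<kappa>i: "hi i \<le> \<kappa> * lo i" if "exp L \<le> \<bar>a i\<bar>" for i
  proof -
    have "\<bar>b i\<bar> \<le> 1 / exp L" unfolding b using that a0[of i] by (intro divide_left_mono) auto
    moreover have "\<kappa> * (exp L - \<tau>) = 1 / exp L + \<tau>" using eL by (simp add: \<kappa>_def exp_minus divide_inverse)
    ultimately have "hi i \<le> \<kappa> * (exp L - \<tau>)" by (simp add: hi_def)
    also have "\<dots> \<le> \<kappa> * lo i" using that \<kappa> by (intro mult_left_mono) (auto simp: lo_def)
    finally show ?thesis .
  qed
  define r where "r = (1 / 2 :: real) powr (1 / \<theta>)"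
  have r: "0 < r" "r powr \<theta> \<le> 1 / 2" using \<theta> by (auto simp: r_def powr_powr)
  have "(\<lambda>m. \<kappa> ^ m) \<longlonglongrightarrow> 0" using \<kappa> by (intro LIMSEQ_power_zero) auto
  then have "\<forall>\<^sub>F m in sequentially. \<kappa> ^ m < r * c1 / (2 * R)"
    using r c1 R0 by (intro order_tendstoD) auto
  then obtain m where m: "\<kappa> ^ m < r * c1 / (2 * R)" using eventually_happens[of _ sequentially] by auto
  \<comment> \<open>\<open>E0\<close> and \<open>Z \<eta>\<close> are the constants
    \<open>D0\<close> and \<zeta> of the locale, written down before \<eta> is known. Since
    \<open>K\<close> does not involve \<eta>, the latter can be chosen afterwards to make
    \<open>K * Z \<eta>\<close> small.\<close>
  define E0 where "E0 = L / 2 + ln (2 * (2 * M + C + 1))"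
  define Z where "Z \<eta> = (\<Sum>l\<in>UNIV. pmf p l * (R * \<eta> / lo l) powr \<theta>)" for \<eta>
  define K where "K = E0 * (2 / q ^ Suc m) * real (Suc m)"
  have E00: "0 < E0" using L C M1 by (auto simp: E0_def intro!: add_pos_nonneg)
  have K0: "0 < K" using E00 q by (simp add: K_def del: power_Suc of_nat_Suc)
  have 0: "\<forall>\<^sub>F \<eta> in at_right (0::real). 0 < \<eta>" by (rule eventually_at_right_less)
  have 1: "\<forall>\<^sub>F \<eta> in at_right 0. \<eta> < \<tau> / 2"
    using \<tau> by (intro eventually_at_right_cont_less continuous_intros) auto
  have 2: "\<forall>\<^sub>F \<eta> in at_right 0. \<eta> * (2 * M + C) < 1 / 2"
    by (intro eventually_at_right_cont_less continuous_intros) auto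
  have 3: "\<forall>\<^sub>F \<eta> in at_right 0. \<forall>l. R * (\<eta> / lo l) / (1 - \<kappa>) < r / 2"
    using r lo_neq \<kappa> by (intro eventually_all_finite eventually_at_right_cont_less continuous_intros) auto
  have "((\<lambda>\<eta>. K * Z \<eta>) \<longlongrightarrow> K * (\<Sum>l\<in>UNIV. pmf p l * (R * 0 / lo l) powr \<theta>)) (at_right 0)"
    unfolding Z_def using \<theta> lo0 lo_neq R0 0
    by (intro tendsto_intros tendsto_powr'[OF _ tendsto_const]) (auto elim!: eventually_mono intro!: divide_nonneg_pos)
  then have 4: "\<forall>\<^sub>F \<eta> in at_right 0. K * Z \<eta> < L / 4"
    using L \<theta> by (intro order_tendstoD) auto
  from 0 1 2 3 4 have "\<forall>\<^sub>F \<eta> in at_right 0. 0 < \<eta> \<and> \<eta> < \<tau> / 2 \<and> \<eta> * (2 * M + C) < 1 / 2 \<and>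
      (\<forall>l. R * (\<eta> / lo l) / (1 - \<kappa>) < r / 2) \<and> K * Z \<eta> < L / 4"
    by eventually_elim auto
  from eventually_happens[OF this] obtain \<eta> where \<eta>: "0 < \<eta>" "\<eta> < \<tau> / 2" "\<eta> * (2 * M + C) < 1 / 2"
      "\<And>l. R * (\<eta> / lo l) / (1 - \<kappa>) < r / 2" "K * Z \<eta> < L / 4"
    by (auto simp: trivial_limit_at_right_real)
  show ?thesis
  proof (rule exI[of _ \<eta>], rule exI[of _ K], intro conjI \<eta>(1) allI impI)
    fix T :: "'s \<Rightarrow> 'v \<Rightarrow> 'v" and X Y \<alpha> \<beta> \<gamma> \<delta> i j n v
    assume X_T: "\<forall>l v. X (T l v) = \<alpha> l * X v + \<beta> l * Y v" and Y_T: "\<forall>l v. Y (T l v) = \<gamma> l * X v + \<delta> l * Y v"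
      and close: "\<forall>l. \<bar>\<alpha> l - a l\<bar> \<le> \<eta> \<and> \<bar>\<delta> l - b l\<bar> \<le> \<eta> \<and> \<bar>\<gamma> l\<bar> \<le> \<eta> \<and> \<bar>\<beta> l\<bar> \<le> C"
      and i: "\<beta> i = 0" "exp L \<le> \<bar>a i\<bar>" and j: "c \<le> \<bar>\<beta> j\<bar>" and v: "0 < \<bar>X v\<bar> + \<bar>Y v\<bar>"
    have cl: "\<bar>\<alpha> l - a l\<bar> \<le> \<eta>" "\<bar>\<delta> l - b l\<bar> \<le> \<eta>" "\<bar>\<gamma> l\<bar> \<le> \<eta>" "\<bar>\<beta> l\<bar> \<le> C" for l
      using close by auto
    interpret escape p T X Y \<alpha> \<beta> \<gamma> \<delta> lo hi L C c c1 \<theta> R \<eta> \<kappa> M q r m i j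
    proof
      show "X (T l v) = \<alpha> l * X v + \<beta> l * Y v" "Y (T l v) = \<gamma> l * X v + \<delta> l * Y v" for l v
        using X_T Y_T by auto
      show "lo l + C / R \<le> \<bar>\<alpha> l\<bar>" "\<bar>\<alpha> l\<bar> \<le> M" "\<bar>\<delta> l\<bar> \<le> hi l" "hi l \<le> M" "\<bar>\<beta> l\<bar> \<le> C" "\<bar>\<gamma> l\<bar> \<le> \<eta>" for l
        unfolding lo_def hi_def
        using cl[of l] R(2) \<eta>(2) \<tau>(1,2) M[of l] by linarith+
      show "1 / 2 \<le> \<bar>\<alpha> l * \<delta> l - \<beta> l * \<gamma> l\<bar>" for l
      proof -
        have \<delta>M: "\<bar>\<delta> l\<bar> \<le> M" using cl[of l] M[of l] \<eta> \<tau> by linarith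
        have "\<bar>(\<alpha> l - a l) * \<delta> l\<bar> \<le> \<eta> * M" "\<bar>a l * (\<delta> l - b l)\<bar> \<le> M * \<eta>" "\<bar>\<beta> l * \<gamma> l\<bar> \<le> C * \<eta>"
          unfolding abs_mult using cl[of l] \<delta>M M[of l] C \<eta>(1) by (auto intro!: mult_mono)
        moreover have "\<alpha> l * \<delta> l - \<beta> l * \<gamma> l = a l * b l + (\<alpha> l - a l) * \<delta> l + a l * (\<delta> l - b l) - \<beta> l * \<gamma> l"
          by (simp add: algebra_simps)
        moreover have "\<eta> * (2 * M + C) = \<eta> * M + M * \<eta> + C * \<eta>" by (simp add: algebra_simps)
        ultimately show ?thesis using ab[of l] \<eta>(3) by linarith
      qed
      show "M * c1 \<le> c / 2" using c1 c1' by (simp add: algebra_simps)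
      have "\<eta> * c1 \<le> 1 * 1" using \<eta> \<tau> c1 by (intro mult_mono) auto
      then have "c1 * (\<eta> * c1 + M) \<le> c1 * (M + 1)" using c1 by (intro mult_left_mono) auto
      then show "c1 * (\<eta> * c1 + M) \<le> c / 2" using c1' by linarith
      show "\<kappa> ^ m * R / c1 \<le> r / 2" using m R0 c1 by (simp add: field_simps)
      show "hi i \<le> \<kappa> * lo i" using \<kappa>i i by auto
      show "3 * L / 4 \<le> (\<Sum>l\<in>UNIV. pmf p l * ln (lo l))" "(\<Sum>l\<in>UNIV. pmf p l * (hi l / lo l) powr \<theta>) \<le> 1"
        using sum_lo sum_quot by (auto simp: lo_def hi_def)
      show "R * (\<eta> / lo i) / (1 - \<kappa>) \<le> r / 2" using \<eta>(4)[of i] by simp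
    qed (use \<eta> \<tau> q L C c c1 \<theta> R R0 \<kappa> lo0 M1 i j r in auto)
    have "ln (N v) + real n * (L / 2)
      - E0 * (2 / q ^ Suc m) * (real (Suc m) + real n * (real (Suc m) * Z \<eta>)) \<le> (Q ^^ n) (\<lambda>v. ln (N v)) v"
    proof -
      have "D0 = E0" "\<zeta> = Z \<eta>" by (simp_all add: D0_def M'_def E0_def \<zeta>_def Z_def)
      then show ?thesis using log_norm_growth[of v n] v by (simp only: N_def)
    qed
    moreover have "E0 * (2 / q ^ Suc m) * (real (Suc m) + real n * (real (Suc m) * Z \<eta>)) = K + real n * (K * Z \<eta>)"
      unfolding K_def by (simp add: algebra_simps add_divide_distrib)
    moreover have "real n * (K * Z \<eta>) \<le> real n * (L / 4)" using \<eta>(5) by (intro mult_left_mono) auto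
    ultimately have "ln (N v) + real n * (L / 4) - K \<le> (Q ^^ n) (\<lambda>v. ln (N v)) v" by argo
    then show "ln (\<bar>X v\<bar> + \<bar>Y v\<bar>) + real n * (L / 4) - K \<le> (Q ^^ n) (\<lambda>v. ln (\<bar>X v\<bar> + \<bar>Y v\<bar>)) v"
      by (simp add: N_def)
  qed
qed

section \<open>Contraction of the projective action\<close>

definition cross2 :: "real^2 \<Rightarrow> real^2 \<Rightarrow> real" where
  "cross2 v w = v $ 1 * w $ 2 - v $ 2 * w $ 1"

lemma cross2_matrix: "cross2 (M *v v) (M *v w) = det M * cross2 v (w :: real^2)"
  by (simp add: cross2_def det_2 matrix_vector_mult_def sum_2 algebra_simps)

text \<open>Lagrange's identity, that is, the sum of the squares of sine and cosine of the
  angle.\<close>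

lemma cross2_sq: "(cross2 v w)\<^sup>2 + (v \<bullet> w)\<^sup>2 = (norm v)\<^sup>2 * (norm w)\<^sup>2"
  unfolding power2_norm_eq_inner
  by (simp add: cross2_def inner_vec_def sum_2 power2_eq_square algebra_simps)

lemma abs_cross2_le: "\<bar>cross2 v w\<bar> \<le> norm v * norm w"
proof -
  have "(cross2 v w)\<^sup>2 \<le> (norm v * norm w)\<^sup>2"
    using cross2_sq[of v w] by (simp add: power_mult_distrib) (smt (verit) zero_le_power2)
  then show ?thesis by (simp add: abs_le_square_iff flip: abs_le_square_iff)
qed

text \<open>The modulus of the sine of the angle, written so that a matrix of determinant 1 or -1
  changes only the denominator.\<close>

definition pdist :: "real^2 \<Rightarrow> real^2 \<Rightarrow> real" where
  "pdist v w = \<bar>cross2 v w\<bar> / (norm v * norm w)"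

lemma pdist_nonneg: "0 \<le> pdist v w" by (simp add: pdist_def)

lemma pdist_le_1: "pdist v w \<le> 1"
  unfolding pdist_def using abs_cross2_le[of v w]
  by (cases "norm v * norm w = 0") (auto simp: divide_le_eq_1)

lemma pdist_commute: "pdist v w = pdist w v"
  by (simp add: pdist_def cross2_def mult.commute abs_minus_commute)

text \<open>With the sign for which the angle is not obtuse, the squared chord is
  \<open>2 - 2 * c\<close>, and \<open>4 * (1 - c\<^sup>2)\<close> exceeds it by
  \<open>2 * (1 - c) * (1 + 2 * c)\<close>.\<close>

lemma unit_vectors_close_up_to_sign:
  assumes "norm v = 1" "norm w = 1"
  shows "\<exists>s. \<bar>s\<bar> = 1 \<and> norm (v - s *\<^sub>R w) \<le> 2 * \<bar>cross2 v w\<bar>"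
proof -
  define s :: real where "s = (if v \<bullet> w \<ge> 0 then 1 else - 1)"
  define c where "c = \<bar>v \<bullet> w\<bar>"
  have "(norm (v - s *\<^sub>R w))\<^sup>2 = 2 - 2 * c"
    using assms unfolding power2_norm_eq_inner
    by (auto simp: inner_diff_left inner_diff_right inner_commute s_def c_def norm_eq_1)
  moreover have "(cross2 v w)\<^sup>2 = 1 - c\<^sup>2" using cross2_sq[of v w] assms by (simp add: c_def)
  moreover have "c \<le> 1" using Cauchy_Schwarz_ineq2[of v w] assms by (simp add: c_def)
  then have "0 \<le> (1 - c) * (1 + 2 * c)" by (auto simp: c_def)
  ultimately have "(norm (v - s *\<^sub>R w))\<^sup>2 \<le> (2 * \<bar>cross2 v w\<bar>)\<^sup>2"
    by (simp add: power_mult_distrib algebra_simps power2_eq_square)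
  then have "norm (v - s *\<^sub>R w) \<le> 2 * \<bar>cross2 v w\<bar>" by (rule power2_le_imp_le) auto
  then show ?thesis by (intro exI[of _ s]) (auto simp: s_def)
qed

text \<open>Up to sign, unit vectors differ by at most \<open>2 * pdist v w\<close>, so their images
  differ by \<open>M\<close> times this; relative to an image of length at least
  \<open>1 / M\<close> that is a factor \<open>1 + 2 * M\<^sup>2 * pdist v w\<close>.\<close>

lemma log_expansion_lipschitz:
  fixes B :: "real^2^2"
  assumes up: "\<And>v. norm (B *v v) \<le> M * norm v" and lo: "\<And>v. norm v \<le> M * norm (B *v v)"
    and "0 < M" "v \<noteq> 0" "w \<noteq> 0"
  shows "(ln (norm (B *v w)) - ln (norm w)) - (ln (norm (B *v v)) - ln (norm v)) \<le> 2 * M\<^sup>2 * pdist v w"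
proof -
  let ?v = "v /\<^sub>R norm v" and ?w = "w /\<^sub>R norm w"
  have n1: "norm ?v = 1" "norm ?w = 1" using assms by auto
  have "\<bar>cross2 ?w ?v\<bar> = pdist w v"
    by (simp add: cross2_def pdist_def field_simps abs_mult flip: right_diff_distrib)
       (simp add: divide_simps abs_mult flip: right_diff_distrib)
  then have cr: "\<bar>cross2 ?w ?v\<bar> = pdist v w" by (simp add: pdist_commute)
  obtain s where s: "\<bar>s\<bar> = 1" "norm (?w - s *\<^sub>R ?v) \<le> 2 * pdist v w"
    using unit_vectors_close_up_to_sign[OF n1(2,1)] cr by auto
  have sc: "norm (B *v (x /\<^sub>R norm x)) = norm (B *v x) / norm x" for x
    by (simp add: matrix_vector_mult_scaleR divide_inverse)
  have pos: "0 < norm (B *v x)" if "x \<noteq> 0" for x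
    using lo[of x] that by (cases "B *v x = 0") auto
  have Bv: "1 \<le> M * norm (B *v ?v)" using lo[of ?v] n1 by simp
  have "norm (B *v ?w) = norm (s *\<^sub>R (B *v ?v) + B *v (?w - s *\<^sub>R ?v))"
    by (simp add: matrix_vector_mult_diff_distrib matrix_vector_mult_scaleR)
  also have "\<dots> \<le> norm (s *\<^sub>R (B *v ?v)) + norm (B *v (?w - s *\<^sub>R ?v))" by (rule norm_triangle_ineq)
  also have "\<dots> \<le> norm (B *v ?v) + M * (2 * pdist v w)"
    using s up[of "?w - s *\<^sub>R ?v"] \<open>0 < M\<close>
    by (intro add_mono) (auto intro: order_trans mult_left_mono)
  also have "\<dots> \<le> norm (B *v ?v) + (M * norm (B *v ?v)) * (M * (2 * pdist v w))"
    using mult_right_mono[OF Bv, of "M * (2 * pdist v w)"] \<open>0 < M\<close> pdist_nonneg[of v w] by simp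
  also have "\<dots> = norm (B *v ?v) * (1 + 2 * M\<^sup>2 * pdist v w)"
    by (simp add: algebra_simps power2_eq_square)
  finally have "norm (B *v w) / norm w \<le> norm (B *v v) / norm v * (1 + 2 * M\<^sup>2 * pdist v w)"
    unfolding sc .
  then have "ln (norm (B *v w) / norm w) \<le> ln (norm (B *v v) / norm v * (1 + 2 * M\<^sup>2 * pdist v w))"
    using pos assms by (intro ln_mono) auto
  also have "\<dots> = ln (norm (B *v v) / norm v) + ln (1 + 2 * M\<^sup>2 * pdist v w)"
    using pos assms pdist_nonneg[of v w] by (intro ln_mult_pos) (auto intro!: add_pos_nonneg)
  also have "ln (1 + 2 * M\<^sup>2 * pdist v w) \<le> 2 * M\<^sup>2 * pdist v w"
    using pdist_nonneg[of v w] by (intro ln_add_one_self_le_self) auto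
  finally show ?thesis using pos assms by (simp add: ln_div)
qed

lemma exp_le_quadratic:
  fixes x :: real
  assumes "\<bar>x\<bar> \<le> 1"
  shows "exp x \<le> 1 + x + x\<^sup>2"
proof (cases "0 \<le> x")
  case True
  then show ?thesis using assms by (intro exp_bound) auto
next
  case False
  have "1 - x \<le> exp (- x)" using exp_ge_add_one_self[of "- x"] by simp
  then have "exp x \<le> 1 / (1 - x)" using False by (simp add: exp_minus field_simps)
  moreover have "1 \<le> (1 - x) * (1 + x + x\<^sup>2)"
    using False by (simp add: algebra_simps power2_eq_square mult_nonpos_nonneg mult_nonneg_nonpos)
  then have "1 / (1 - x) \<le> 1 + x + x\<^sup>2" using False by (simp add: divide_le_eq mult.commute)
  ultimately show ?thesis by linarith
qed

definition log_growth :: "'s::finite pmf \<Rightarrow> ('s \<Rightarrow> real^2^2) \<Rightarrow> nat \<Rightarrow> real^2 \<Rightarrow> real" where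
  "log_growth p B n v = (markov_op p (\<lambda>l v. B l *v v) ^^ n) (\<lambda>v. ln (norm v)) v - ln (norm v)"

locale bounded_cocycle =
  fixes p :: "'s::finite pmf" and B :: "'s \<Rightarrow> real^2^2" and M :: real
  assumes B_upper: "\<And>l v. norm (B l *v v) \<le> M * norm v"
    and B_lower: "\<And>l v. norm v \<le> M * norm (B l *v v)"
    and M_ge: "exp 1 \<le> M"
begin

abbreviation "T \<equiv> \<lambda>l v. B l *v v"
abbreviation "Q \<equiv> markov_op p T"

lemma M_pos: "0 < M" and ln_M: "1 \<le> ln M"
proof -
  show "0 < M" using M_ge exp_gt_zero[of 1] by linarith
  then show "1 \<le> ln M" using M_ge by (simp add: ln_ge_iff)
qed

lemma B_nonzero: "v \<noteq> 0 \<Longrightarrow> B l *v v \<noteq> 0"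
  using B_lower[of v l] by auto

lemma fold_nonzero: "v \<noteq> 0 \<Longrightarrow> fold T xs v \<noteq> 0"
  by (induction xs arbitrary: v) (auto simp: B_nonzero)

lemma ln_norm_step:
  assumes "v \<noteq> 0"
  shows "\<bar>ln (norm (B l *v v)) - ln (norm v)\<bar> \<le> ln M"
proof -
  have "ln (norm (B l *v v)) \<le> ln (M * norm v)" "ln (norm v) \<le> ln (M * norm (B l *v v))"
    using B_upper[of l v] B_lower[of v l] B_nonzero[OF assms, of l] assms by (auto intro!: ln_mono)
  moreover have "ln (M * norm v) = ln M + ln (norm v)" "ln (M * norm (B l *v v)) = ln M + ln (norm (B l *v v))"
    using M_pos assms B_nonzero[OF assms] by (auto intro!: ln_mult_pos)
  ultimately show ?thesis by linarith
qed

lemma ln_norm_fold: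
  assumes "v \<noteq> 0"
  shows "\<bar>ln (norm (fold T xs v)) - ln (norm v)\<bar> \<le> real (length xs) * ln M"
  using assms
proof (induction xs arbitrary: v)
  case (Cons x xs)
  have "\<bar>ln (norm (fold T xs (T x v))) - ln (norm (T x v))\<bar> \<le> real (length xs) * ln M"
    using Cons by (intro Cons.IH B_nonzero)
  with ln_norm_step[OF Cons.prems, of x] show ?case by (simp add: algebra_simps)
qed simp

end

text \<open>The geometry enters the oscillation estimate only through \<tau>, a time after which
  every vector has gained at least 1 in mean log norm.\<close>

locale expanding_cocycle = bounded_cocycle +
  fixes \<tau> :: nat
  assumes det_B: "\<And>l. \<bar>det (B l)\<bar> = 1"
    and \<tau>: "1 \<le> \<tau>"
    and expands: "\<And>v. v \<noteq> 0 \<Longrightarrow> ln (norm v) + 1 \<le> (Q ^^ \<tau>) (\<lambda>v. ln (norm v)) v"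
begin

text \<open>With this value the quadratic term in the expansion of
  \<open>exp (- 2 * \<theta> * y)\<close> for \<open>\<bar>y\<bar> \<le> real \<tau> * ln M\<close>
  is at most \<theta>, half of the linear gain \<open>2 * \<theta>\<close>.\<close>

definition "\<theta> = 1 / (4 * (real \<tau> * ln M)\<^sup>2)"

lemma \<tau>_ln_M: "1 \<le> real \<tau> * ln M"
  using mult_mono[of 1 "real \<tau>" 1 "ln M"] \<tau> ln_M by simp

lemma \<theta>_sq: "4 * \<theta> * (real \<tau> * ln M)\<^sup>2 = 1"
proof -
  have "real \<tau> * ln M \<noteq> 0" using \<tau>_ln_M by linarith
  then show ?thesis by (simp add: \<theta>_def)
qed

lemma \<theta>_pos: "0 < \<theta>"
proof -
  have "0 < real \<tau> * ln M" using \<tau>_ln_M by linarith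
  then have "0 < 4 * (real \<tau> * ln M)\<^sup>2"
    by (rule mult_pos_pos[OF zero_less_numeral zero_less_power])
  then show ?thesis unfolding \<theta>_def by (rule divide_pos_pos[OF zero_less_one])
qed

lemma \<theta>_le_1: "\<theta> \<le> 1"
proof -
  have "\<theta> * 1 \<le> \<theta> * (4 * (real \<tau> * ln M)\<^sup>2)"
    using \<theta>_pos one_le_power[OF \<tau>_ln_M, of 2] by (intro mult_left_mono) auto
  then show ?thesis using \<theta>_sq by (simp add: mult_ac)
qed

text \<open>The quantity averaged is \<open>exp (- 2 * \<theta> * y)\<close> with \<open>y\<close>
  the log growth over \<tau> steps. To second order its mean is at most 1, minus
  \<open>2 * \<theta>\<close> since \<open>y\<close> has mean at least 1, plus \<theta> for the
  quadratic term.\<close>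

lemma negative_moment:
  assumes v: "v \<noteq> 0"
  shows "(Q ^^ \<tau>) (\<lambda>w. (norm v / norm w) powr (2 * \<theta>)) v \<le> 1 - \<theta>"
proof -
  let ?\<Lambda> = "real \<tau> * ln M"
  let ?f = "\<lambda>w. (1 + \<theta> + 2 * \<theta> * ln (norm v)) - 2 * \<theta> * ln (norm w)"
  have "(Q ^^ \<tau>) (\<lambda>w. (norm v / norm w) powr (2 * \<theta>)) v \<le> (Q ^^ \<tau>) ?f v"
  proof (rule markov_iter_mono)
    fix xs :: "'a list" assume len: "length xs = \<tau>"
    define w where "w = fold T xs v"
    define y where "y = ln (norm w) - ln (norm v)"
    have w: "w \<noteq> 0" using fold_nonzero[OF v] by (simp add: w_def)
    have y: "\<bar>y\<bar> \<le> ?\<Lambda>" using ln_norm_fold[OF v, of xs] len by (simp add: y_def w_def)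
    have "y\<^sup>2 \<le> ?\<Lambda>\<^sup>2" using y \<tau>_ln_M by (intro power2_le_iff_abs_le[THEN iffD2]) auto
    then have "(4 * \<theta>\<^sup>2) * y\<^sup>2 \<le> (4 * \<theta>\<^sup>2) * ?\<Lambda>\<^sup>2" by (intro mult_left_mono) auto
    also have "\<dots> = \<theta> * (4 * \<theta> * ?\<Lambda>\<^sup>2)" by (simp add: power2_eq_square)
    finally have y2: "4 * \<theta>\<^sup>2 * y\<^sup>2 \<le> \<theta>" unfolding \<theta>_sq by simp
    have "2 * \<theta> * \<bar>y\<bar> \<le> 2 * \<theta> * ?\<Lambda>" using y \<theta>_pos by (intro mult_left_mono) auto
    also have "\<dots> \<le> 2 * \<theta> * (2 * ?\<Lambda>\<^sup>2)"
    proof -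
      have "?\<Lambda> * 1 \<le> ?\<Lambda> * ?\<Lambda>" using \<tau>_ln_M by (intro mult_left_mono) auto
      then show ?thesis using \<theta>_pos \<tau>_ln_M by (intro mult_left_mono) (auto simp: power2_eq_square)
    qed
    also have "\<dots> = 1" using \<theta>_sq by (simp add: mult_ac)
    finally have "\<bar>- 2 * \<theta> * y\<bar> \<le> 1" using \<theta>_pos by (simp add: abs_mult)
    then have "exp (- 2 * \<theta> * y) \<le> 1 + (- 2 * \<theta> * y) + (- 2 * \<theta> * y)\<^sup>2" by (rule exp_le_quadratic)
    also have "\<dots> = 1 - 2 * \<theta> * y + 4 * \<theta>\<^sup>2 * y\<^sup>2" by (simp add: power_mult_distrib)
    also have "\<dots> \<le> ?f w" using y2 by (simp add: y_def algebra_simps)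
    finally have "exp (- 2 * \<theta> * y) \<le> ?f w" .
    moreover have "(norm v / norm w) powr (2 * \<theta>) = exp (- 2 * \<theta> * y)"
      using v w by (simp add: powr_def ln_div y_def algebra_simps)
    ultimately show "(norm v / norm (fold T xs v)) powr (2 * \<theta>) \<le> ?f (fold T xs v)"
      by (simp add: w_def)
  qed
  also have "\<dots> = (1 + \<theta> + 2 * \<theta> * ln (norm v)) - 2 * \<theta> * (Q ^^ \<tau>) (\<lambda>v. ln (norm v)) v"
    by (simp add: markov_iter_diff markov_iter_cmult)
  also have "\<dots> \<le> 1 - \<theta>"
    using mult_left_mono[OF expands[OF v], of "2 * \<theta>"] \<theta>_pos by (simp add: algebra_simps)
  finally show ?thesis .
qed

text \<open>The coupling of two orbits by the same random letters.\<close>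

abbreviation "T2 \<equiv> \<lambda>l (z :: (real^2) \<times> (real^2)). (B l *v fst z, B l *v snd z)"

lemma fold_T2: "fold T2 xs z = (fold T xs (fst z), fold T xs (snd z))"
  by (induction xs arbitrary: z) auto

lemma markov_T2_fst: "(markov_op p T2 ^^ n) (\<lambda>z. f (fst z)) z = (Q ^^ n) f (fst z)"
  and markov_T2_snd: "(markov_op p T2 ^^ n) (\<lambda>z. f (snd z)) z = (Q ^^ n) f (snd z)"
  by (rule markov_iter_semiconj; simp)+

lemma cross2_fold: "\<bar>cross2 (fold T xs v) (fold T xs w)\<bar> = \<bar>cross2 v w\<bar>"
  by (induction xs arbitrary: v w) (auto simp: cross2_matrix abs_mult det_B)

text \<open>As the spanned area is constant, the distance is multiplied by the product of the two
  inverse expansions. The inequality \<open>2 * a * b \<le> a\<^sup>2 + b\<^sup>2\<close> separates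
  the factors, which is why negative moments of order \<open>2 * \<theta>\<close> are
  required.\<close>

lemma projective_contraction:
  assumes v: "v \<noteq> 0" and w: "w \<noteq> 0"
  shows "(markov_op p T2 ^^ \<tau>) (\<lambda>z. pdist (fst z) (snd z) powr \<theta>) (v, w) \<le> (1 - \<theta>) * pdist v w powr \<theta>"
proof -
  let ?d = "pdist v w powr \<theta> / 2"
  let ?g = "\<lambda>v w. (norm v / norm (w::real^2)) powr (2 * \<theta>)"
  have "(markov_op p T2 ^^ \<tau>) (\<lambda>z. pdist (fst z) (snd z) powr \<theta>) (v, w)
     \<le> (markov_op p T2 ^^ \<tau>) (\<lambda>z. ?d * (?g v (fst z) + ?g w (snd z))) (v, w)"
  proof (rule markov_iter_mono)
    fix xs :: "'a list"
    define v' w' where "v' = fold T xs v" and "w' = fold T xs w"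
    have 0: "v' \<noteq> 0" "w' \<noteq> 0" using fold_nonzero v w by (auto simp: v'_def w'_def)
    define a b where "a = (norm v / norm v') powr \<theta>" and "b = (norm w / norm w') powr \<theta>"
    have a2: "?g v v' = a\<^sup>2" "?g w w' = b\<^sup>2"
      using 0 v w by (simp_all add: a_def b_def powr_powr mult.commute flip: powr_realpow)
    have "pdist v' w' = pdist v w * (norm v / norm v') * (norm w / norm w')"
      using 0 v w cross2_fold[of xs v w] by (simp add: pdist_def v'_def w'_def)
    then have "pdist v' w' powr \<theta> = pdist v w powr \<theta> * a * b"
      unfolding a_def b_def by (simp only: powr_mult pdist_nonneg divide_nonneg_nonneg norm_ge_zero mult_nonneg_nonneg)
    also have "\<dots> = ?d * (2 * a * b)" by simp
    also have "\<dots> \<le> ?d * (a\<^sup>2 + b\<^sup>2)"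
      using sum_squares_bound[of a b] by (intro mult_left_mono) auto
    finally show "pdist (fst (fold T2 xs (v, w))) (snd (fold T2 xs (v, w))) powr \<theta>
      \<le> ?d * (?g v (fst (fold T2 xs (v, w))) + ?g w (snd (fold T2 xs (v, w))))"
      unfolding fold_T2 fst_conv snd_conv v'_def[symmetric] w'_def[symmetric] a2 .
  qed
  also have "\<dots> = ?d * ((Q ^^ \<tau>) (?g v) v + (Q ^^ \<tau>) (?g w) w)"
    by (simp only: markov_iter_cmult markov_iter_add markov_T2_fst[where f="?g v"]
        markov_T2_snd[where f="?g w"] fst_conv snd_conv)
  also have "\<dots> \<le> ?d * ((1 - \<theta>) + (1 - \<theta>))"
    by (intro mult_left_mono add_mono negative_moment v w) auto
  also have "\<dots> = (1 - \<theta>) * pdist v w powr \<theta>" by argo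
  finally show ?thesis .
qed

text \<open>The occupation bound applies with \<open>h\<close> and \<open>k\<close> both equal to
  the contracted power and with \<open>\<epsilon> = 0\<close>; hence a bound independent of
  \<open>n\<close>.\<close>

lemma projective_distance_sum:
  assumes "v \<noteq> 0" "w \<noteq> 0"
  shows "(\<Sum>j<n. (markov_op p T2 ^^ j) (\<lambda>z. pdist (fst z) (snd z) powr \<theta>) (v, w)) \<le> real \<tau> / \<theta>"
proof -
  have "\<theta> * (\<Sum>j<n. (markov_op p T2 ^^ j) (\<lambda>z. pdist (fst z) (snd z) powr \<theta>) (v, w))
      \<le> real \<tau> + real n * 0"
  proof (rule markov_occupation_bound[where S="{z. fst z \<noteq> 0 \<and> snd z \<noteq> 0}" and h="\<lambda>z. pdist (fst z) (snd z) powr \<theta>"])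
    fix z :: "(real^2) \<times> (real^2)" assume z: "z \<in> {z. fst z \<noteq> 0 \<and> snd z \<noteq> 0}"
    then show "\<theta> * pdist (fst z) (snd z) powr \<theta>
      \<le> pdist (fst z) (snd z) powr \<theta> - (markov_op p T2 ^^ \<tau>) (\<lambda>z. pdist (fst z) (snd z) powr \<theta>) z + 0"
      using projective_contraction[of "fst z" "snd z"] by (simp add: algebra_simps)
  qed (use assms B_nonzero \<theta>_pos in \<open>auto intro!: powr_le1 simp: pdist_nonneg pdist_le_1\<close>)
  then show ?thesis using \<theta>_pos by (simp add: field_simps)
qed

text \<open>Both growths are sums of the mean one-step expansion along their orbits. In the coupling
  the summands differ by at most a multiple of the distance, which is below its power \<theta>. The
  cube of \<tau> is \<tau> / \<theta>.\<close>

lemma log_growth_diff_le: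
  assumes v: "v \<noteq> 0" and w: "w \<noteq> 0"
  shows "log_growth p B n w - log_growth p B n v \<le> 8 * M\<^sup>2 * (ln M)\<^sup>2 * real \<tau> ^ 3"
proof -
  define \<phi> where "\<phi> v = Q (\<lambda>v. ln (norm v)) v - ln (norm v)" for v
  have \<phi>: "\<phi> (snd z) - \<phi> (fst z) \<le> 2 * M\<^sup>2 * pdist (fst z) (snd z) powr \<theta>"
    if "z \<in> {z. fst z \<noteq> 0 \<and> snd z \<noteq> 0}" for z
  proof -
    have "pdist (fst z) (snd z) \<le> pdist (fst z) (snd z) powr \<theta>"
      using powr_mono'[of \<theta> 1 "pdist (fst z) (snd z)"] pdist_nonneg[of "fst z" "snd z"]
        pdist_le_1[of "fst z" "snd z"] \<theta>_pos \<theta>_le_1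
      by (cases "pdist (fst z) (snd z) = 0") auto
    then have le: "2 * M\<^sup>2 * pdist (fst z) (snd z) \<le> 2 * M\<^sup>2 * pdist (fst z) (snd z) powr \<theta>"
      by (intro mult_left_mono) auto
    have \<phi>_eq: "\<phi> v = (\<Sum>l\<in>UNIV. pmf p l * (ln (norm (B l *v v)) - ln (norm v)))" for v
      by (simp add: \<phi>_def markov_op_def right_diff_distrib sum_subtractf sum_pmf_UNIV flip: sum_distrib_right)
    have "\<phi> (snd z) - \<phi> (fst z) = (\<Sum>l\<in>UNIV. pmf p l * ((ln (norm (B l *v snd z)) - ln (norm (snd z)))
        - (ln (norm (B l *v fst z)) - ln (norm (fst z)))))"
      unfolding \<phi>_eq by (simp add: sum_subtractf right_diff_distrib)
    also have "\<dots> \<le> (\<Sum>l\<in>UNIV. pmf p l * (2 * M\<^sup>2 * pdist (fst z) (snd z)))"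
      using that M_pos
      by (intro sum_mono mult_left_mono log_expansion_lipschitz B_upper B_lower) auto
    also have "\<dots> = 2 * M\<^sup>2 * pdist (fst z) (snd z)"
      by (simp add: sum_pmf_UNIV flip: sum_distrib_right)
    finally show ?thesis using le by linarith
  qed
  have "log_growth p B n w - log_growth p B n v = (\<Sum>j<n. (Q ^^ j) \<phi> w) - (\<Sum>j<n. (Q ^^ j) \<phi> v)"
    unfolding log_growth_def \<phi>_def markov_iter_telescope[symmetric] ..
  also have "\<dots> = (\<Sum>j<n. (markov_op p T2 ^^ j) (\<lambda>z. \<phi> (snd z) - \<phi> (fst z)) (v, w))"
    by (simp only: markov_iter_diff sum_subtractf markov_T2_fst markov_T2_snd fst_conv snd_conv)
  also have "\<dots> \<le> (\<Sum>j<n. (markov_op p T2 ^^ j) (\<lambda>z. 2 * M\<^sup>2 * pdist (fst z) (snd z) powr \<theta>) (v, w))"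
    using v w B_nonzero
    by (intro sum_mono markov_iter_mono_inv[where S="{z. fst z \<noteq> 0 \<and> snd z \<noteq> 0}"] \<phi>) auto
  also have "\<dots> = 2 * M\<^sup>2 * (\<Sum>j<n. (markov_op p T2 ^^ j) (\<lambda>z. pdist (fst z) (snd z) powr \<theta>) (v, w))"
    by (simp add: markov_iter_cmult sum_distrib_left)
  also have "\<dots> \<le> 2 * M\<^sup>2 * (real \<tau> / \<theta>)"
    by (intro mult_left_mono projective_distance_sum v w) auto
  also have "\<dots> = 8 * M\<^sup>2 * (ln M)\<^sup>2 * real \<tau> ^ 3"
    by (simp add: \<theta>_def power_mult_distrib power3_eq_cube power2_eq_square)
  finally show ?thesis .
qed

end

section \<open>Exponential moments\<close>

text \<open>Comparing \<open>g (m * n)\<close> with both \<open>m * g n\<close> and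
  \<open>n * g m\<close> shows that \<open>g n / n\<close> is Cauchy with error
  \<open>K / n + K / m\<close>; letting \<open>m\<close> tend to infinity leaves
  \<open>K / n\<close>.\<close>

lemma almost_additive_limit:
  fixes g :: "nat \<Rightarrow> real"
  assumes g: "\<And>m n. \<bar>g (m + n) - g m - g n\<bar> \<le> K"
  shows "\<exists>\<Lambda>. \<forall>n. \<bar>g n - real n * \<Lambda>\<bar> \<le> K"
proof -
  have mult: "\<bar>g (m * n) - real m * g n\<bar> \<le> real m * K" if "1 \<le> m" for m n
    using that
  proof (induction m rule: dec_induct)
    case base
    then show ?case using g[of 0 0] by simp
  next
    case (step m)
    then show ?case using g[of n "m * n"] by (simp add: algebra_simps)
  qed
  have diff: "\<bar>g n / real n - g m / real m\<bar> \<le> K / real n + K / real m" if "1 \<le> m" "1 \<le> n" for m n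
  proof -
    have "\<bar>real m * g n - real n * g m\<bar> \<le> real m * K + real n * K"
      using mult[OF that(1), of n] mult[OF that(2), of m] by (simp add: mult.commute)
    then have "\<bar>real m * g n - real n * g m\<bar> / (real m * real n) \<le> (real m * K + real n * K) / (real m * real n)"
      using that by (intro divide_right_mono) auto
    moreover have "g n / real n - g m / real m = (real m * g n - real n * g m) / (real m * real n)"
      using that by (simp add: field_simps)
    moreover have "(real m * K + real n * K) / (real m * real n) = K / real n + K / real m"
      using that by (simp add: field_simps)
    ultimately show ?thesis using that by (simp add: abs_mult)
  qed
  have K0: "0 \<le> K" using g[of 0 0] by linarith
  have "Cauchy (\<lambda>n. g n / real n)"
  proof (rule metric_CauchyI)
    fix e :: real assume e: "0 < e"
    obtain N where N: "2 * K / e < real N" using reals_Archimedean2 by blast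
    have "dist (g n / real n) (g m / real m) < e" if "max 1 N \<le> m" "max 1 N \<le> n" for m n
    proof -
      have "K / real k < e / 2" if "max 1 N \<le> k" for k
      proof -
        have "2 * K / e < real k" using N that by (smt (verit) max.bounded_iff of_nat_mono)
        then show ?thesis using that e by (simp add: field_simps)
      qed
      from this[OF that(1)] this[OF that(2)] diff[of m n] that show ?thesis
        unfolding dist_real_def by linarith
    qed
    then show "\<exists>M. \<forall>m\<ge>M. \<forall>n\<ge>M. dist (g m / real m) (g n / real n) < e" by (metis)
  qed
  then obtain \<Lambda> where \<Lambda>: "(\<lambda>n. g n / real n) \<longlonglongrightarrow> \<Lambda>"
    using convergent_eq_Cauchy by blast
  have "\<bar>g n - real n * \<Lambda>\<bar> \<le> K" for n
  proof (cases "n = 0")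
    case True
    then show ?thesis using g[of 0 0] by simp
  next
    case False
    have "(\<lambda>m. \<bar>g n / real n - g m / real m\<bar>) \<longlonglongrightarrow> \<bar>g n / real n - \<Lambda>\<bar>"
      by (intro tendsto_intros \<Lambda>)
    moreover have "(\<lambda>m. K / real n + K / real m) \<longlonglongrightarrow> K / real n + 0"
      by (intro tendsto_intros lim_const_over_n)
    ultimately have "\<bar>g n / real n - \<Lambda>\<bar> \<le> K / real n + 0"
      using False diff[of _ n] by (intro LIMSEQ_le[where X="\<lambda>m. \<bar>g n / real n - g m / real m\<bar>"]) (auto intro!: exI[of _ 1])
    then have "real n * \<bar>g n / real n - \<Lambda>\<bar> \<le> real n * (K / real n)"
      by (intro mult_left_mono) auto
    moreover have "g n - real n * \<Lambda> = real n * (g n / real n - \<Lambda>)"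
      using False by (simp add: field_simps)
    then have "\<bar>g n - real n * \<Lambda>\<bar> = real n * \<bar>g n / real n - \<Lambda>\<bar>"
      by (simp add: abs_mult)
    ultimately show ?thesis using False by simp
  qed
  then show ?thesis by blast
qed

section \<open>Iterates under the Bernoulli measure\<close>

lemma cocycle_iter_case_nat: "cocycle_iter B (case_nat s \<omega>) (Suc n) = cocycle_iter B \<omega> n ** B s"
proof (induction n)
  case (Suc n)
  then show ?case
    by (subst cocycle_iter.simps(2)) (simp add: matrix_mul_assoc)
qed simp

lemma prob_space_bernoulli: "prob_space (bernoulli p)"
  unfolding bernoulli_def by (intro prob_space_PiM) (rule prob_space_measure_pmf)

lemma space_bernoulli [simp]: "space (bernoulli p) = UNIV"
  by (simp add: bernoulli_def space_PiM)

text \<open>Over a finite alphabet the discrete sigma-algebra on matrices is admissible, so every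
  function of an iterate becomes measurable at once.\<close>

lemma measurable_cocycle_iter:
  fixes p :: "'s::finite pmf"
  shows "(\<lambda>x. cocycle_iter B x n) \<in> measurable (bernoulli p) (count_space UNIV)"
proof (induction n)
  case (Suc n)
  have 1: "(\<lambda>x. x n) \<in> measurable (bernoulli p) (count_space UNIV)"
    unfolding bernoulli_def using measurable_component_singleton[of n UNIV "\<lambda>_. measure_pmf p"]
    by (simp cong: measurable_cong_sets)
  have "(\<lambda>x. B l ** cocycle_iter B x n) \<in> measurable (bernoulli p) (count_space UNIV)" for l
    by (rule measurable_compose[OF Suc]) simp
  from measurable_compose_countable[OF this 1] show ?case by simp
qed simp

lemma borel_measurable_cocycle_iter:
  fixes p :: "'s::finite pmf"
  assumes "\<And>P. f P \<in> space N"
  shows "(\<lambda>x. f (cocycle_iter B x n)) \<in> measurable (bernoulli p) N"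
  using assms by (intro measurable_compose[OF measurable_cocycle_iter]) auto

text \<open>Conditioning on the first letter: prepending an independent letter preserves the
  Bernoulli measure.\<close>

lemma nn_integral_cocycle_Suc:
  fixes p :: "'s::finite pmf"
  shows "(\<integral>\<^sup>+x. f (cocycle_iter B x (Suc n)) \<partial>bernoulli p)
    = (\<Sum>l\<in>UNIV. ennreal (pmf p l) * (\<integral>\<^sup>+x. f (cocycle_iter B x n ** B l) \<partial>bernoulli p))"
proof -
  interpret sequence_space "measure_pmf p" by unfold_locales
  interpret S: prob_space "bernoulli p" by (rule prob_space_bernoulli)
  have Suc: "(\<lambda>x. f (cocycle_iter B x (Suc n))) \<in> borel_measurable (bernoulli p)"
    by (intro borel_measurable_cocycle_iter) auto
  have cn: "(\<lambda>(s, \<omega>). case_nat s \<omega>) \<in> measurable (measure_pmf p \<Otimes>\<^sub>M bernoulli p) (bernoulli p)"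
    unfolding bernoulli_def by simp
  have "(\<integral>\<^sup>+x. f (cocycle_iter B x (Suc n)) \<partial>bernoulli p)
      = (\<integral>\<^sup>+x. f (cocycle_iter B x (Suc n)) \<partial>distr (measure_pmf p \<Otimes>\<^sub>M bernoulli p) (bernoulli p) (\<lambda>(s, \<omega>). case_nat s \<omega>))"
    using PiM_iter unfolding bernoulli_def by simp
  also have "\<dots> = (\<integral>\<^sup>+z. f (cocycle_iter B (case z of (s, \<omega>) \<Rightarrow> case_nat s \<omega>) (Suc n)) \<partial>(measure_pmf p \<Otimes>\<^sub>M bernoulli p))"
    by (rule nn_integral_distr[OF cn]) (use Suc in simp)
  also have "\<dots> = (\<integral>\<^sup>+s. \<integral>\<^sup>+\<omega>. f (cocycle_iter B (case_nat s \<omega>) (Suc n)) \<partial>bernoulli p \<partial>measure_pmf p)"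
    using measurable_compose[OF cn Suc] by (subst S.nn_integral_fst[symmetric]) (auto simp: split_beta)
  also have "\<dots> = (\<integral>\<^sup>+s. \<integral>\<^sup>+\<omega>. f (cocycle_iter B \<omega> n ** B s) \<partial>bernoulli p \<partial>measure_pmf p)"
    by (simp only: cocycle_iter_case_nat)
  also have "\<dots> = (\<Sum>l\<in>UNIV. ennreal (pmf p l) * (\<integral>\<^sup>+x. f (cocycle_iter B x n ** B l) \<partial>bernoulli p))"
    by (subst nn_integral_measure_pmf_support[of UNIV]) (auto simp: mult.commute)
  finally show ?thesis .
qed

text \<open>The set \<open>V\<close> allows two uses: all nonzero vectors for the perturbed
  cocycles, and a single invariant line, with \<open>K = 0\<close>, for the diagonal one.\<close>

locale oscillation_cocycle = bounded_cocycle +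
  fixes V :: "(real^2) set" and K :: real
  assumes V_nonzero: "\<And>v. v \<in> V \<Longrightarrow> v \<noteq> 0" and V_inv: "\<And>l v. v \<in> V \<Longrightarrow> B l *v v \<in> V"
    and osc: "\<And>n v w. v \<in> V \<Longrightarrow> w \<in> V \<Longrightarrow> log_growth p B n w - log_growth p B n v \<le> K"
    and K_nonneg: "0 \<le> K"
begin

abbreviation "G \<equiv> log_growth p B"

lemma G_Suc: "G (Suc n) v = (\<Sum>l\<in>UNIV. pmf p l * ((ln (norm (B l *v v)) - ln (norm v)) + G n (B l *v v)))"
proof -
  have "(\<Sum>l\<in>UNIV. pmf p l * ((ln (norm (B l *v v)) - ln (norm v)) + G n (B l *v v)))
     = (\<Sum>l\<in>UNIV. pmf p l * (Q ^^ n) (\<lambda>v. ln (norm v)) (B l *v v) - pmf p l * ln (norm v))"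
    unfolding log_growth_def by (intro sum.cong) (auto simp: algebra_simps)
  also have "\<dots> = G (Suc n) v"
    unfolding log_growth_def markov_iter_Suc
    by (simp add: sum_subtractf sum_pmf_UNIV flip: sum_distrib_right)
  finally show ?thesis by simp
qed

lemma abs_osc: "v \<in> V \<Longrightarrow> w \<in> V \<Longrightarrow> \<bar>G n w - G n v\<bar> \<le> K"
  using osc[of v w n] osc[of w v n] by linarith

text \<open>Induction on the first letter. Its increment \<open>Y l\<close> is centred because
  \<open>G (Suc n) v\<close> is the mean of \<open>F\<close>, and the rest of the orbit is centred
  by \<open>G n\<close> at the new vector, so the induction hypothesis applies there.\<close>

lemma exp_moment:
  assumes v: "v \<in> V" and c: "2 * ln M + K \<le> c" "\<bar>\<xi>\<bar> * c \<le> 1"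
  shows "(\<integral>\<^sup>+x. ennreal (exp (\<xi> * (ln (norm (cocycle_iter B x n *v v)) - ln (norm v) - G n v))) \<partial>bernoulli p)
    \<le> ennreal (exp (real n * (\<xi>\<^sup>2 * c\<^sup>2)))"
  using v
proof (induction n arbitrary: v)
  case 0
  interpret S: prob_space "bernoulli p" by (rule prob_space_bernoulli)
  show ?case using S.emeasure_space_1 by (simp add: log_growth_def)
next
  case (Suc n)
  define F where "F l = (ln (norm (B l *v v)) - ln (norm v)) + G n (B l *v v)" for l
  define Y where "Y l = F l - G (Suc n) v" for l
  have GF: "G (Suc n) v = (\<Sum>l\<in>UNIV. pmf p l * F l)" unfolding G_Suc F_def ..
  have "F l - F k \<le> 2 * ln M + K" for l k
    using ln_norm_step[OF V_nonzero[OF Suc.prems], of l] ln_norm_step[OF V_nonzero[OF Suc.prems], of k]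
      osc[OF V_inv[OF Suc.prems, of k] V_inv[OF Suc.prems, of l], of n] unfolding F_def by linarith
  then have Fc: "F l - F k \<le> c" for l k using c(1) by (meson order_trans)
  \<comment> \<open>\<open>F\<close> itself may grow with \<open>n\<close>, but its differences are
    bounded by the oscillation; writing \<open>Y l\<close> as their average gives a bound free of
    \<open>n\<close>.\<close>
  have Yl: "Y l = (\<Sum>k\<in>UNIV. pmf p k * (F l - F k))" for l
    by (simp add: Y_def GF right_diff_distrib sum_subtractf sum_pmf_UNIV flip: sum_distrib_right)
  have "\<bar>Y l\<bar> \<le> c" for l
  proof -
    have "\<bar>Y l\<bar> \<le> (\<Sum>k\<in>UNIV. pmf p k * \<bar>F l - F k\<bar>)"
      unfolding Yl by (rule order_trans[OF sum_abs]) (simp add: abs_mult)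
    also have "\<dots> \<le> (\<Sum>k\<in>UNIV. pmf p k * c)"
    proof (intro sum_mono mult_left_mono)
      show "\<bar>F l - F k\<bar> \<le> c" for k using Fc[of l k] Fc[of k l] by linarith
    qed auto
    finally show ?thesis by (simp add: sum_pmf_UNIV flip: sum_distrib_right)
  qed
  have EY: "(\<Sum>l\<in>UNIV. pmf p l * Y l) = 0"
    by (simp add: Y_def right_diff_distrib sum_subtractf GF sum_pmf_UNIV flip: sum_distrib_right)
  let ?b = "exp (real n * (\<xi>\<^sup>2 * c\<^sup>2))"
  have "(\<integral>\<^sup>+x. ennreal (exp (\<xi> * (ln (norm (cocycle_iter B x (Suc n) *v v)) - ln (norm v) - G (Suc n) v))) \<partial>bernoulli p)
     = (\<Sum>l\<in>UNIV. ennreal (pmf p l) *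
       (\<integral>\<^sup>+x. ennreal (exp (\<xi> * (ln (norm ((cocycle_iter B x n ** B l) *v v)) - ln (norm v) - G (Suc n) v))) \<partial>bernoulli p))"
    by (rule nn_integral_cocycle_Suc)
  also have "\<dots> \<le> (\<Sum>l\<in>UNIV. ennreal (pmf p l) * (ennreal (exp (\<xi> * Y l)) * ennreal ?b))"
  proof (intro sum_mono mult_left_mono)
    fix l
    have "(\<integral>\<^sup>+x. ennreal (exp (\<xi> * (ln (norm ((cocycle_iter B x n ** B l) *v v)) - ln (norm v) - G (Suc n) v))) \<partial>bernoulli p)
      = (\<integral>\<^sup>+x. ennreal (exp (\<xi> * Y l)) * ennreal (exp (\<xi> * (ln (norm (cocycle_iter B x n *v (B l *v v))) - ln (norm (B l *v v)) - G n (B l *v v)))) \<partial>bernoulli p)"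
      by (intro nn_integral_cong)
         (simp add: Y_def F_def matrix_vector_mul_assoc algebra_simps flip: ennreal_mult exp_add)
    also have "\<dots> = ennreal (exp (\<xi> * Y l)) * (\<integral>\<^sup>+x. ennreal (exp (\<xi> * (ln (norm (cocycle_iter B x n *v (B l *v v))) - ln (norm (B l *v v)) - G n (B l *v v)))) \<partial>bernoulli p)"
      by (intro nn_integral_cmult borel_measurable_cocycle_iter[where f="\<lambda>P. ennreal (exp (\<xi> * (ln (norm (P *v (B l *v v))) - ln (norm (B l *v v)) - G n (B l *v v))))"]) auto
    also have "\<dots> \<le> ennreal (exp (\<xi> * Y l)) * ennreal ?b"
      by (intro mult_left_mono Suc.IH V_inv Suc.prems) auto
    finally show "(\<integral>\<^sup>+x. ennreal (exp (\<xi> * (ln (norm ((cocycle_iter B x n ** B l) *v v)) - ln (norm v) - G (Suc n) v))) \<partial>bernoulli p)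
      \<le> ennreal (exp (\<xi> * Y l)) * ennreal ?b" .
  qed auto
  also have "\<dots> = ennreal ((\<Sum>l\<in>UNIV. pmf p l * exp (\<xi> * Y l)) * ?b)"
    by (simp add: sum_distrib_right mult.assoc flip: ennreal_mult sum_ennreal)
  also have "\<dots> \<le> ennreal (exp (\<xi>\<^sup>2 * c\<^sup>2) * ?b)"
  proof (intro ennreal_leI mult_right_mono)
    have "pmf p l * exp (\<xi> * Y l) \<le> pmf p l * ((1 + \<xi>\<^sup>2 * c\<^sup>2) + \<xi> * Y l)" for l
    proof (intro mult_left_mono)
      have "\<bar>\<xi> * Y l\<bar> \<le> \<bar>\<xi>\<bar> * c" unfolding abs_mult using \<open>\<bar>Y l\<bar> \<le> c\<close> by (intro mult_left_mono) auto
      then have 1: "\<bar>\<xi> * Y l\<bar> \<le> 1" using c by linarith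
      have "(Y l)\<^sup>2 \<le> c\<^sup>2" using \<open>\<bar>Y l\<bar> \<le> c\<close> by (metis abs_ge_zero power2_abs power_mono)
      then have "(\<xi> * Y l)\<^sup>2 \<le> \<xi>\<^sup>2 * c\<^sup>2" unfolding power_mult_distrib by (intro mult_left_mono) auto
      with exp_le_quadratic[OF 1] show "exp (\<xi> * Y l) \<le> (1 + \<xi>\<^sup>2 * c\<^sup>2) + \<xi> * Y l" by linarith
    qed auto
    then have "(\<Sum>l\<in>UNIV. pmf p l * exp (\<xi> * Y l)) \<le> (\<Sum>l\<in>UNIV. pmf p l * ((1 + \<xi>\<^sup>2 * c\<^sup>2) + \<xi> * Y l))"
      by (intro sum_mono)
    also have "\<dots> = (1 + \<xi>\<^sup>2 * c\<^sup>2) * (\<Sum>l\<in>UNIV. pmf p l) + \<xi> * (\<Sum>l\<in>UNIV. pmf p l * Y l)"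
      unfolding sum_distrib_left sum.distrib[symmetric] by (intro sum.cong) (auto simp: algebra_simps)
    also have "\<dots> = 1 + \<xi>\<^sup>2 * c\<^sup>2" by (simp add: sum_pmf_UNIV EY)
    also have "\<dots> \<le> exp (\<xi>\<^sup>2 * c\<^sup>2)" by (rule exp_ge_add_one_self)
    finally show "(\<Sum>l\<in>UNIV. pmf p l * exp (\<xi> * Y l)) \<le> exp (\<xi>\<^sup>2 * c\<^sup>2)" .
  qed auto
  also have "exp (\<xi>\<^sup>2 * c\<^sup>2) * ?b = exp (real (Suc n) * (\<xi>\<^sup>2 * c\<^sup>2))"
    by (simp add: algebra_simps flip: exp_add)
  finally show ?case .
qed

text \<open>The growth after time \<open>m\<close> is the mean of \<open>G n\<close> at the position
  then reached, and \<open>G n\<close> varies by at most \<open>K\<close> on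
  \<open>V\<close>.\<close>

lemma G_add_le:
  assumes v: "v \<in> V"
  shows "\<bar>G (m + n) v - G m v - G n v\<bar> \<le> K"
proof -
  have "(Q ^^ m) (\<lambda>w. G n w) v = (Q ^^ (m + n)) (\<lambda>v. ln (norm v)) v - (Q ^^ m) (\<lambda>v. ln (norm v)) v"
    unfolding log_growth_def by (simp add: markov_iter_diff funpow_add)
  then have "G (m + n) v - G m v = (Q ^^ m) (\<lambda>w. G n w) v" by (simp add: log_growth_def)
  moreover have "(Q ^^ m) (\<lambda>w. G n w) v \<le> (Q ^^ m) (\<lambda>w. G n v + K) v"
    by (rule markov_iter_mono_inv[where S=V, OF V_inv v]) (use osc[OF v] in \<open>auto simp: algebra_simps\<close>)
  moreover have "(Q ^^ m) (\<lambda>w. G n v - K) v \<le> (Q ^^ m) (\<lambda>w. G n w) v"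
    by (rule markov_iter_mono_inv[where S=V, OF V_inv v]) (use osc[OF _ v] in \<open>auto simp: algebra_simps\<close>)
  ultimately show ?thesis by simp
qed

lemma exists_exponent: "\<exists>\<Lambda>. \<forall>v\<in>V. \<forall>n. \<bar>G n v - real n * \<Lambda>\<bar> \<le> 2 * K"
proof (cases "V = {}")
  case False
  then obtain v where v: "v \<in> V" by auto
  then obtain \<Lambda> where \<Lambda>: "\<And>n. \<bar>G n v - real n * \<Lambda>\<bar> \<le> K"
    using almost_additive_limit[of "\<lambda>n. G n v" K] G_add_le[OF v] by blast
  have "\<bar>G n w - real n * \<Lambda>\<bar> \<le> 2 * K" if "w \<in> V" for w n
    using \<Lambda>[of n] abs_osc[OF v that, of n] by linarith
  then show ?thesis by blast
qed auto

text \<open>The bound is Chernoff's inequality at \<open>\<xi> = t / (2 n c\<^sup>2)\<close> with \<open>n = y\<^sup>6\<close>, \<open>t = y\<^sup>5 / 2\<close>.\<close>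

lemma vector_deviation:
  assumes v: "v \<in> V" and c: "2 * ln M + K \<le> c" and \<Lambda>: "\<bar>G n v - real n * \<Lambda>\<bar> \<le> 2 * K"
    and n: "real n = y ^ 6" and y: "1 \<le> y" "64 * c\<^sup>2 \<le> y ^ 3"
  shows "measure (bernoulli p) {x. y ^ 5 / 2 + 2 * K \<le> \<bar>ln (norm (cocycle_iter B x n *v v)) - ln (norm v) - real n * \<Lambda>\<bar>}
     \<le> 2 * exp (- 4 * y)"
proof -
  interpret S: prob_space "bernoulli p" by (rule prob_space_bernoulli)
  define f where "f x = ln (norm (cocycle_iter B x n *v v)) - ln (norm v) - G n v" for x
  have f [measurable]: "f \<in> borel_measurable (bernoulli p)"
    unfolding f_def by (rule borel_measurable_cocycle_iter[where f="\<lambda>P. ln (norm (P *v v)) - ln (norm v) - G n v"]) simp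
  have c2: "2 \<le> c" using c ln_M K_nonneg by linarith
  define t where "t = y ^ 5 / 2"
  define \<xi> where "\<xi> = t / (2 * real n * c\<^sup>2)"
  have y0: "0 < y" using y by linarith
  have \<xi>: "\<xi> = 1 / (4 * y * c\<^sup>2)" using y0 by (simp add: \<xi>_def t_def n power_numeral_reduce)
  have \<xi>0: "0 < \<xi>" unfolding \<xi> using y0 c2 by simp
  have "1 * 1 \<le> y * c" using y c2 by (intro mult_mono) auto
  then have "\<bar>\<xi>\<bar> * c \<le> 1" using \<xi>0 c2 y0 unfolding \<xi> by (simp add: power2_eq_square field_simps)
  then have c\<xi>: "\<bar>\<xi>\<bar> * c \<le> 1" "\<bar>- \<xi>\<bar> * c \<le> 1" by auto
  \<comment> \<open>The left side equals \<open>- (y ^ 4 / (16 * c\<^sup>2))\<close>. The rate 4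
    leaves room for the numerical prefactors of the later union bounds.\<close>
  have expo: "- \<xi> * t + real n * (\<xi>\<^sup>2 * c\<^sup>2) \<le> - 4 * y"
  proof -
    have "- \<xi> * t + real n * (\<xi>\<^sup>2 * c\<^sup>2) = - (y ^ 4 / (16 * c\<^sup>2))"
      using y0 c2 unfolding \<xi> t_def n by (simp add: field_simps power_numeral_reduce)
    moreover have "4 * y * (16 * c\<^sup>2) \<le> y * y ^ 3" using y by simp
    then have "4 * y \<le> y ^ 4 / (16 * c\<^sup>2)" using c2 by (subst pos_le_divide_eq) (auto simp: power_numeral_reduce)
    ultimately show ?thesis by linarith
  qed
  have up: "emeasure (bernoulli p) {x\<in>UNIV. g x \<ge> t} \<le> ennreal (exp (- 4 * y))"
    if [measurable]: "g \<in> borel_measurable (bernoulli p)"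
      and "(\<integral>\<^sup>+x. ennreal (exp (\<xi> * g x)) \<partial>bernoulli p) \<le> ennreal (exp (real n * (\<xi>\<^sup>2 * c\<^sup>2)))" for g
  proof -
    have "emeasure (bernoulli p) {x\<in>UNIV. g x \<ge> t} \<le> ennreal (exp (- \<xi> * t)) * (\<integral>\<^sup>+x. ennreal (exp (\<xi> * g x)) * indicator UNIV x \<partial>bernoulli p)"
      using \<xi>0 sets.top[of "bernoulli p"] by (intro Chernoff_ineq_nn_integral_ge) auto
    also have "\<dots> \<le> ennreal (exp (- \<xi> * t)) * ennreal (exp (real n * (\<xi>\<^sup>2 * c\<^sup>2)))"
      using that(2) by (intro mult_left_mono) auto
    also have "\<dots> \<le> ennreal (exp (- 4 * y))"
      using expo by (simp flip: ennreal_mult exp_add)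
    finally show ?thesis .
  qed
  have 1: "measure (bernoulli p) {x. f x \<ge> t} \<le> exp (- 4 * y)"
    using up[OF f] exp_moment[OF v c c\<xi>(1), of n, folded f_def] by (simp add: S.emeasure_eq_measure)
  have 2: "measure (bernoulli p) {x. - f x \<ge> t} \<le> exp (- 4 * y)"
    using up[of "\<lambda>x. - f x"] exp_moment[OF v c c\<xi>(2), of n, folded f_def] f by (simp add: S.emeasure_eq_measure)
  have "measure (bernoulli p) {x. y ^ 5 / 2 + 2 * K \<le> \<bar>ln (norm (cocycle_iter B x n *v v)) - ln (norm v) - real n * \<Lambda>\<bar>}
      \<le> measure (bernoulli p) ({x. f x \<ge> t} \<union> {x. - f x \<ge> t})"
  proof (intro S.finite_measure_mono)
    have "{x \<in> space (bernoulli p). f x \<ge> t} \<union> {x \<in> space (bernoulli p). - f x \<ge> t} \<in> sets (bernoulli p)" by measurable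
    then show "{x. f x \<ge> t} \<union> {x. - f x \<ge> t} \<in> sets (bernoulli p)" by simp
  qed (use \<Lambda> in \<open>auto simp: f_def t_def\<close>)
  also have "\<dots> \<le> measure (bernoulli p) {x. f x \<ge> t} + measure (bernoulli p) {x. - f x \<ge> t}"
  proof (intro measure_Un_le)
    have "{x \<in> space (bernoulli p). f x \<ge> t} \<in> sets (bernoulli p)" "{x \<in> space (bernoulli p). - f x \<ge> t} \<in> sets (bernoulli p)"
      by measurable
    then show "{x. f x \<ge> t} \<in> sets (bernoulli p)" "{x. - f x \<ge> t} \<in> sets (bernoulli p)" by auto
  qed
  finally show ?thesis using 1 2 by linarith
qed

end

section \<open>Plane geometry and the operator norm\<close>

lemma cross2_cramer: "cross2 u v *\<^sub>R x = cross2 x v *\<^sub>R u + cross2 u x *\<^sub>R (v :: real^2)"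
  by (simp add: vec_eq_iff forall_2 cross2_def algebra_simps)

lemma cross2_eq_0_imp_scale:
  assumes "cross2 u v = 0" "u \<noteq> 0"
  shows "\<exists>c. v = c *\<^sub>R u"
proof -
  have "(u \<bullet> u) *\<^sub>R v = (u \<bullet> v) *\<^sub>R u"
    using assms(1) by (simp add: vec_eq_iff forall_2 cross2_def inner_vec_def sum_2 algebra_simps)
  then have "(1 / (u \<bullet> u)) *\<^sub>R ((u \<bullet> u) *\<^sub>R v) = (1 / (u \<bullet> u)) *\<^sub>R ((u \<bullet> v) *\<^sub>R u)" by simp
  then have "v = ((u \<bullet> v) / (u \<bullet> u)) *\<^sub>R u" using assms(2) by simp
  then show ?thesis by blast
qed

lemma norm_matrix_vector_le: "norm (P *v v) \<le> norm P * norm (v :: real^2)" for P :: "real^2^2"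
proof -
  have "\<bar>(P *v v) $ i\<bar> \<le> norm (P $ i) * norm v" for i
    using Cauchy_Schwarz_ineq2[of "P $ i" v] by (simp add: matrix_vector_mult_def inner_vec_def)
  then have "L2_set (\<lambda>i. norm ((P *v v) $ i)) UNIV \<le> L2_set (\<lambda>i. norm (P $ i) * norm v) UNIV"
    by (intro L2_set_mono) auto
  also have "\<dots> = norm P * norm v"
    by (simp add: norm_vec_def L2_set_left_distrib)
  finally show ?thesis by (simp add: norm_vec_def)
qed

text \<open>The square spanned by \<open>v\<close> and its rotation \<open>w\<close> by a right
  angle keeps its area, while \<open>P *v w\<close> has length at most \<open>M * norm v\<close>; so
  \<open>P *v v\<close> cannot be short.\<close>

lemma norm_le_of_unimodular:
  fixes P :: "real^2^2"
  assumes "\<bar>det P\<bar> = 1" and up: "\<And>v. norm (P *v v) \<le> M * norm v"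
  shows "norm v \<le> M * norm (P *v v)"
proof (cases "v = 0")
  case False
  define w :: "real^2" where "w = vector [- v $ 2, v $ 1]"
  have nw: "norm w = norm v"
    by (simp add: w_def norm_vec_def L2_set_def sum_2 add.commute)
  have "\<bar>cross2 v w\<bar> = norm v * norm v"
    by (simp add: cross2_def w_def norm_vec_def L2_set_def sum_2 power2_eq_square)
  moreover have "\<bar>cross2 (P *v v) (P *v w)\<bar> = \<bar>cross2 v w\<bar>"
    using assms(1) by (simp add: cross2_matrix abs_mult)
  ultimately have "norm v * norm v \<le> norm (P *v v) * norm (P *v w)"
    using abs_cross2_le[of "P *v v" "P *v w"] by simp
  also have "\<dots> \<le> norm (P *v v) * (M * norm v)"
    using up[of w] nw by (intro mult_left_mono) auto
  finally show ?thesis using False by (simp add: mult_ac)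
qed (use up[of 0] in simp)

lemma SL2_abs_det: "P \<in> SL2 \<Longrightarrow> \<bar>det P\<bar> = 1"
  by (auto simp: SL2_def)

lemma bounded_cocycle_of_norm_le:
  assumes "B \<in> cocycles" "\<And>l. norm (B l) \<le> M" "exp 1 \<le> M"
  shows "bounded_cocycle B M"
proof
  show up: "norm (B l *v v) \<le> M * norm v" for l v
    using norm_matrix_vector_le[of "B l" v] mult_right_mono[OF assms(2)[of l], of "norm v"] by simp
  show "norm v \<le> M * norm (B l *v v)" for l v
    using assms(1) by (intro norm_le_of_unimodular SL2_abs_det up) (auto simp: cocycles_def)
qed fact

lemma norm_le_opnorm: "norm (P *v v) \<le> opnorm P * norm v"
  unfolding opnorm_def by (rule onorm) (rule matrix_vector_mul_bounded_linear)

text \<open>Cramer's rule bounds every image by the images of a basis. This reduces the operator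
  norm to two fixed starting vectors, uniformly in the matrix.\<close>

lemma ln_opnorm_basis:
  assumes "cross2 u v \<noteq> 0"
  shows "\<exists>r. \<forall>P. P *v u \<noteq> 0 \<longrightarrow> P *v v \<noteq> 0 \<longrightarrow>
    \<bar>ln (opnorm P) - max (ln (norm (P *v u))) (ln (norm (P *v v)))\<bar> \<le> r"
proof -
  define s where "s = norm u + norm v"
  have uv: "u \<noteq> 0" "v \<noteq> 0" using assms by (auto simp: cross2_def)
  then have s0: "0 < s" by (simp add: s_def add_pos_pos)
  define k where "k = s / \<bar>cross2 u v\<bar>"
  have k0: "0 < k" using s0 assms by (simp add: k_def)
  have "\<bar>ln (opnorm P) - max (ln (norm (P *v u))) (ln (norm (P *v v)))\<bar> \<le> \<bar>ln s\<bar> + \<bar>ln k\<bar>"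
    if Pu: "P *v u \<noteq> 0" and Pv: "P *v v \<noteq> 0" for P
  proof -
    define m where "m = max (norm (P *v u)) (norm (P *v v))"
    have op0: "0 \<le> opnorm P" unfolding opnorm_def
      by (rule onorm_pos_le) (rule matrix_vector_mul_bounded_linear)
    have "norm (P *v u) \<le> opnorm P * s" "norm (P *v v) \<le> opnorm P * s"
      using norm_le_opnorm[of P u] norm_le_opnorm[of P v] op0
      by (auto simp: s_def distrib_left intro: add_increasing2 add_increasing)
    moreover have Pu0: "0 < norm (P *v u)" "0 < norm (P *v v)" using Pu Pv by auto
    ultimately have lo: "ln (norm (P *v u)) \<le> ln (opnorm P * s)" "ln (norm (P *v v)) \<le> ln (opnorm P * s)"
      and "0 < opnorm P * s"
      using ln_mono by (blast, blast, linarith)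
    then have op: "0 < opnorm P" using s0 by (simp add: zero_less_mult_iff)
    have ls: "ln (opnorm P * s) = ln (opnorm P) + ln s" using op s0 by (rule ln_mult_pos)
    have "opnorm P \<le> k * m"
      unfolding opnorm_def
    proof (rule onorm_bound)
      show "0 \<le> k * m" using k0 by (auto simp: m_def le_max_iff_disj)
      fix x
      have "\<bar>cross2 u v\<bar> * norm (P *v x) = norm (P *v (cross2 u v *\<^sub>R x))"
        by (simp add: matrix_vector_mult_scaleR)
      also have "\<dots> = norm (cross2 x v *\<^sub>R (P *v u) + cross2 u x *\<^sub>R (P *v v))"
        by (subst cross2_cramer) (simp add: matrix_vector_right_distrib matrix_vector_mult_scaleR)
      also have "\<dots> \<le> \<bar>cross2 x v\<bar> * norm (P *v u) + \<bar>cross2 u x\<bar> * norm (P *v v)"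
        by (rule order_trans[OF norm_triangle_ineq]) simp
      also have "\<dots> \<le> (norm x * norm v) * m + (norm u * norm x) * m"
        by (intro add_mono mult_mono abs_cross2_le) (auto simp: m_def)
      also have "\<dots> = s * m * norm x" by (simp add: s_def algebra_simps)
      finally have "norm (P *v x) \<le> s * m * norm x / \<bar>cross2 u v\<bar>"
        using assms by (subst pos_le_divide_eq) (auto simp: mult.commute)
      then show "norm (P *v x) \<le> k * m * norm x" by (simp add: k_def)
    qed
    then have "ln (opnorm P) \<le> ln (k * m)" using op by (intro ln_mono)
    also have "\<dots> = ln k + ln m" using k0 Pu by (intro ln_mult_pos) (auto simp: m_def less_max_iff_disj)
    also have "ln m = max (ln (norm (P *v u))) (ln (norm (P *v v)))"
      using Pu Pv by (auto simp: m_def max_def)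
    finally show ?thesis using lo ls by linarith
  qed
  then show ?thesis by blast
qed

lemma powr_sixth:
  assumes "1 \<le> n"
  defines "y \<equiv> real n powr (1 / 6)"
  shows "y ^ 6 = real n" "1 \<le> y" "real n powr (- 1 / 6) = 1 / y"
proof -
  have n: "1 \<le> real n" using assms by simp
  have y0: "0 < y" using n by (simp add: y_def)
  then have "y ^ 6 = y powr (real 6)" by (rule powr_realpow[symmetric])
  then show "y ^ 6 = real n" using n by (simp add: y_def powr_powr)
  show "1 \<le> y" unfolding y_def using n by (intro ge_one_powr_ge_zero) auto
  show "real n powr (- 1 / 6) = 1 / y"
    using powr_minus_divide[of "real n" "1 / 6"] by (simp add: y_def)
qed

section \<open>Almost sure limits and deviations of the norm\<close>

lemma AE_tendsto_of_stretched_tails: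
  fixes f :: "nat \<Rightarrow> (nat \<Rightarrow> 's::finite) \<Rightarrow> real"
  assumes [measurable]: "\<And>n. f n \<in> borel_measurable (bernoulli p)"
    and tail: "\<And>n. N \<le> n \<Longrightarrow> measure (bernoulli p) {x \<in> space (bernoulli p). \<bar>f n x / real n - \<Lambda>\<bar> > real n powr (- 1 / 6)}
      \<le> exp (- (real n powr (1 / 6)))"
  shows "AE x in bernoulli p. (\<lambda>n. f n x / real n) \<longlonglongrightarrow> \<Lambda>"
proof -
  interpret S: prob_space "bernoulli p" by (rule prob_space_bernoulli)
  define A where "A n = {x \<in> space (bernoulli p). \<bar>f n x / real n - \<Lambda>\<bar> > real n powr (- 1 / 6)}" for n
  have "summable (\<lambda>n. measure (bernoulli p) (A n))"
  proof (rule summable_comparison_test_ev)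
    show "\<forall>\<^sub>F n in sequentially. norm (measure (bernoulli p) (A n)) \<le> 12 ^ 12 * inverse (real n ^ 2)"
      using eventually_ge_at_top[of "max 1 N"]
    proof eventually_elim
      case (elim n)
      define y where "y = real n powr (1 / 6)"
      have y: "y ^ 6 = real n" "1 \<le> y" using powr_sixth[of n] elim by (auto simp: y_def)
      \<comment> \<open>The twelfth power turns \<open>exp (- y)\<close> into a multiple of
        \<open>y\<close> to the power -12, which is the summable \<open>1 / n^2\<close>.\<close>
      have "y / 12 \<le> exp (y / 12)" using exp_ge_add_one_self[of "y / 12"] by linarith
      then have "(y / 12) ^ 12 \<le> exp (y / 12) ^ 12" using y by (intro power_mono) auto
      also have "exp (y / 12) ^ 12 = exp y" by (simp flip: exp_of_nat_mult)
      also have "(y / 12) ^ 12 = real n ^ 2 / 12 ^ 12"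
        unfolding y(1)[symmetric] by (simp add: power_divide flip: power_mult)
      finally have "exp (- y) \<le> 12 ^ 12 * inverse (real n ^ 2)"
        using elim by (simp add: exp_minus field_simps)
      then show ?case using tail[of n] elim by (simp add: A_def y_def)
    qed
    show "summable (\<lambda>n. 12 ^ 12 * inverse (real n ^ 2))"
      by (intro summable_mult inverse_power_summable) auto
  qed
  then have "AE x in bernoulli p. eventually (\<lambda>n. x \<in> space (bernoulli p) - A n) sequentially"
  proof (intro borel_cantelli_AE1)
    show "A n \<in> sets (bernoulli p)" for n unfolding A_def by measurable
    show "emeasure (bernoulli p) (A n) < \<infinity>" for n by (simp add: S.emeasure_eq_measure)
  qed
  then show ?thesis
  proof eventually_elim
    case (elim x)
    have "(\<lambda>n. f n x / real n - \<Lambda>) \<longlonglongrightarrow> 0"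
    proof (rule Lim_null_comparison)
      show "\<forall>\<^sub>F n in sequentially. norm (f n x / real n - \<Lambda>) \<le> real n powr (- 1 / 6)"
        using elim by eventually_elim (auto simp: A_def not_less)
      show "(\<lambda>n. real n powr (- 1 / 6)) \<longlonglongrightarrow> 0"
        by (intro tendsto_neg_powr filterlim_real_sequentially) auto
    qed
    then show ?case by (simp add: LIM_zero_iff)
  qed
qed

text \<open>Two constants that agree almost surely in a probability space are equal, which makes the
  definite descriptions of the exponents evaluable.\<close>

lemma THE_AE_limit:
  fixes f :: "nat \<Rightarrow> (nat \<Rightarrow> 's) \<Rightarrow> real"
  assumes "AE x in bernoulli p. (\<lambda>n. f n x) \<longlonglongrightarrow> l"
  shows "(THE l. AE x in bernoulli p. (\<lambda>n. f n x) \<longlonglongrightarrow> l) = l"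
proof (rule the_equality, rule assms)
  interpret S: prob_space "bernoulli p" by (rule prob_space_bernoulli)
  fix l' assume "AE x in bernoulli p. (\<lambda>n. f n x) \<longlonglongrightarrow> l'"
  with assms have "AE x in bernoulli p. l' = l"
    by eventually_elim (rule LIMSEQ_unique)
  then show "l' = l" by (simp add: S.AE_const)
qed

lemma lyap_eq:
  assumes "AE x in bernoulli p. (\<lambda>n. ln (opnorm (cocycle_iter B x n)) / real n) \<longlonglongrightarrow> l"
  shows "lyap p B = l"
  unfolding lyap_def by (rule THE_AE_limit[OF assms])

lemma restricted_exp_eq:
  assumes "AE x in bernoulli p. (\<lambda>n. ln (norm (cocycle_iter B x n *v u)) / real n) \<longlonglongrightarrow> l"
  shows "restricted_exp p B u = l"
  unfolding restricted_exp_def by (rule THE_AE_limit[OF assms])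

lemma (in bounded_cocycle) cocycle_iter_nonzero: "v \<noteq> 0 \<Longrightarrow> cocycle_iter B x n *v v \<noteq> 0"
  by (induction n) (auto simp: B_nonzero simp flip: matrix_vector_mul_assoc)

context oscillation_cocycle
begin

text \<open>With \<open>n = y^6\<close> the permitted deviation of the log norm is
  \<open>y ^ 5\<close>. Half of it goes to \<open>vector_deviation\<close> for each of the two basis
  vectors, the other half absorbs \<open>K\<close> and \<open>r\<close>. The lower bound on
  \<open>n\<close> says that \<open>y ^ 3\<close>, the root of \<open>n\<close>, is at least
  \<open>64 * c\<^sup>2\<close>.\<close>

lemma norm_deviation:
  assumes uv: "u \<in> V" "v \<in> V"
    and r: "\<And>P. P *v u \<noteq> 0 \<Longrightarrow> P *v v \<noteq> 0 \<Longrightarrow>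
      \<bar>ln (opnorm P) - max (ln (norm (P *v u))) (ln (norm (P *v v)))\<bar> \<le> r"
    and r': "\<bar>ln (norm u)\<bar> \<le> r" "\<bar>ln (norm v)\<bar> \<le> r"
    and c: "2 * ln M + K + 2 * r \<le> c"
    and \<Lambda>: "\<And>v n. v \<in> V \<Longrightarrow> \<bar>G n v - real n * \<Lambda>\<bar> \<le> 2 * K"
    and n: "1 \<le> n" "(64 * c\<^sup>2)\<^sup>2 \<le> real n"
  shows "measure (bernoulli p) {x \<in> space (bernoulli p).
      \<bar>ln (opnorm (cocycle_iter B x n)) / real n - \<Lambda>\<bar> > real n powr (- 1 / 6)} < exp (- (real n powr (1 / 6)))"
proof -
  interpret S: prob_space "bernoulli p" by (rule prob_space_bernoulli)
  define y where "y = real n powr (1 / 6)"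
  have y: "y ^ 6 = real n" "1 \<le> y" "real n powr (- 1 / 6) = 1 / y"
    using powr_sixth[of n] n by (auto simp: y_def)
  have r0: "0 \<le> r" using r'(1) by linarith
  have c2: "2 \<le> c" "2 * ln M + K \<le> c" "2 * K + 2 * r \<le> 2 * c" using c ln_M K_nonneg r0 by linarith+
  have "(y ^ 3)\<^sup>2 = y ^ 6" by (simp flip: power_mult)
  then have "(64 * c\<^sup>2)\<^sup>2 \<le> (y ^ 3)\<^sup>2" using n(2) y(1) by linarith
  then have y3: "64 * c\<^sup>2 \<le> y ^ 3"
    by (rule power2_le_imp_le) (use y(2) in simp)
  have "2 * c \<le> c\<^sup>2" using c2 by (simp add: power2_eq_square)
  moreover have "y ^ 3 \<le> y ^ 5" using y by (intro power_increasing) auto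
  moreover have "0 \<le> c\<^sup>2" by simp
  ultimately have y5: "2 * K + 2 * r \<le> y ^ 5 / 2" using y3 c2(3) by linarith
  define E where "E w = {x. y ^ 5 / 2 + 2 * K \<le> \<bar>ln (norm (cocycle_iter B x n *v w)) - ln (norm w) - real n * \<Lambda>\<bar>}" for w
  have Em: "E w \<in> sets (bernoulli p)" for w
  proof -
    have [measurable]: "(\<lambda>x. ln (norm (cocycle_iter B x n *v w))) \<in> borel_measurable (bernoulli p)"
      by (rule borel_measurable_cocycle_iter[where f="\<lambda>P. ln (norm (P *v w))"]) simp
    have "{x \<in> space (bernoulli p). y ^ 5 / 2 + 2 * K \<le> \<bar>ln (norm (cocycle_iter B x n *v w)) - ln (norm w) - real n * \<Lambda>\<bar>} \<in> sets (bernoulli p)"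
      by measurable
    then show ?thesis by (simp add: E_def)
  qed
  have E: "measure (bernoulli p) (E w) \<le> 2 * exp (- 4 * y)" if "w \<in> V" for w
    unfolding E_def using that c2 y y3 \<Lambda> by (intro vector_deviation) auto
  have "measure (bernoulli p) {x \<in> space (bernoulli p).
      \<bar>ln (opnorm (cocycle_iter B x n)) / real n - \<Lambda>\<bar> > real n powr (- 1 / 6)} \<le> measure (bernoulli p) (E u \<union> E v)"
  proof (intro S.finite_measure_mono sets.Un Em subsetI)
    fix x assume "x \<in> {x \<in> space (bernoulli p).
      \<bar>ln (opnorm (cocycle_iter B x n)) / real n - \<Lambda>\<bar> > real n powr (- 1 / 6)}"
    then have "1 / y < \<bar>ln (opnorm (cocycle_iter B x n)) / real n - \<Lambda>\<bar>" using y by simp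
    then have "real n * (1 / y) < real n * \<bar>ln (opnorm (cocycle_iter B x n)) / real n - \<Lambda>\<bar>"
      using n by (intro mult_strict_left_mono) auto
    also have "\<dots> = \<bar>real n * (ln (opnorm (cocycle_iter B x n)) / real n - \<Lambda>)\<bar>" by (simp add: abs_mult)
    also have "real n * (ln (opnorm (cocycle_iter B x n)) / real n - \<Lambda>) = ln (opnorm (cocycle_iter B x n)) - real n * \<Lambda>"
      using n by (simp add: right_diff_distrib)
    also have "real n * (1 / y) = y ^ 5" unfolding y(1)[symmetric] using y(2) by (simp add: power_numeral_reduce)
    finally have "y ^ 5 < \<bar>ln (opnorm (cocycle_iter B x n)) - real n * \<Lambda>\<bar>" .
    moreover have "\<bar>ln (opnorm (cocycle_iter B x n)) -
        max (ln (norm (cocycle_iter B x n *v u))) (ln (norm (cocycle_iter B x n *v v)))\<bar> \<le> r"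
      using uv by (intro r cocycle_iter_nonzero V_nonzero)
    ultimately have "y ^ 5 / 2 + 2 * K \<le> \<bar>ln (norm (cocycle_iter B x n *v u)) - ln (norm u) - real n * \<Lambda>\<bar> \<or>
      y ^ 5 / 2 + 2 * K \<le> \<bar>ln (norm (cocycle_iter B x n *v v)) - ln (norm v) - real n * \<Lambda>\<bar>"
      using y5 r' unfolding max_def by (auto split: if_splits)
    then show "x \<in> E u \<union> E v" by (auto simp: E_def)
  qed
  also have "\<dots> \<le> measure (bernoulli p) (E u) + measure (bernoulli p) (E v)"
    by (intro measure_Un_le Em)
  also have "\<dots> \<le> 4 * exp (- 4 * y)" using E[OF uv(1)] E[OF uv(2)] by linarith
  also have "\<dots> < exp (- y)"
  proof -
    have "2 \<le> exp y" using exp_ge_add_one_self[of y] y(2) by linarith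
    then have "2 ^ 3 \<le> exp y ^ 3" by (intro power_mono) auto
    moreover have "exp y ^ 3 = exp (3 * y)" using exp_of_nat_mult[of 3 y] by simp
    ultimately have "4 < exp (3 * y)" by simp
    then have "4 * exp (- 4 * y) < exp (3 * y) * exp (- 4 * y)" by (intro mult_strict_right_mono) auto
    then show ?thesis by (simp flip: exp_add)
  qed
  finally show ?thesis by (simp add: y_def)
qed

text \<open>A strong law for one starting vector, obtained from the exponential tails by
  Borel-Cantelli; on an invariant line it identifies the restricted exponent.\<close>

lemma vector_exponent:
  assumes v: "v \<in> V" and \<Lambda>: "\<And>n. \<bar>G n v - real n * \<Lambda>\<bar> \<le> 2 * K"
  shows "AE x in bernoulli p. (\<lambda>n. ln (norm (cocycle_iter B x n *v v)) / real n) \<longlonglongrightarrow> \<Lambda>"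
proof -
  interpret S: prob_space "bernoulli p" by (rule prob_space_bernoulli)
  define c where "c = 2 * ln M + K"
  define f where "f n x = ln (norm (cocycle_iter B x n *v v)) - ln (norm v)" for n x
  have f [measurable]: "f n \<in> borel_measurable (bernoulli p)" for n
    unfolding f_def by (rule borel_measurable_cocycle_iter[where f="\<lambda>P. ln (norm (P *v v)) - ln (norm v)"]) simp
  have c2: "2 \<le> c" "K \<le> c" using ln_M K_nonneg by (auto simp: c_def)
  obtain N where N: "(64 * c\<^sup>2)\<^sup>2 \<le> real N" using real_arch_simple by blast
  have "AE x in bernoulli p. (\<lambda>n. f n x / real n) \<longlonglongrightarrow> \<Lambda>"
  proof (rule AE_tendsto_of_stretched_tails[OF f])
    fix n assume "max 1 N \<le> n"
    then have n: "1 \<le> n" "(64 * c\<^sup>2)\<^sup>2 \<le> real n" using N by (auto intro: order_trans)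
    define y where "y = real n powr (1 / 6)"
    have y: "y ^ 6 = real n" "1 \<le> y" "real n powr (- 1 / 6) = 1 / y"
      using powr_sixth[of n] n by (auto simp: y_def)
    have "(y ^ 3)\<^sup>2 = y ^ 6" by (simp flip: power_mult)
  then have "(64 * c\<^sup>2)\<^sup>2 \<le> (y ^ 3)\<^sup>2" using n(2) y(1) by linarith
    then have y3: "64 * c\<^sup>2 \<le> y ^ 3"
    by (rule power2_le_imp_le) (use y(2) in simp)
    have "2 * c \<le> c\<^sup>2" using c2 by (simp add: power2_eq_square)
    moreover have "y ^ 3 \<le> y ^ 5" using y by (intro power_increasing) auto
    moreover have "0 \<le> c\<^sup>2" by simp
    ultimately have y5: "2 * K \<le> y ^ 5 / 2" using y3 c2 by linarith
    have "measure (bernoulli p) {x \<in> space (bernoulli p). \<bar>f n x / real n - \<Lambda>\<bar> > real n powr (- 1 / 6)}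
      \<le> measure (bernoulli p) {x. y ^ 5 / 2 + 2 * K \<le> \<bar>ln (norm (cocycle_iter B x n *v v)) - ln (norm v) - real n * \<Lambda>\<bar>}"
    proof (intro S.finite_measure_mono subsetI)
      fix x assume "x \<in> {x \<in> space (bernoulli p). \<bar>f n x / real n - \<Lambda>\<bar> > real n powr (- 1 / 6)}"
      then have "1 / y < \<bar>f n x / real n - \<Lambda>\<bar>" using y by simp
      then have "real n * (1 / y) < real n * \<bar>f n x / real n - \<Lambda>\<bar>"
        using n by (intro mult_strict_left_mono) auto
      also have "\<dots> = \<bar>real n * (f n x / real n - \<Lambda>)\<bar>" by (simp add: abs_mult)
      also have "real n * (f n x / real n - \<Lambda>) = f n x - real n * \<Lambda>"
        using n by (simp add: right_diff_distrib)
      also have "real n * (1 / y) = y ^ 5" unfolding y(1)[symmetric] using y(2) by (simp add: power_numeral_reduce)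
      finally show "x \<in> {x. y ^ 5 / 2 + 2 * K \<le> \<bar>ln (norm (cocycle_iter B x n *v v)) - ln (norm v) - real n * \<Lambda>\<bar>}"
        using y5 by (simp add: f_def)
    next
      have "{x \<in> space (bernoulli p). y ^ 5 / 2 + 2 * K \<le> \<bar>f n x - real n * \<Lambda>\<bar>} \<in> sets (bernoulli p)"
        by measurable
      then show "{x. y ^ 5 / 2 + 2 * K \<le> \<bar>ln (norm (cocycle_iter B x n *v v)) - ln (norm v) - real n * \<Lambda>\<bar>} \<in> sets (bernoulli p)"
        by (simp add: f_def)
    qed
    also have "\<dots> \<le> 2 * exp (- 4 * y)"
      using v c2 y y3 \<Lambda> by (intro vector_deviation) (auto simp: c_def)
    also have "\<dots> \<le> exp (- y)"
    proof -
      have "2 \<le> exp (3 * y)" using exp_ge_add_one_self[of "3 * y"] y by linarith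
      then have "2 * exp (- 4 * y) \<le> exp (3 * y) * exp (- 4 * y)" by (intro mult_right_mono) auto
      then show ?thesis by (simp flip: exp_add)
    qed
    finally show "measure (bernoulli p) {x \<in> space (bernoulli p). \<bar>f n x / real n - \<Lambda>\<bar> > real n powr (- 1 / 6)}
      \<le> exp (- (real n powr (1 / 6)))" by (simp add: y_def)
  qed
  then show ?thesis
  proof eventually_elim
    case (elim x)
    have "(\<lambda>n. f n x / real n + ln (norm v) / real n) \<longlonglongrightarrow> \<Lambda> + 0"
      by (intro tendsto_add elim lim_const_over_n)
    then show ?case by (simp add: f_def flip: add_divide_distrib)
  qed
qed

end

section \<open>Diagonal cocycles\<close>

lemma eigenvalue_le_norm:
  assumes "P *v u = a *\<^sub>R u" "u \<noteq> 0"
  shows "\<bar>a\<bar> \<le> norm (P :: real^2^2)"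
proof -
  have "\<bar>a\<bar> * norm u \<le> norm P * norm u" using norm_matrix_vector_le[of P u] assms by simp
  then show ?thesis using assms(2) by simp
qed

lemma cocycles_bounded:
  fixes A :: "'s::finite \<Rightarrow> real^2^2"
  assumes "A \<in> cocycles"
  shows "\<exists>M. bounded_cocycle A M"
proof -
  define M where "M = exp 1 + (\<Sum>l\<in>UNIV. norm (A l))"
  have "norm (A l) \<le> M" for l
    using member_le_sum[of l UNIV "\<lambda>l. norm (A l)"] exp_gt_zero[of "1::real"] by (simp add: M_def del: exp_gt_zero)
  moreover have "exp 1 \<le> M" by (simp add: M_def sum_nonneg)
  ultimately have "bounded_cocycle A M" by (rule bounded_cocycle_of_norm_le[OF assms])
  then show ?thesis ..
qed

text \<open>On an invariant line the mean one-step expansion is constant, so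
  \<open>log_growth p A n v\<close> is exactly \<open>n * lam\<close> and does not
  oscillate.\<close>

lemma invariant_line_exponent:
  fixes p :: "'s::finite pmf"
  assumes A: "A \<in> cocycles" and u: "u \<noteq> 0" and eig: "\<And>l. A l *v u = a l *\<^sub>R u"
  shows "AE x in bernoulli p. (\<lambda>n. ln (norm (cocycle_iter A x n *v u)) / real n) \<longlonglongrightarrow> (\<Sum>l\<in>UNIV. pmf p l * ln \<bar>a l\<bar>)"
proof -
  obtain M where "bounded_cocycle A M" using cocycles_bounded[OF A] by blast
  then interpret bounded_cocycle p A M .
  define V where "V = {v. v \<noteq> 0 \<and> (\<forall>l. A l *v v = a l *\<^sub>R v)}"
  define lam where "lam = (\<Sum>l\<in>UNIV. pmf p l * ln \<bar>a l\<bar>)"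
  have inv: "A l *v v \<in> V" if "v \<in> V" for l v
    using that B_nonzero[of v l] by (auto simp: V_def matrix_vector_mult_scaleR)
  have a0: "a l \<noteq> 0" for l using B_nonzero[OF u, of l] eig[of l] by auto
  have G: "log_growth p A n v = real n * lam" if v: "v \<in> V" for n v
  proof -
    have \<phi>: "Q (\<lambda>v. ln (norm v)) w - ln (norm w) = lam" if "w \<in> V" for w
    proof -
      have "ln (norm (A l *v w)) = ln \<bar>a l\<bar> + ln (norm w)" for l
        using that a0[of l] by (simp add: V_def ln_mult)
      then show ?thesis
        by (simp add: markov_op_def lam_def distrib_left sum.distrib sum_pmf_UNIV flip: sum_distrib_right)
    qed
    have "log_growth p A n v = (\<Sum>j<n. (Q ^^ j) (\<lambda>v. Q (\<lambda>v. ln (norm v)) v - ln (norm v)) v)"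
      unfolding log_growth_def by (rule markov_iter_telescope)
    also have "\<dots> = (\<Sum>j<n. (Q ^^ j) (\<lambda>_. lam) v)"
      by (intro sum.cong refl markov_iter_cong \<phi> fold_invariant[of V, OF inv v])
    finally show ?thesis by simp
  qed
  interpret oscillation_cocycle p A M V 0
    by unfold_locales (auto simp: inv G, auto simp: V_def)
  show ?thesis
    unfolding lam_def[symmetric]
    by (rule vector_exponent) (use u eig G in \<open>auto simp: V_def\<close>)
qed

lemma cross2_eq_0_trans:
  assumes "u \<noteq> 0" "cross2 u v = 0" "cross2 u w = 0"
  shows "cross2 v w = 0"
proof -
  obtain c d where "v = c *\<^sub>R u" "w = d *\<^sub>R u"
    using cross2_eq_0_imp_scale[OF assms(2,1)] cross2_eq_0_imp_scale[OF assms(3,1)] by blast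
  then show ?thesis by (simp add: cross2_def)
qed

lemma cross2_scaleR: "cross2 (c *\<^sub>R v) w = c * cross2 v w" "cross2 v (c *\<^sub>R w) = c * cross2 v w"
  by (simp_all add: cross2_def algebra_simps)

lemma cross2_add: "cross2 (v + v') w = cross2 v w + cross2 v' w" "cross2 v (w + w') = cross2 v w + cross2 v w'"
  by (simp_all add: cross2_def algebra_simps)

lemma cross2_diff: "cross2 (v - v') w = cross2 v w - cross2 v' w" "cross2 v (w - w') = cross2 v w - cross2 v w'"
  by (simp_all add: cross2_def algebra_simps)

lemma cross2_self [simp]: "cross2 v v = 0" by (simp add: cross2_def)

lemma inv_line_eigenvalues:
  assumes "inv_line A w"
  shows "\<exists>a. \<forall>l. A l *v w = a l *\<^sub>R w"
  using assms by (intro choice) (simp add: inv_line_def)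

text \<open>The operator norm is comparable to the larger of the norms along the two lines, so the
  Lyapunov exponent is the maximum of the two restricted exponents. Hence some invariant line
  attains it, and the choice in \<open>e_plus\<close> is from a nonempty set.\<close>

lemma Diag_structure:
  fixes p :: "'s::finite pmf"
  assumes A: "A \<in> Diag"
  defines "u \<equiv> e_plus p A"
  shows "\<exists>v a b. norm u = 1 \<and> cross2 u v \<noteq> 0 \<and> (\<forall>l. A l *v u = a l *\<^sub>R u) \<and> (\<forall>l. A l *v v = b l *\<^sub>R v)
     \<and> (\<forall>l. \<bar>a l * b l\<bar> = 1) \<and> lyap p A = (\<Sum>l\<in>UNIV. pmf p l * ln \<bar>a l\<bar>) \<and> a_coef p A = a"
proof -
  have coc: "A \<in> cocycles" using A by (simp add: Diag_def)
  obtain w1 w2 where w: "inv_line A w1" "inv_line A w2" and ncol: "\<not> collinear {0, w1, w2}"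
    using A by (auto simp: Diag_def)
  have w0: "w1 \<noteq> 0" "w2 \<noteq> 0" using w by (auto simp: inv_line_def)
  have cr: "cross2 w1 w2 \<noteq> 0"
    using ncol cross2_eq_0_imp_scale[of w1 w2] w0 by (auto simp: collinear_lemma scalar_mult_eq_scaleR)
  obtain a1 where a1: "\<And>l. A l *v w1 = a1 l *\<^sub>R w1" using inv_line_eigenvalues[OF w(1)] by blast
  obtain a2 where a2: "\<And>l. A l *v w2 = a2 l *\<^sub>R w2" using inv_line_eigenvalues[OF w(2)] by blast
  define l1 l2 where "l1 = (\<Sum>l\<in>UNIV. pmf p l * ln \<bar>a1 l\<bar>)" and "l2 = (\<Sum>l\<in>UNIV. pmf p l * ln \<bar>a2 l\<bar>)"
  have E1: "AE x in bernoulli p. (\<lambda>n. ln (norm (cocycle_iter A x n *v w1)) / real n) \<longlonglongrightarrow> l1"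
    unfolding l1_def by (rule invariant_line_exponent[OF coc w0(1) a1])
  have E2: "AE x in bernoulli p. (\<lambda>n. ln (norm (cocycle_iter A x n *v w2)) / real n) \<longlonglongrightarrow> l2"
    unfolding l2_def by (rule invariant_line_exponent[OF coc w0(2) a2])
  obtain M where "bounded_cocycle A M" using cocycles_bounded[OF coc] by blast
  then interpret bounded_cocycle p A M .
  obtain r where r: "\<And>P. P *v w1 \<noteq> 0 \<Longrightarrow> P *v w2 \<noteq> 0 \<Longrightarrow>
    \<bar>ln (opnorm P) - max (ln (norm (P *v w1))) (ln (norm (P *v w2)))\<bar> \<le> r"
    using ln_opnorm_basis[OF cr] by blast
  from E1 E2 have "AE x in bernoulli p. (\<lambda>n. ln (opnorm (cocycle_iter A x n)) / real n) \<longlonglongrightarrow> max l1 l2"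
  proof eventually_elim
    case (elim x)
    let ?P = "cocycle_iter A x"
    let ?m = "\<lambda>n. max (ln (norm (?P n *v w1)) / real n) (ln (norm (?P n *v w2)) / real n)"
    have m: "?m \<longlonglongrightarrow> max l1 l2" by (intro tendsto_max elim)
    have "(\<lambda>n. ln (opnorm (?P n)) / real n - ?m n) \<longlonglongrightarrow> 0"
    proof (rule Lim_null_comparison)
      show "\<forall>\<^sub>F n in sequentially. norm (ln (opnorm (?P n)) / real n - ?m n) \<le> r / real n"
      proof (intro always_eventually allI)
        fix n
        have "?m n = max (ln (norm (?P n *v w1))) (ln (norm (?P n *v w2))) / real n"
          by (simp add: max_divide_distrib_right)
        then have "norm (ln (opnorm (?P n)) / real n - ?m n)
            = \<bar>ln (opnorm (?P n)) - max (ln (norm (?P n *v w1))) (ln (norm (?P n *v w2)))\<bar> / real n"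
          by (simp flip: diff_divide_distrib)
        also have "\<dots> \<le> r / real n"
          using w0 by (intro divide_right_mono r cocycle_iter_nonzero) auto
        finally show "norm (ln (opnorm (?P n)) / real n - ?m n) \<le> r / real n" .
      qed
    qed (rule lim_const_over_n)
    from tendsto_add[OF this m] show ?case by simp
  qed
  then have ly: "lyap p A = max l1 l2" by (rule lyap_eq)
  have ex: "\<exists>u. norm u = 1 \<and> inv_line A u \<and> restricted_exp p A u = lam"
    if "w \<noteq> 0" "\<And>l. A l *v w = a l *\<^sub>R w" "lam = (\<Sum>l\<in>UNIV. pmf p l * ln \<bar>a l\<bar>)" for w a lam
  proof -
    let ?w = "w /\<^sub>R norm w"
    have eig: "A l *v ?w = a l *\<^sub>R ?w" for l by (simp add: matrix_vector_mult_scaleR that)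
    have "?w \<noteq> 0" using that by simp
    from restricted_exp_eq[OF invariant_line_exponent[OF coc this eig, of p]] that eig show ?thesis
      by (intro exI[of _ ?w]) (auto simp: inv_line_def)
  qed
  have "\<exists>u. norm u = 1 \<and> inv_line A u \<and> restricted_exp p A u = lyap p A"
    using ex[OF w0(1) a1 l1_def] ex[OF w0(2) a2 l2_def] ly by (cases "l1 \<le> l2") (auto simp: max_def)
  then have "norm u = 1 \<and> inv_line A u \<and> restricted_exp p A u = lyap p A"
    unfolding u_def e_plus_def by (rule someI_ex)
  then have u: "norm u = 1" "inv_line A u" "restricted_exp p A u = lyap p A" by auto
  obtain a where a: "\<And>l. A l *v u = a l *\<^sub>R u" using inv_line_eigenvalues[OF u(2)] by blast
  have u0: "u \<noteq> 0" using u by auto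
  have ly': "lyap p A = (\<Sum>l\<in>UNIV. pmf p l * ln \<bar>a l\<bar>)"
    using restricted_exp_eq[OF invariant_line_exponent[OF coc u0 a, of p]] u(3) by simp
  have ac: "a_coef p A = a"
  proof
    fix l
    show "a_coef p A l = a l"
      unfolding a_coef_def u_def[symmetric] using a u0 by (intro the_equality) auto
  qed
  \<comment> \<open>The chosen \<open>u\<close> need not lie on either given line, but it cannot be
    parallel to both, so one of them serves as \<open>v\<close>.\<close>
  have "cross2 u w1 \<noteq> 0 \<or> cross2 u w2 \<noteq> 0" using cross2_eq_0_trans[OF u0] cr by blast
  then obtain v b where v: "cross2 u v \<noteq> 0" "\<And>l. A l *v v = b l *\<^sub>R v" using a1 a2 by blast
  have "\<bar>a l * b l\<bar> = 1" for l
  proof -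
    have "a l * b l * cross2 u v = det (A l) * cross2 u v"
      using cross2_matrix[of "A l" u v] by (simp add: a v cross2_scaleR mult_ac)
    moreover have "\<bar>det (A l)\<bar> = 1" using coc SL2_abs_det by (auto simp: cocycles_def)
    ultimately show ?thesis using v(1) by simp
  qed
  with u a v ly' ac show ?thesis by blast
qed

section \<open>Perturbation of a diagonal cocycle\<close>

text \<open>At the points \<sigma> and -\<sigma> the linear term dominates and changes sign. Such
  equations describe the slopes of the invariant directions of a nearly diagonal matrix.\<close>

lemma small_quadratic_root:
  fixes a b d \<kappa> \<sigma> g :: real
  assumes "\<bar>a\<bar> \<le> \<kappa>" "\<bar>b\<bar> \<le> \<kappa>" "g - 2 * \<kappa> \<le> \<bar>d\<bar>" "0 < \<sigma>" "\<sigma> \<le> 1" "0 \<le> \<kappa>" "\<kappa> < g * \<sigma> / 4" "0 < g"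
  shows "\<exists>s. \<bar>s\<bar> \<le> \<sigma> \<and> a * s\<^sup>2 + d * s - b = 0"
proof -
  let ?f = "\<lambda>s. a * s\<^sup>2 + d * s - b"
  have "\<bar>a * \<sigma>\<^sup>2\<bar> \<le> \<kappa> * 1"
    unfolding abs_mult using assms by (intro mult_mono) (auto simp: power_le_one)
  then have ab: "\<bar>a * \<sigma>\<^sup>2 - b\<bar> \<le> 2 * \<kappa>" using assms by linarith
  have "g * \<sigma> \<le> g * 1" using assms by (intro mult_left_mono) auto
  then have "g / 2 < g - 2 * \<kappa>" using assms by linarith
  then have "g / 2 * \<sigma> < \<bar>d\<bar> * \<sigma>" using assms by (intro mult_strict_right_mono) auto
  then have "2 * \<kappa> < \<bar>d\<bar> * \<sigma>" using \<open>\<kappa> < g * \<sigma> / 4\<close> by linarith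
  then have gap: "\<bar>a * \<sigma>\<^sup>2 - b\<bar> < \<bar>d * \<sigma>\<bar>" using ab assms by (simp add: abs_mult)
  have cont: "continuous_on {- \<sigma>..\<sigma>} ?f" by (intro continuous_intros)
  show ?thesis
  proof (cases "0 \<le> d * \<sigma>")
    case True
    then have "?f (- \<sigma>) \<le> 0" "0 \<le> ?f \<sigma>" using gap by (auto simp: abs_if split: if_splits)
    then obtain s where "- \<sigma> \<le> s" "s \<le> \<sigma>" "?f s = 0"
      using IVT'[of ?f "- \<sigma>" 0 \<sigma>] cont assms by auto
    then show ?thesis by (intro exI[of _ s]) auto
  next
    case False
    then have "?f \<sigma> \<le> 0" "0 \<le> ?f (- \<sigma>)" using gap by (auto simp: abs_if split: if_splits)
    then obtain s where "- \<sigma> \<le> s" "s \<le> \<sigma>" "?f s = 0"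
      using IVT2'[of ?f \<sigma> 0 "- \<sigma>"] cont assms by auto
    then show ?thesis by (intro exI[of _ s]) auto
  qed
qed

text \<open>Two independent contracted eigenvectors would force a determinant of modulus below 1, so
  the contracting line is unique and the choice in \<open>e_minus\<close> is determined up to a
  scalar.\<close>

lemma e_minus_eq_scale:
  assumes P: "\<bar>det P\<bar> = 1" and w: "w \<noteq> 0" "P *v w = \<mu> *\<^sub>R w" "\<bar>\<mu>\<bar> < 1"
  shows "\<exists>k. k \<noteq> 0 \<and> e_minus P = k *\<^sub>R w"
proof -
  have "norm (w /\<^sub>R norm w) = 1 \<and> (\<exists>\<mu>. \<bar>\<mu>\<bar> < 1 \<and> P *v (w /\<^sub>R norm w) = \<mu> *\<^sub>R (w /\<^sub>R norm w))"
    using w by (auto simp: matrix_vector_mult_scaleR intro!: exI[of _ \<mu>])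
  then have "norm (e_minus P) = 1 \<and> (\<exists>\<mu>. \<bar>\<mu>\<bar> < 1 \<and> P *v e_minus P = \<mu> *\<^sub>R e_minus P)"
    unfolding e_minus_def by (rule someI)
  then obtain \<mu>' where e: "norm (e_minus P) = 1" "\<bar>\<mu>'\<bar> < 1" "P *v e_minus P = \<mu>' *\<^sub>R e_minus P" by blast
  have "\<mu> * \<mu>' * cross2 w (e_minus P) = det P * cross2 w (e_minus P)"
    using cross2_matrix[of P w "e_minus P"] by (simp add: w e cross2_scaleR mult_ac)
  moreover have "\<bar>\<mu> * \<mu>'\<bar> < 1"
    unfolding abs_mult using abs_mult_less[OF w(3) e(2)] by simp
  then have "\<mu> * \<mu>' \<noteq> det P" using P by auto
  ultimately have "cross2 w (e_minus P) = 0" by simp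
  then obtain k where "e_minus P = k *\<^sub>R w" using cross2_eq_0_imp_scale w(1) by blast
  with e(1) show ?thesis by (intro exI[of _ k]) auto
qed

lemma proj_dist_eq_pdist:
  assumes "v \<noteq> 0" "w \<noteq> 0"
  shows "proj_dist v w = pdist v w"
proof -
  define c where "c = (v \<bullet> w) / (norm v * norm w)"
  have nz: "norm v * norm w > 0" using assms by simp
  have "\<bar>c\<bar> \<le> 1" using Cauchy_Schwarz_ineq2[of v w] nz by (simp add: c_def divide_le_eq)
  then have eq: "proj_dist v w = sqrt (1 - c\<^sup>2)"
    by (simp add: proj_dist_def vec_angle_def c_def[symmetric] sin_arccos_abs abs_square_le_1)
  have "c\<^sup>2 + (pdist v w)\<^sup>2 = ((v \<bullet> w)\<^sup>2 + (cross2 v w)\<^sup>2) / (norm v * norm w)\<^sup>2"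
    by (simp add: c_def pdist_def power_divide add_divide_distrib)
  also have "\<dots> = 1" using cross2_sq[of v w] assms by (simp add: power_mult_distrib add.commute)
  finally have "1 - c\<^sup>2 = (pdist v w)\<^sup>2" by simp
  with eq show ?thesis by (simp add: pdist_nonneg)
qed

lemma pdist_scaleR: "a \<noteq> 0 \<Longrightarrow> b \<noteq> 0 \<Longrightarrow> pdist (a *\<^sub>R v) (b *\<^sub>R w) = pdist v w"
  by (simp add: pdist_def cross2_scaleR abs_mult)

lemma cross2_zero [simp]: "cross2 0 w = 0" "cross2 w 0 = 0" by (simp_all add: cross2_def)

text \<open>The diagonal entries are separated by about \<open>E - 1 / E\<close>, which gives small
  roots \<open>s\<close> and \<open>t\<close> of the slope equations; the invariant directions are
  then \<open>s *\<^sub>R u + v\<close> and \<open>u + t *\<^sub>R v\<close>.\<close>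

lemma perturbed_hyperbolic:
  fixes P :: "real^2^2" and E :: real
  assumes uv: "cross2 u v \<noteq> 0"
    and Pu: "P *v u = \<alpha> *\<^sub>R u + \<gamma> *\<^sub>R v" and Pv: "P *v v = \<beta> *\<^sub>R u + \<delta> *\<^sub>R v"
    and close: "\<bar>\<alpha> - a\<bar> \<le> \<kappa>" "\<bar>\<delta> - b\<bar> \<le> \<kappa>" "\<bar>\<beta>\<bar> \<le> \<kappa>" "\<bar>\<gamma>\<bar> \<le> \<kappa>"
    and E: "1 < E" "E \<le> \<bar>a\<bar>" "\<bar>b\<bar> \<le> 1 / E"
    and \<kappa>: "\<kappa> < (E - 1 / E) * \<sigma> / 4" "2 * \<kappa> < 1 - 1 / E" "2 * \<kappa> < E - 1" "0 < \<sigma>" "\<sigma> \<le> 1"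
  shows "hyperbolic P" "\<exists>s \<mu>. \<bar>s\<bar> \<le> \<sigma> \<and> \<bar>\<mu>\<bar> < 1 \<and> P *v (s *\<^sub>R u + v) = \<mu> *\<^sub>R (s *\<^sub>R u + v)"
proof -
  have \<kappa>0: "0 \<le> \<kappa>" using close(1) by linarith
  have "1 / E < 1" using E(1) by simp
  then have g: "0 < E - 1 / E" using E(1) by linarith
  have u0: "u \<noteq> 0" and v0: "v \<noteq> 0" using uv by (auto simp: cross2_def)
  have gap: "E - 1 / E - 2 * \<kappa> \<le> \<bar>\<delta> - \<alpha>\<bar>" "E - 1 / E - 2 * \<kappa> \<le> \<bar>\<alpha> - \<delta>\<bar>"
    using close E(2,3) by linarith+
  obtain s where s: "\<bar>s\<bar> \<le> \<sigma>" "\<gamma> * s\<^sup>2 + (\<delta> - \<alpha>) * s - \<beta> = 0"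
    using small_quadratic_root[of \<gamma> \<kappa> \<beta> "E - 1 / E" "\<delta> - \<alpha>" \<sigma>] close gap \<kappa> \<kappa>0 g by blast
  obtain t where t: "\<bar>t\<bar> \<le> \<sigma>" "\<beta> * t\<^sup>2 + (\<alpha> - \<delta>) * t - \<gamma> = 0"
    using small_quadratic_root[of \<beta> \<kappa> \<gamma> "E - 1 / E" "\<alpha> - \<delta>" \<sigma>] close gap \<kappa> \<kappa>0 g by blast
  have "\<bar>s\<bar> \<le> 1" "\<bar>t\<bar> \<le> 1" using s(1) t(1) \<kappa>(5) by linarith+
  then have "\<bar>s * \<gamma>\<bar> \<le> 1 * \<kappa>" "\<bar>t * \<beta>\<bar> \<le> 1 * \<kappa>"
    unfolding abs_mult using close(3,4) by (intro mult_mono; simp)+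
  then have \<mu>: "\<bar>s * \<gamma> + \<delta>\<bar> < 1" and lam: "1 < \<bar>\<alpha> + t * \<beta>\<bar>" using close E \<kappa> by linarith+
  have "P *v (s *\<^sub>R u + v) = (s * \<alpha> + \<beta>) *\<^sub>R u + (s * \<gamma> + \<delta>) *\<^sub>R v"
    by (simp add: matrix_vector_right_distrib matrix_vector_mult_scaleR Pu Pv algebra_simps)
  also have "s * \<alpha> + \<beta> = (s * \<gamma> + \<delta>) * s" using s(2) by (simp add: algebra_simps power2_eq_square)
  finally have eig1: "P *v (s *\<^sub>R u + v) = (s * \<gamma> + \<delta>) *\<^sub>R (s *\<^sub>R u + v)" by (simp add: scaleR_add_right)
  have "P *v (u + t *\<^sub>R v) = (\<alpha> + t * \<beta>) *\<^sub>R u + (\<gamma> + t * \<delta>) *\<^sub>R v"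
    by (simp add: matrix_vector_right_distrib matrix_vector_mult_scaleR Pu Pv algebra_simps)
  also have "\<gamma> + t * \<delta> = (\<alpha> + t * \<beta>) * t" using t(2) by (simp add: algebra_simps power2_eq_square)
  finally have eig2: "P *v (u + t *\<^sub>R v) = (\<alpha> + t * \<beta>) *\<^sub>R (u + t *\<^sub>R v)" by (simp add: scaleR_add_right)
  have "cross2 u (s *\<^sub>R u + v) \<noteq> 0" "cross2 (u + t *\<^sub>R v) v \<noteq> 0"
    using uv by (simp_all add: cross2_add cross2_scaleR)
  then have "s *\<^sub>R u + v \<noteq> 0" "u + t *\<^sub>R v \<noteq> 0" by (metis cross2_zero)+
  with eig1 eig2 \<mu> lam show "hyperbolic P" unfolding hyperbolic_def by blast
  show "\<exists>s \<mu>. \<bar>s\<bar> \<le> \<sigma> \<and> \<bar>\<mu>\<bar> < 1 \<and> P *v (s *\<^sub>R u + v) = \<mu> *\<^sub>R (s *\<^sub>R u + v)"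
    using s(1) \<mu> eig1 by blast
qed

locale diagonal_cocycle =
  fixes p :: "'s::finite pmf" and A :: "'s \<Rightarrow> real^2^2" and u v :: "real^2" and a b :: "'s \<Rightarrow> real" and L :: real
  assumes supp: "set_pmf p = UNIV" and norm_u: "norm u = 1" and uv: "cross2 u v \<noteq> 0"
    and Au: "\<And>l. A l *v u = a l *\<^sub>R u" and Av: "\<And>l. A l *v v = b l *\<^sub>R v"
    and ab: "\<And>l. \<bar>a l * b l\<bar> = 1"
    and L: "L = (\<Sum>l\<in>UNIV. pmf p l * ln \<bar>a l\<bar>)" "0 < L"
begin

definition "\<Delta> = \<bar>cross2 u v\<bar>"
definition "S = norm u + norm v"
text \<open>The summand 1 lets the same bound serve every cocycle within distance 1 of
  \<open>A\<close>.\<close>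

definition "M = exp 1 + (\<Sum>l\<in>UNIV. norm (A l) + 1)"

lemma \<Delta>_pos: "0 < \<Delta>" using uv by (simp add: \<Delta>_def)

lemma S_ge: "1 \<le> S" "norm u \<le> S" "norm v \<le> S" using norm_u by (auto simp: S_def)

lemma M_bounds: "norm (A l) + 1 \<le> M" "exp 1 \<le> M"
  using member_le_sum[of l UNIV "\<lambda>l. norm (A l) + 1"] by (auto simp: M_def sum_nonneg less_imp_le add_increasing)

lemma M_pos: "0 < M" using M_bounds(2) exp_gt_zero[of 1] by linarith

lemma u_nonzero: "u \<noteq> 0" and v_nonzero: "v \<noteq> 0"
  using uv by (auto simp: cross2_def)

lemma near_bounded:
  assumes "B \<in> cocycles" "\<And>l. norm (B l - A l) \<le> 1"
  shows "bounded_cocycle B M"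
proof (rule bounded_cocycle_of_norm_le[OF assms(1) _ M_bounds(2)])
  fix l
  have "norm (B l) \<le> norm (A l) + norm (B l - A l)" by (rule norm_triangle_sub)
  then show "norm (B l) \<le> M" using M_bounds(1)[of l] assms(2)[of l] by linarith
qed

text \<open>For \<open>x\<close> and \<open>y\<close> among \<open>u\<close> and \<open>v\<close>
  these quotients are, up to sign, the matrix entries in that basis, by Cramer's rule.\<close>

lemma entry_close:
  assumes "norm (P - A l) \<le> \<epsilon>" "norm x \<le> S" "norm y \<le> S"
  shows "\<bar>cross2 (P *v x) y / cross2 u v - cross2 (A l *v x) y / cross2 u v\<bar> \<le> \<epsilon> * S\<^sup>2 / \<Delta>"
    "\<bar>cross2 y (P *v x) / cross2 u v - cross2 y (A l *v x) / cross2 u v\<bar> \<le> \<epsilon> * S\<^sup>2 / \<Delta>"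
proof -
  have n: "norm ((P - A l) *v x) * norm y \<le> \<epsilon> * S\<^sup>2"
  proof -
    have "norm ((P - A l) *v x) * norm y \<le> (norm (P - A l) * norm x) * norm y"
      by (intro mult_right_mono norm_matrix_vector_le) auto
    also have "\<dots> \<le> (\<epsilon> * S) * S"
      using assms S_ge order_trans[OF norm_ge_zero assms(1)] by (intro mult_mono) auto
    finally show ?thesis by (simp add: power2_eq_square mult.assoc)
  qed
  have "\<bar>cross2 ((P - A l) *v x) y\<bar> \<le> \<epsilon> * S\<^sup>2" "\<bar>cross2 y ((P - A l) *v x)\<bar> \<le> \<epsilon> * S\<^sup>2"
    using abs_cross2_le[of "(P - A l) *v x" y] abs_cross2_le[of y "(P - A l) *v x"] n by (auto simp: mult.commute)
  then have "\<bar>cross2 ((P - A l) *v x) y\<bar> / \<Delta> \<le> \<epsilon> * S\<^sup>2 / \<Delta>" "\<bar>cross2 y ((P - A l) *v x)\<bar> / \<Delta> \<le> \<epsilon> * S\<^sup>2 / \<Delta>"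
    using \<Delta>_pos by (auto intro!: divide_right_mono)
  then show "\<bar>cross2 (P *v x) y / cross2 u v - cross2 (A l *v x) y / cross2 u v\<bar> \<le> \<epsilon> * S\<^sup>2 / \<Delta>"
    "\<bar>cross2 y (P *v x) / cross2 u v - cross2 y (A l *v x) / cross2 u v\<bar> \<le> \<epsilon> * S\<^sup>2 / \<Delta>"
    by (simp_all add: \<Delta>_def matrix_vector_mult_diff_rdistrib cross2_diff flip: diff_divide_distrib)
qed

text \<open>Here \<open>D\<close> is independent of \<open>B\<close>, so \<rho> enters only through
  the explicit logarithm. The bound \<open>\<rho> \<le> exp (- 1)\<close> makes this logarithm at
  least 1, so that it can later absorb constants.\<close>

lemma near_expansion:
  "\<exists>\<epsilon> D. 0 < \<epsilon> \<and> \<epsilon> \<le> 1 \<and> (\<forall>B\<in>cocycles. (\<forall>l. norm (B l - A l) < \<epsilon>) \<longrightarrow>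
     (\<forall>i. exp L \<le> \<bar>a i\<bar> \<longrightarrow> hyperbolic (B i)) \<and>
     (\<forall>i j \<rho>. exp L \<le> \<bar>a i\<bar> \<longrightarrow> (\<forall>l. proj_dist (B l *v e_minus (B i)) (e_minus (B i)) \<le> \<rho>) \<longrightarrow>
        proj_dist (B j *v e_minus (B i)) (e_minus (B i)) = \<rho> \<longrightarrow> 0 < \<rho> \<longrightarrow>
        \<rho> \<le> exp (- 1) \<and>
        (\<forall>n x. x \<noteq> 0 \<longrightarrow> ln (norm x) + real n * (L / 4) - D - ln (1 / \<rho>)
            \<le> (markov_op p (\<lambda>l x. B l *v x) ^^ n) (\<lambda>x. ln (norm x)) x)))"
proof -
  \<comment> \<open>Bounds for \<open>\<bar>\<beta>' l\<bar> / \<rho>\<close>: the quantity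
    \<open>\<bar>\<beta>' l\<bar> * \<Delta>\<close> is the distance times
    \<open>norm (B l *v w) * norm w\<close>, and this product lies between
    \<open>\<Delta>\<^sup>2 / M\<close> and \<open>M * S\<^sup>2\<close>.\<close>
  define C where "C = M * S\<^sup>2 / \<Delta>"
  define c where "c = \<Delta> / M"
  have Cc: "0 < C" "0 < c" using M_pos S_ge \<Delta>_pos by (auto simp: C_def c_def)
  from uniform_drift[where 'v="real^2", OF supp ab L Cc]
  obtain \<eta> D where \<eta>: "0 < \<eta>" and drift: "\<forall>(T::'s \<Rightarrow> real^2 \<Rightarrow> real^2) X Y \<alpha> \<beta> \<gamma> \<delta> i j.
     (\<forall>l v. X (T l v) = \<alpha> l * X v + \<beta> l * Y v) \<longrightarrow> (\<forall>l v. Y (T l v) = \<gamma> l * X v + \<delta> l * Y v) \<longrightarrow>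
     (\<forall>l. \<bar>\<alpha> l - a l\<bar> \<le> \<eta> \<and> \<bar>\<delta> l - b l\<bar> \<le> \<eta> \<and> \<bar>\<gamma> l\<bar> \<le> \<eta> \<and> \<bar>\<beta> l\<bar> \<le> C) \<longrightarrow>
     \<beta> i = 0 \<longrightarrow> exp L \<le> \<bar>a i\<bar> \<longrightarrow> c \<le> \<bar>\<beta> j\<bar> \<longrightarrow>
     (\<forall>n v. 0 < \<bar>X v\<bar> + \<bar>Y v\<bar> \<longrightarrow>
        ln (\<bar>X v\<bar> + \<bar>Y v\<bar>) + real n * (L / 4) - D \<le> (markov_op p T ^^ n) (\<lambda>v. ln (\<bar>X v\<bar> + \<bar>Y v\<bar>)) v)"
    by (elim exE conjE) (rule that)
  define E where "E = exp L"
  have E: "1 < E" "1 / E < 1" using L(2) by (simp_all add: E_def)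
  \<comment> \<open>Bounds the slope of \<open>w\<close> against \<open>v\<close>; the second entry
    is what forces \<rho> below 1/3.\<close>
  define \<sigma> where "\<sigma> = min 1 (\<Delta> / (3 * M * (4 + 2 * M)))"
  have \<sigma>: "0 < \<sigma>" "\<sigma> \<le> 1" using \<Delta>_pos M_pos by (auto simp: \<sigma>_def)
  have "\<sigma> \<le> \<Delta> / (3 * M * (4 + 2 * M))" by (simp add: \<sigma>_def)
  then have "\<sigma> * (3 * M * (4 + 2 * M)) \<le> \<Delta>" using M_pos by (subst (asm) pos_le_divide_eq) auto
  then have "3 * ((4 + 2 * M) * \<sigma> * M) \<le> \<Delta>" by (simp add: mult_ac)
  then have \<sigma>': "(4 + 2 * M) * \<sigma> * M / \<Delta> \<le> 1 / 3" using \<Delta>_pos by (subst pos_divide_le_eq) auto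
  \<comment> \<open>Half of \<eta> is reserved because passing from the basis \<open>u, v\<close> to
    \<open>u, w\<close> changes the diagonal entries by a further term of size \<kappa>. The last
    three entries serve hyperbolicity.\<close>
  define \<kappa> where "\<kappa> = Min {\<sigma>, \<eta> / 2, (E - 1 / E) * \<sigma> / 8, (1 - 1 / E) / 4, (E - 1) / 4}"
  have gE: "0 < E - 1 / E" using E by linarith
  have \<kappa>0: "0 < \<kappa>" unfolding \<kappa>_def using \<sigma> \<eta> E gE by (subst Min_gr_iff) (auto intro!: mult_pos_pos)
  have \<kappa>: "\<kappa> \<le> \<sigma>" "\<kappa> \<le> \<eta> / 2" "\<kappa> \<le> (E - 1 / E) * \<sigma> / 8" "\<kappa> \<le> (1 - 1 / E) / 4" "\<kappa> \<le> (E - 1) / 4"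
    unfolding \<kappa>_def by (rule Min_le; simp)+
  have gs: "0 < (E - 1 / E) * \<sigma>" using gE \<sigma> by (intro mult_pos_pos)
  define \<epsilon> where "\<epsilon> = min 1 (\<kappa> * \<Delta> / S\<^sup>2)"
  have S2: "0 < S\<^sup>2" using S_ge by simp
  have \<epsilon>: "0 < \<epsilon>" "\<epsilon> \<le> 1" using \<kappa>0 \<Delta>_pos S2 by (auto simp: \<epsilon>_def)
  have "\<epsilon> \<le> \<kappa> * \<Delta> / S\<^sup>2" by (simp add: \<epsilon>_def)
  then have \<epsilon>\<kappa>: "\<epsilon> * S\<^sup>2 / \<Delta> \<le> \<kappa>" using \<Delta>_pos S2 by (simp add: field_simps)
  define D1 where "D1 = D + ln ((S + 1) / \<Delta>) + ln (1 + S)"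
  show ?thesis
  proof (rule exI[of _ \<epsilon>], rule exI[of _ D1], intro conjI \<epsilon> ballI impI)
    fix B :: "'s \<Rightarrow> real^2^2" assume B: "B \<in> cocycles" and near: "\<forall>l. norm (B l - A l) < \<epsilon>"
    then have near': "norm (B l - A l) \<le> \<epsilon>" for l by (simp add: less_imp_le)
    interpret bounded_cocycle p B M
      by (rule near_bounded[OF B]) (use near' \<epsilon>(2) in \<open>blast intro: order_trans\<close>)
    define \<alpha> \<beta> \<gamma> \<delta> where "\<alpha> l = cross2 (B l *v u) v / cross2 u v" and "\<beta> l = cross2 (B l *v v) v / cross2 u v"
      and "\<gamma> l = cross2 u (B l *v u) / cross2 u v" and "\<delta> l = cross2 u (B l *v v) / cross2 u v" for l
    have decomp: "x = (cross2 x v / cross2 u v) *\<^sub>R u + (cross2 u x / cross2 u v) *\<^sub>R v" for x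
    proof -
      have "(1 / cross2 u v) *\<^sub>R (cross2 u v *\<^sub>R x) = (1 / cross2 u v) *\<^sub>R (cross2 x v *\<^sub>R u + cross2 u x *\<^sub>R v)"
        by (subst cross2_cramer) simp
      then show ?thesis using uv by (simp add: scaleR_add_right)
    qed
    have Bu: "B l *v u = \<alpha> l *\<^sub>R u + \<gamma> l *\<^sub>R v" and Bv: "B l *v v = \<beta> l *\<^sub>R u + \<delta> l *\<^sub>R v" for l
      unfolding \<alpha>_def \<beta>_def \<gamma>_def \<delta>_def by (rule decomp)+
    have close: "\<bar>\<alpha> l - a l\<bar> \<le> \<kappa>" "\<bar>\<delta> l - b l\<bar> \<le> \<kappa>" "\<bar>\<beta> l\<bar> \<le> \<kappa>" "\<bar>\<gamma> l\<bar> \<le> \<kappa>" for l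
    proof -
      have e: "cross2 (A l *v u) v / cross2 u v = a l" "cross2 u (A l *v v) / cross2 u v = b l"
        "cross2 (A l *v v) v / cross2 u v = 0" "cross2 u (A l *v u) / cross2 u v = 0"
        using uv by (simp_all add: Au Av cross2_scaleR)
      show "\<bar>\<alpha> l - a l\<bar> \<le> \<kappa>" "\<bar>\<delta> l - b l\<bar> \<le> \<kappa>" "\<bar>\<beta> l\<bar> \<le> \<kappa>" "\<bar>\<gamma> l\<bar> \<le> \<kappa>"
        using entry_close(1)[OF near' S_ge(2,3), of l] entry_close(2)[OF near' S_ge(3,2), of l]
          entry_close(1)[OF near' S_ge(3,3), of l] entry_close(2)[OF near' S_ge(2,2), of l] \<epsilon>\<kappa>
        unfolding e \<alpha>_def \<beta>_def \<gamma>_def \<delta>_def by linarith+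
    qed
    have b_le: "\<bar>b i\<bar> \<le> 1 / E" if "E \<le> \<bar>a i\<bar>" for i
    proof -
      have "E * \<bar>b i\<bar> \<le> \<bar>a i\<bar> * \<bar>b i\<bar>" using that by (intro mult_right_mono) auto
      then show ?thesis using ab[of i] E(1) by (simp add: abs_mult field_simps)
    qed
    have "x / 8 < x / 4" if "0 < x" for x :: real using that by simp
    from le_less_trans[OF \<kappa>(3) this[OF gs]]
    have \<kappa>_less: "\<kappa> < (E - 1 / E) * \<sigma> / 4" "2 * \<kappa> < 1 - 1 / E" "2 * \<kappa> < E - 1"
      using \<kappa>(4,5) E by argo+
    have hyp: "hyperbolic (B i)" "\<exists>s \<mu>. \<bar>s\<bar> \<le> \<sigma> \<and> \<bar>\<mu>\<bar> < 1 \<and> B i *v (s *\<^sub>R u + v) = \<mu> *\<^sub>R (s *\<^sub>R u + v)"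
      if "E \<le> \<bar>a i\<bar>" for i
      by (rule perturbed_hyperbolic[OF uv Bu Bv close E(1) that b_le[OF that] \<kappa>_less \<sigma>])+
    show "\<forall>i. exp L \<le> \<bar>a i\<bar> \<longrightarrow> hyperbolic (B i)" using hyp(1) by (simp add: E_def)
    show "\<forall>i j \<rho>. exp L \<le> \<bar>a i\<bar> \<longrightarrow> (\<forall>l. proj_dist (B l *v e_minus (B i)) (e_minus (B i)) \<le> \<rho>) \<longrightarrow>
        proj_dist (B j *v e_minus (B i)) (e_minus (B i)) = \<rho> \<longrightarrow> 0 < \<rho> \<longrightarrow>
        \<rho> \<le> exp (- 1) \<and>
        (\<forall>n x. x \<noteq> 0 \<longrightarrow> ln (norm x) + real n * (L / 4) - D1 - ln (1 / \<rho>)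
            \<le> (markov_op p (\<lambda>l x. B l *v x) ^^ n) (\<lambda>x. ln (norm x)) x)"
    proof (intro allI impI)
      fix i j \<rho>
      assume i: "exp L \<le> \<bar>a i\<bar>" and le: "\<forall>l. proj_dist (B l *v e_minus (B i)) (e_minus (B i)) \<le> \<rho>"
        and eq: "proj_dist (B j *v e_minus (B i)) (e_minus (B i)) = \<rho>" and \<rho>0: "0 < \<rho>"
      obtain s \<mu> where s: "\<bar>s\<bar> \<le> \<sigma>" and \<mu>: "\<bar>\<mu>\<bar> < 1" "B i *v (s *\<^sub>R u + v) = \<mu> *\<^sub>R (s *\<^sub>R u + v)"
        using hyp(2)[of i] i by (auto simp: E_def)
      define w where "w = s *\<^sub>R u + v"
      have uw: "cross2 u w = cross2 u v" by (simp add: w_def cross2_add cross2_scaleR)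
      then have w0: "w \<noteq> 0" using uv by (auto simp: cross2_def)
      have wS: "norm w \<le> S"
      proof -
        have "norm w \<le> \<bar>s\<bar> * norm u + norm v" unfolding w_def by (rule order_trans[OF norm_triangle_ineq]) simp
        also have "\<dots> \<le> 1 * norm u + norm v" using s \<sigma> by (intro add_right_mono mult_right_mono) auto
        finally show ?thesis by (simp add: S_def)
      qed
      have w\<Delta>: "\<Delta> \<le> norm w" using abs_cross2_le[of u w] norm_u uw by (simp add: \<Delta>_def)
      obtain k where k: "k \<noteq> 0" "e_minus (B i) = k *\<^sub>R w"
        using e_minus_eq_scale[of "B i" w \<mu>] B w0 \<mu> SL2_abs_det by (auto simp: w_def cocycles_def)
      have pd: "proj_dist (B l *v e_minus (B i)) (e_minus (B i)) = pdist (B l *v w) w" for l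
        using k w0 B_nonzero[OF w0, of l]
        by (simp add: matrix_vector_mult_scaleR proj_dist_eq_pdist pdist_scaleR)
      define \<beta>' where "\<beta>' l = cross2 (B l *v w) w / cross2 u v" for l
      have pd\<beta>: "pdist (B l *v w) w * (norm (B l *v w) * norm w) = \<bar>\<beta>' l\<bar> * \<Delta>" for l
        using B_nonzero[OF w0, of l] w0 uv by (simp add: pdist_def \<beta>'_def \<Delta>_def)
      have Bw_up: "norm (B l *v w) * norm w \<le> M * S\<^sup>2" for l
      proof -
        have "norm (B l *v w) * norm w \<le> (M * S) * S"
          using order_trans[OF B_upper[of l w] mult_left_mono[OF wS]] wS M_pos S_ge(1) by (intro mult_mono) auto
        then show ?thesis by (simp add: power2_eq_square)
      qed
      have Bw_lo: "\<Delta>\<^sup>2 / M \<le> norm (B l *v w) * norm w" for l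
      proof -
        have "\<Delta> / M \<le> norm (B l *v w)"
          using B_lower[of w l] w\<Delta> M_pos by (simp add: field_simps)
        then have "\<Delta> / M * \<Delta> \<le> norm (B l *v w) * norm w"
          using w\<Delta> \<Delta>_pos M_pos by (intro mult_mono) auto
        then show ?thesis by (simp add: power2_eq_square)
      qed
      have pd_le: "pdist (B l *v w) w \<le> \<rho>" for l using le pd by simp
      have pd_ge: "\<rho> \<le> pdist (B j *v w) w" using eq pd by simp
      have \<beta>_up: "\<bar>\<beta>' l\<bar> \<le> \<rho> * C" for l
      proof -
        have "\<bar>\<beta>' l\<bar> * \<Delta> \<le> \<rho> * (M * S\<^sup>2)"
          unfolding pd\<beta>[symmetric] by (rule mult_mono[OF pd_le Bw_up]) (use \<rho>0 in auto)
        then show ?thesis using \<Delta>_pos by (simp add: C_def field_simps)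
      qed
      have \<rho>1: "\<rho> \<le> 1" using eq pd[of j] pdist_le_1[of "B j *v w" w] by simp
      have "\<rho> * (\<Delta>\<^sup>2 / M) \<le> \<bar>\<beta>' j\<bar> * \<Delta>"
        unfolding pd\<beta>[symmetric] by (rule mult_mono[OF pd_ge Bw_lo]) (use M_pos in \<open>auto simp: pdist_nonneg\<close>)
      then have \<beta>_lo: "\<rho> * c \<le> \<bar>\<beta>' j\<bar>" using \<Delta>_pos M_pos
        by (simp add: c_def field_simps power2_eq_square)
      have \<beta>'j: "\<beta>' j = s * \<alpha> j + \<beta> j - s\<^sup>2 * \<gamma> j - s * \<delta> j"
      proof -
        have "cross2 (B j *v w) w = (s * \<alpha> j + \<beta> j - s\<^sup>2 * \<gamma> j - s * \<delta> j) * cross2 u v"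
          unfolding w_def matrix_vector_right_distrib matrix_vector_mult_scaleR Bu Bv
          by (simp add: cross2_def algebra_simps power2_eq_square)
        then show ?thesis using uv by (simp add: \<beta>'_def)
      qed
      have s1: "\<bar>s\<bar> \<le> 1" using s \<sigma> by linarith
      have aM: "\<bar>a l\<bar> + 1 \<le> M" "\<bar>b l\<bar> + 1 \<le> M" for l
        using eigenvalue_le_norm[OF Au[of l] u_nonzero] eigenvalue_le_norm[OF Av[of l] v_nonzero] M_bounds(1)[of l]
        by linarith+
      \<comment> \<open>For \<open>A\<close> the direction \<open>v\<close> is invariant, and
        \<open>w\<close> is \<sigma>-close to it; so every term of \<open>\<beta>' j\<close> is of
        order \<sigma>, and \<rho> with it.\<close>
      have "\<rho> \<le> exp (- 1)"
      proof -
        have "\<bar>\<alpha> j\<bar> \<le> M + \<sigma>" "\<bar>\<delta> j\<bar> \<le> M + \<sigma>" using close[of j] \<kappa>(1) aM[of j] by linarith+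
        then have 1: "\<bar>s * \<alpha> j\<bar> \<le> \<sigma> * (M + \<sigma>)" "\<bar>s * \<delta> j\<bar> \<le> \<sigma> * (M + \<sigma>)"
          unfolding abs_mult using s \<sigma> by (intro mult_mono; simp)+
        have "\<bar>s\<^sup>2 * \<gamma> j\<bar> \<le> 1 * \<sigma>"
          unfolding abs_mult using close(4)[of j] s1 \<kappa>(1) \<sigma> by (intro mult_mono) (auto simp: abs_square_le_1)
        with 1 have "\<bar>\<beta>' j\<bar> \<le> 2 * (\<sigma> * (M + \<sigma>)) + 2 * \<sigma>"
          unfolding \<beta>'j using close(3)[of j] \<kappa>(1) by linarith
        also have "\<dots> \<le> 2 * (\<sigma> * (M + 1)) + 2 * \<sigma>" using \<sigma> by simp
        also have "\<dots> = (4 + 2 * M) * \<sigma>" by (simp add: algebra_simps)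
        finally have "\<bar>\<beta>' j\<bar> \<le> (4 + 2 * M) * \<sigma>" .
        with \<beta>_lo have "\<rho> * c \<le> (4 + 2 * M) * \<sigma>" by linarith
        then have "\<rho> \<le> (4 + 2 * M) * \<sigma> * M / \<Delta>" using \<Delta>_pos M_pos by (simp add: c_def field_simps)
        also have "\<dots> \<le> 1 / 3" by (rule \<sigma>')
        also have "1 / 3 \<le> exp (- 1 :: real)" using exp_le by (simp add: exp_minus field_simps)
        finally show ?thesis .
      qed
      moreover have "ln (norm x) + real n * (L / 4) - D1 - ln (1 / \<rho>)
            \<le> (Q ^^ n) (\<lambda>x. ln (norm x)) x" if x: "x \<noteq> 0" for n x
      proof -
        \<comment> \<open>Coordinates in the basis \<open>u, w\<close> with the factor \<rho> put on
          the second: this replaces the entry \<open>\<beta>' l\<close> by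
          \<open>\<beta>' l / \<rho>\<close> and \<gamma> by the even smaller
          \<open>\<rho> * \<gamma> l\<close>.\<close>
        define X Y where "X x = cross2 x w / cross2 u v" and "Y x = \<rho> * (cross2 u x / cross2 u v)" for x
        define \<alpha>' \<delta>' where "\<alpha>' l = cross2 (B l *v u) w / cross2 u v" and "\<delta>' l = cross2 u (B l *v w) / cross2 u v" for l
        have dec: "x = X x *\<^sub>R u + (Y x / \<rho>) *\<^sub>R w" for x
        proof -
          have "(1 / cross2 u v) *\<^sub>R (cross2 u v *\<^sub>R x) = (1 / cross2 u v) *\<^sub>R (cross2 x w *\<^sub>R u + cross2 u x *\<^sub>R w)"
            unfolding uw[symmetric] by (subst cross2_cramer[of u w x]) simp
          then show ?thesis using uv \<rho>0 by (simp add: scaleR_add_right X_def Y_def)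
        qed
        have XT: "X (B l *v x) = \<alpha>' l * X x + (\<beta>' l / \<rho>) * Y x" for l x
        proof -
          have "X (B l *v x) = X (B l *v (X x *\<^sub>R u + (Y x / \<rho>) *\<^sub>R w))" using dec[of x] by simp
          also have "\<dots> = X x * \<alpha>' l + (Y x / \<rho>) * \<beta>' l"
            by (simp add: X_def[of "B l *v _"] X_def[of "_ + _"] \<alpha>'_def \<beta>'_def matrix_vector_right_distrib matrix_vector_mult_scaleR
                cross2_add cross2_scaleR add_divide_distrib)
          finally show ?thesis by (simp add: mult.commute)
        qed
        have YT: "Y (B l *v x) = (\<rho> * \<gamma> l) * X x + \<delta>' l * Y x" for l x
        proof -
          have "Y (B l *v x) = Y (B l *v (X x *\<^sub>R u + (Y x / \<rho>) *\<^sub>R w))" using dec[of x] by simp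
          also have "\<dots> = \<rho> * (X x * \<gamma> l + (Y x / \<rho>) * \<delta>' l)"
            by (simp add: Y_def[of "B l *v _"] Y_def[of "_ + _"] \<gamma>_def \<delta>'_def matrix_vector_right_distrib matrix_vector_mult_scaleR
                cross2_add cross2_scaleR add_divide_distrib)
          finally show ?thesis using \<rho>0 by (simp add: algebra_simps)
        qed
        have \<alpha>': "\<alpha>' l = \<alpha> l - s * \<gamma> l" and \<delta>': "\<delta>' l = \<delta> l + s * \<gamma> l" for l
        proof -
          have "cross2 (B l *v u) w = (\<alpha> l - s * \<gamma> l) * cross2 u v" "cross2 u (B l *v w) = (\<delta> l + s * \<gamma> l) * cross2 u v"
            unfolding w_def matrix_vector_right_distrib matrix_vector_mult_scaleR Bu Bv
            by (simp_all add: cross2_def algebra_simps)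
          then show "\<alpha>' l = \<alpha> l - s * \<gamma> l" "\<delta>' l = \<delta> l + s * \<gamma> l" using uv by (simp_all add: \<alpha>'_def \<delta>'_def)
        qed
        have sg: "\<bar>s * \<gamma> l\<bar> \<le> 1 * \<kappa>" for l
          unfolding abs_mult using s1 close(4)[of l] by (intro mult_mono) auto
        have rg: "\<bar>\<rho> * \<gamma> l\<bar> \<le> 1 * \<kappa>" for l
          unfolding abs_mult using \<rho>0 \<rho>1 close(4)[of l] by (intro mult_mono) auto
        have cl: "\<forall>l. \<bar>\<alpha>' l - a l\<bar> \<le> \<eta> \<and> \<bar>\<delta>' l - b l\<bar> \<le> \<eta> \<and> \<bar>\<rho> * \<gamma> l\<bar> \<le> \<eta> \<and> \<bar>\<beta>' l / \<rho>\<bar> \<le> C"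
        proof (intro allI conjI)
          fix l
          show "\<bar>\<alpha>' l - a l\<bar> \<le> \<eta>" "\<bar>\<delta>' l - b l\<bar> \<le> \<eta>" "\<bar>\<rho> * \<gamma> l\<bar> \<le> \<eta>"
            unfolding \<alpha>' \<delta>' using close[of l] sg[of l] rg[of l] \<kappa>(2) by linarith+
          show "\<bar>\<beta>' l / \<rho>\<bar> \<le> C" using \<beta>_up[of l] \<rho>0 by (simp add: field_simps)
        qed
        \<comment> \<open>\<open>w\<close> is an eigenvector of \<open>B i\<close>, so the second
          axis is exactly invariant under this letter.\<close>
        have \<beta>i: "\<beta>' i / \<rho> = 0" using \<mu>(2) by (simp add: \<beta>'_def w_def[symmetric] cross2_scaleR)
        have \<beta>j: "c \<le> \<bar>\<beta>' j / \<rho>\<bar>" using \<beta>_lo \<rho>0 by (simp add: field_simps)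
        define N where "N x = \<bar>X x\<bar> + \<bar>Y x\<bar>" for x
        have N0: "0 < N x" if "x \<noteq> 0" for x
        proof (rule ccontr)
          assume "\<not> 0 < N x"
          then have "X x = 0" "Y x = 0" by (auto simp: N_def)
          with dec[of x] that show False by simp
        qed
        have N_up: "ln (N x) \<le> ln ((S + 1) / \<Delta>) + ln (norm x)" if "x \<noteq> 0" for x
        proof -
          have "\<bar>cross2 x w\<bar> \<le> norm x * S" using abs_cross2_le[of x w] wS
            by (meson mult_left_mono norm_ge_zero order_trans)
          moreover have "\<rho> * \<bar>cross2 u x\<bar> \<le> 1 * norm x"
            using abs_cross2_le[of u x] norm_u \<rho>0 \<rho>1 by (intro mult_mono) auto
          ultimately have "(\<bar>cross2 x w\<bar> + \<rho> * \<bar>cross2 u x\<bar>) / \<Delta> \<le> (norm x * S + 1 * norm x) / \<Delta>"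
            using \<Delta>_pos by (intro divide_right_mono add_mono) auto
          moreover have "N x = (\<bar>cross2 x w\<bar> + \<rho> * \<bar>cross2 u x\<bar>) / \<Delta>"
            using \<rho>0 by (simp add: N_def X_def Y_def \<Delta>_def abs_mult add_divide_distrib)
          ultimately have "N x \<le> ((S + 1) / \<Delta>) * norm x" by (simp add: algebra_simps)
          then have "ln (N x) \<le> ln (((S + 1) / \<Delta>) * norm x)" using N0[OF that] by (intro ln_mono)
          also have "\<dots> = ln ((S + 1) / \<Delta>) + ln (norm x)"
            using that S_ge \<Delta>_pos by (intro ln_mult_pos) auto
          finally show ?thesis .
        qed
        \<comment> \<open>The only place where \<rho> costs anything: near the second axis
          \<open>N x\<close> can be as small as a multiple of
          \<open>\<rho> * norm x\<close>.\<close>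
        have N_lo: "ln (norm x) - ln (1 + S) - ln (1 / \<rho>) \<le> ln (N x)"
        proof -
          have "norm x = norm (X x *\<^sub>R u + (Y x / \<rho>) *\<^sub>R w)" using dec[of x] by simp
          also have "\<dots> \<le> \<bar>X x\<bar> * norm u + \<bar>Y x\<bar> / \<rho> * norm w"
            using \<rho>0 by (intro order_trans[OF norm_triangle_ineq]) simp
          also have "\<dots> \<le> \<bar>X x\<bar> / \<rho> * (1 + S) + \<bar>Y x\<bar> / \<rho> * (1 + S)"
          proof (intro add_mono mult_mono)
            show "\<bar>X x\<bar> \<le> \<bar>X x\<bar> / \<rho>" using \<rho>0 \<rho>1 by (simp add: field_simps mult_left_le_one_le)
          qed (use \<rho>0 norm_u wS S_ge in auto)
          also have "\<dots> = N x * ((1 + S) * (1 / \<rho>))" by (simp add: N_def field_simps add_divide_distrib)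
          finally have "ln (norm x) \<le> ln (N x * ((1 + S) * (1 / \<rho>)))" using x by (intro ln_mono) auto
          also have "\<dots> = ln (N x) + ln ((1 + S) * (1 / \<rho>))"
            using N0[OF x] S_ge \<rho>0 by (intro ln_mult_pos mult_pos_pos) auto
          also have "ln ((1 + S) * (1 / \<rho>)) = ln (1 + S) + ln (1 / \<rho>)"
            using S_ge \<rho>0 by (intro ln_mult_pos) auto
          finally show ?thesis by linarith
        qed
        have "ln (N x) + real n * (L / 4) - D \<le> (Q ^^ n) (\<lambda>v. ln (N v)) x"
          unfolding N_def
          using drift[rule_format, of X "\<lambda>l x. B l *v x" \<alpha>' "\<lambda>l. \<beta>' l / \<rho>" Y "\<lambda>l. \<rho> * \<gamma> l" \<delta>' i j x n,
              OF XT YT cl[rule_format] \<beta>i i \<beta>j] N0[OF x]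
          by (simp only: N_def)
        also have "\<dots> \<le> (Q ^^ n) (\<lambda>v. ln ((S + 1) / \<Delta>) + ln (norm v)) x"
          by (rule markov_iter_mono_inv[where S="{x. x \<noteq> 0}"]) (use x N_up B_nonzero in auto)
        also have "\<dots> = ln ((S + 1) / \<Delta>) + (Q ^^ n) (\<lambda>v. ln (norm v)) x" by (simp add: markov_iter_add)
        finally show ?thesis using N_lo unfolding D1_def by linarith
      qed
      ultimately show "\<rho> \<le> exp (- 1) \<and>
        (\<forall>n x. x \<noteq> 0 \<longrightarrow> ln (norm x) + real n * (L / 4) - D1 - ln (1 / \<rho>)
            \<le> (markov_op p (\<lambda>l x. B l *v x) ^^ n) (\<lambda>x. ln (norm x)) x)" by blast
    qed
  qed
qed

end

context diagonal_cocycle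
begin

text \<open>With \<open>\<ell> = ln (1 / \<rho>)\<close>, expansion sets in at a time \<open>\<tau> = O(\<ell>)\<close>, so the oscillation of the
  finite-time exponents is \<open>O(\<ell>\<^sup>3)\<close> and \<open>n \<ge> const \<cdot> \<ell>\<^sup>1\<^sup>2\<close> suffices; the exponent 54 is far from sharp.\<close>

lemma near_large_deviation:
  "\<exists>\<epsilon> c. 0 < \<epsilon> \<and> 0 < c \<and> (\<forall>B\<in>cocycles. (\<forall>l. norm (B l - A l) < \<epsilon>) \<longrightarrow>
     (\<forall>i. exp L \<le> \<bar>a i\<bar> \<longrightarrow> hyperbolic (B i)) \<and>
     (\<forall>i j \<rho> n. exp L \<le> \<bar>a i\<bar> \<longrightarrow> (\<forall>l. proj_dist (B l *v e_minus (B i)) (e_minus (B i)) \<le> \<rho>) \<longrightarrow>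
        proj_dist (B j *v e_minus (B i)) (e_minus (B i)) = \<rho> \<longrightarrow> 0 < \<rho> \<longrightarrow>
        1 \<le> n \<longrightarrow> ((1 / c) * ln (1 / \<rho>)) ^ 54 \<le> real n \<longrightarrow>
        measure (bernoulli p) {x \<in> space (bernoulli p).
          \<bar>ln (opnorm (cocycle_iter B x n)) / real n - lyap p B\<bar> > real n powr (- 1 / 6)}
        < exp (- (real n powr (1 / 6)))))"
proof -
  obtain \<epsilon> D where \<epsilon>: "0 < \<epsilon>" "\<epsilon> \<le> 1" and main: "\<forall>B\<in>cocycles. (\<forall>l. norm (B l - A l) < \<epsilon>) \<longrightarrow>
     (\<forall>i. exp L \<le> \<bar>a i\<bar> \<longrightarrow> hyperbolic (B i)) \<and>
     (\<forall>i j \<rho>. exp L \<le> \<bar>a i\<bar> \<longrightarrow> (\<forall>l. proj_dist (B l *v e_minus (B i)) (e_minus (B i)) \<le> \<rho>) \<longrightarrow>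
        proj_dist (B j *v e_minus (B i)) (e_minus (B i)) = \<rho> \<longrightarrow> 0 < \<rho> \<longrightarrow>
        \<rho> \<le> exp (- 1) \<and>
        (\<forall>n x. x \<noteq> 0 \<longrightarrow> ln (norm x) + real n * (L / 4) - D - ln (1 / \<rho>)
            \<le> (markov_op p (\<lambda>l x. B l *v x) ^^ n) (\<lambda>x. ln (norm x)) x))"
    using near_expansion by (elim exE conjE) (rule that)
  obtain r0 where r0: "\<And>P. P *v u \<noteq> 0 \<Longrightarrow> P *v v \<noteq> 0 \<Longrightarrow>
    \<bar>ln (opnorm P) - max (ln (norm (P *v u))) (ln (norm (P *v v)))\<bar> \<le> r0"
    using ln_opnorm_basis[OF uv] by blast
  define r where "r = \<bar>r0\<bar> + \<bar>ln (norm u)\<bar> + \<bar>ln (norm v)\<bar>"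
  have r: "\<bar>ln (opnorm P) - max (ln (norm (P *v u))) (ln (norm (P *v v)))\<bar> \<le> r"
    if "P *v u \<noteq> 0" "P *v v \<noteq> 0" for P using r0[OF that] by (simp add: r_def)
  have r': "\<bar>ln (norm u)\<bar> \<le> r" "\<bar>ln (norm v)\<bar> \<le> r" "0 \<le> r" by (simp_all add: r_def)
  define t where "t = 4 / L * (\<bar>D\<bar> + 2) + 1"
  have t1: "1 \<le> t" using L(2) by (simp add: t_def)
  have lnM: "1 \<le> ln M" using M_bounds(2) M_pos by (simp add: ln_ge_iff)
  define K1 where "K1 = 8 * M\<^sup>2 * (ln M)\<^sup>2 * t ^ 3"
  define C1 where "C1 = 2 * ln M + K1 + 2 * r"
  have K1: "0 \<le> K1" using t1 by (simp add: K1_def)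
  have C1: "2 \<le> C1" using lnM K1 r'(3) by (simp add: C1_def)
  \<comment> \<open>So \<open>1 / c = (64 * C1\<^sup>2)\<^sup>2\<close>, and with
    \<open>C2 = C1 * ell ^ 3\<close> the threshold of \<open>norm_deviation\<close> becomes
    \<open>(1 / c) * ell ^ 12\<close>.\<close>
  define c where "c = 1 / (4096 * C1 ^ 4)"
  have C14: "1 \<le> C1 ^ 4" using C1 by (intro one_le_power) auto
  have c0: "0 < c" using C1 by (simp add: c_def)
  show ?thesis
  proof (rule exI[of _ \<epsilon>], rule exI[of _ c], intro conjI \<epsilon>(1) c0 ballI impI)
    fix B :: "'s \<Rightarrow> real^2^2" assume B: "B \<in> cocycles" and near: "\<forall>l. norm (B l - A l) < \<epsilon>"
    note main_B = main[rule_format, OF B near[rule_format]]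
    show "\<forall>i. exp L \<le> \<bar>a i\<bar> \<longrightarrow> hyperbolic (B i)" using main_B by blast
    have bdd: "bounded_cocycle B M"
      by (rule near_bounded[OF B]) (use near \<epsilon>(2) in \<open>meson less_imp_le order_trans\<close>)
    show "\<forall>i j \<rho> n. exp L \<le> \<bar>a i\<bar> \<longrightarrow> (\<forall>l. proj_dist (B l *v e_minus (B i)) (e_minus (B i)) \<le> \<rho>) \<longrightarrow>
        proj_dist (B j *v e_minus (B i)) (e_minus (B i)) = \<rho> \<longrightarrow> 0 < \<rho> \<longrightarrow>
        1 \<le> n \<longrightarrow> ((1 / c) * ln (1 / \<rho>)) ^ 54 \<le> real n \<longrightarrow>
        measure (bernoulli p) {x \<in> space (bernoulli p).
          \<bar>ln (opnorm (cocycle_iter B x n)) / real n - lyap p B\<bar> > real n powr (- 1 / 6)}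
        < exp (- (real n powr (1 / 6)))"
    proof (intro allI impI)
      fix i j \<rho> n
      assume i: "exp L \<le> \<bar>a i\<bar>" and le: "\<forall>l. proj_dist (B l *v e_minus (B i)) (e_minus (B i)) \<le> \<rho>"
        and eq: "proj_dist (B j *v e_minus (B i)) (e_minus (B i)) = \<rho>" and \<rho>0: "0 < \<rho>"
        and n: "1 \<le> n" "((1 / c) * ln (1 / \<rho>)) ^ 54 \<le> real n"
      have \<rho>1: "\<rho> \<le> exp (- 1)" and growth: "\<And>n x. x \<noteq> 0 \<Longrightarrow> ln (norm x) + real n * (L / 4) - D - ln (1 / \<rho>)
            \<le> (markov_op p (\<lambda>l x. B l *v x) ^^ n) (\<lambda>x. ln (norm x)) x"
        using main_B i le eq \<rho>0 by blast+
      define ell where "ell = ln (1 / \<rho>)"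
      have "ln \<rho> \<le> ln (exp (- 1))" using \<rho>0 \<rho>1 by (intro ln_mono) auto
      then have ell1: "1 \<le> ell" using \<rho>0 by (simp add: ell_def ln_div)
      \<comment> \<open>The drift \<open>\<tau> * (L / 4)\<close> has to outweigh
        \<open>D + ell + 1\<close>, and this is at most \<open>(\<bar>D\<bar> + 2) * ell\<close>
        because \<open>ell\<close> is at least 1.\<close>
      define \<tau> where "\<tau> = nat \<lceil>4 / L * (\<bar>D\<bar> + 2) * ell\<rceil>"
      have \<tau>: "4 / L * (\<bar>D\<bar> + 2) * ell \<le> real \<tau>" "real \<tau> \<le> 4 / L * (\<bar>D\<bar> + 2) * ell + 1"
      proof -
        have "0 \<le> 4 / L * (\<bar>D\<bar> + 2) * ell" using L(2) ell1 by simp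
        then show "4 / L * (\<bar>D\<bar> + 2) * ell \<le> real \<tau>" "real \<tau> \<le> 4 / L * (\<bar>D\<bar> + 2) * ell + 1"
          unfolding \<tau>_def by linarith+
      qed
      have \<tau>0: "1 \<le> \<tau>"
      proof -
        have "0 < 4 / L * (\<bar>D\<bar> + 2) * ell" using L(2) ell1 by simp
        then have "0 < real \<tau>" using \<tau>(1) by linarith
        then show ?thesis by simp
      qed
      have \<tau>t: "real \<tau> \<le> t * ell" using \<tau>(2) ell1 by (simp add: t_def distrib_right)
      interpret bounded_cocycle p B M by (rule bdd)
      interpret expanding_cocycle p B M \<tau>
      proof
        show "\<bar>det (B l)\<bar> = 1" for l using B SL2_abs_det by (auto simp: cocycles_def)
        show "1 \<le> \<tau>" by (rule \<tau>0)
        fix x :: "real^2" assume x: "x \<noteq> 0"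
        have "(4 / L * (\<bar>D\<bar> + 2) * ell) * (L / 4) \<le> real \<tau> * (L / 4)"
          using \<tau>(1) L(2) by (intro mult_right_mono) auto
        also have "(4 / L * (\<bar>D\<bar> + 2) * ell) * (L / 4) = (\<bar>D\<bar> + 2) * ell" using L(2) by (simp add: field_simps)
        finally have "(\<bar>D\<bar> + 2) * ell \<le> real \<tau> * (L / 4)" .
        moreover have "(\<bar>D\<bar> + 1) * 1 \<le> (\<bar>D\<bar> + 1) * ell" using ell1 by (intro mult_left_mono) auto
        moreover have "(\<bar>D\<bar> + 2) * ell = (\<bar>D\<bar> + 1) * ell + ell" by (simp add: algebra_simps)
        ultimately have "\<bar>D\<bar> + 1 + ell \<le> real \<tau> * (L / 4)" by argo
        then show "ln (norm x) + 1 \<le> (Q ^^ \<tau>) (\<lambda>v. ln (norm v)) x"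
          using abs_ge_self[of D] growth[OF x, of \<tau>] unfolding ell_def[symmetric] by linarith
      qed
      define K where "K = 8 * M\<^sup>2 * (ln M)\<^sup>2 * real \<tau> ^ 3"
      interpret oscillation_cocycle p B M "{x. x \<noteq> 0}" K
        by unfold_locales (auto simp: B_nonzero K_def intro: log_growth_diff_le)
      obtain \<Lambda> where \<Lambda>: "\<And>w n. w \<in> {x. x \<noteq> 0} \<Longrightarrow> \<bar>G n w - real n * \<Lambda>\<bar> \<le> 2 * K"
        using exists_exponent by blast
      have ell3: "1 \<le> ell ^ 3" using ell1 by (rule one_le_power)
      have "K \<le> 8 * M\<^sup>2 * (ln M)\<^sup>2 * (t * ell) ^ 3"
        unfolding K_def using \<tau>t by (intro mult_left_mono power_mono) auto
      then have K: "K \<le> K1 * ell ^ 3" by (simp add: K1_def power_mult_distrib mult_ac)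
      define C2 where "C2 = C1 * ell ^ 3"
      have C2: "2 * ln M + K + 2 * r \<le> C2"
      proof -
        have "(2 * ln M + 2 * r) * 1 \<le> (2 * ln M + 2 * r) * ell ^ 3"
          using ell3 lnM r'(3) by (intro mult_left_mono) auto
        then show ?thesis using K by (simp add: C2_def C1_def algebra_simps)
      qed
      have dev: "measure (bernoulli p) {x \<in> space (bernoulli p).
          \<bar>ln (opnorm (cocycle_iter B x m)) / real m - \<Lambda>\<bar> > real m powr (- 1 / 6)} < exp (- (real m powr (1 / 6)))"
        if "1 \<le> m" "(64 * C2\<^sup>2)\<^sup>2 \<le> real m" for m
        by (rule norm_deviation[OF _ _ r r'(1,2) C2 \<Lambda> that]) (use u_nonzero v_nonzero in auto)
      have "lyap p B = \<Lambda>"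
      proof (rule lyap_eq, rule AE_tendsto_of_stretched_tails)
        show "(\<lambda>x. ln (opnorm (cocycle_iter B x m))) \<in> borel_measurable (bernoulli p)" for m
          by (rule borel_measurable_cocycle_iter[where f="\<lambda>P. ln (opnorm P)"]) simp
        fix m assume m: "nat \<lceil>(64 * C2\<^sup>2)\<^sup>2\<rceil> + 1 \<le> m"
        then have "real (nat \<lceil>(64 * C2\<^sup>2)\<^sup>2\<rceil>) \<le> real m" by simp
        then have "(64 * C2\<^sup>2)\<^sup>2 \<le> real m" using real_nat_ceiling_ge[of "(64 * C2\<^sup>2)\<^sup>2"] by linarith
        with dev[of m] m show "measure (bernoulli p) {x \<in> space (bernoulli p).
          \<bar>ln (opnorm (cocycle_iter B x m)) / real m - \<Lambda>\<bar> > real m powr (- 1 / 6)} \<le> exp (- (real m powr (1 / 6)))"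
          by simp
      qed
      moreover have "(64 * C2\<^sup>2)\<^sup>2 \<le> real n"
      proof -
        have c1: "1 \<le> 1 / c" using C14 by (simp add: c_def)
        have "(64 * C2\<^sup>2)\<^sup>2 = (1 / c) * ell ^ 12"
          by (simp add: C2_def c_def power_mult_distrib flip: power_mult)
        also have "\<dots> \<le> (1 / c) ^ 54 * ell ^ 54"
          using c1 ell1 self_le_power[OF c1, of 54] by (intro mult_mono power_increasing) auto
        also have "\<dots> = ((1 / c) * ell) ^ 54" by (simp only: power_mult_distrib)
        finally show ?thesis using n(2) by (simp add: ell_def)
      qed
      ultimately show "measure (bernoulli p) {x \<in> space (bernoulli p).
          \<bar>ln (opnorm (cocycle_iter B x n)) / real n - lyap p B\<bar> > real n powr (- 1 / 6)}
        < exp (- (real n powr (1 / 6)))" using dev[OF n(1)] by simp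
    qed
  qed
qed

end

section \<open>The neighbourhood and the deviation theorem\<close>

lemma open_uniform_neighbourhood:
  fixes A :: "'s::finite \<Rightarrow> 'b::real_normed_vector"
  shows "open {B. \<forall>l. norm (B l - A l) < \<epsilon>}"
proof -
  have "open {B. norm (B l - A l) < \<epsilon>}" for l
    by (intro open_Collect_less continuous_intros continuous_on_product_coordinates)
  then have "open (\<Inter>l. {B. norm (B l - A l) < \<epsilon>})" by (intro open_INT) auto
  moreover have "(\<Inter>l. {B. norm (B l - A l) < \<epsilon>}) = {B. \<forall>l. norm (B l - A l) < \<epsilon>}" by auto
  ultimately show ?thesis by simp
qed

theorem theorem5p1:
  fixes p :: "'s::finite pmf" and A :: "'s \<Rightarrow> real^2^2"
  assumes "set_pmf p = UNIV"
    and "A \<in> Diag"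
    and "lyap p A > 0"
  shows "\<exists>U c. open U \<and> A \<in> U \<and> c > 0 \<and>
     (\<forall>B \<in> U \<inter> cocycles. \<forall>i \<in> Sigma_H p A. hyperbolic (B i)) \<and>
     (\<forall>B \<in> U \<inter> cocycles. rho_minus p A B > 0 \<longrightarrow>
        (\<forall>n::nat. n \<ge> 1 \<and> real n \<ge> ((1 / c) * ln (1 / rho_minus p A B)) ^ 54 \<longrightarrow>
           measure (bernoulli p)
             {x \<in> space (bernoulli p).
                \<bar>ln (opnorm (cocycle_iter B x n)) / real n - lyap p B\<bar> > real n powr (-1/6)}
           < exp (- (real n powr (1/6)))))"
proof -
  define u where "u = e_plus p A"
  obtain v a b where d: "norm u = 1" "cross2 u v \<noteq> 0" "\<And>l. A l *v u = a l *\<^sub>R u" "\<And>l. A l *v v = b l *\<^sub>R v"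
    "\<And>l. \<bar>a l * b l\<bar> = 1" "lyap p A = (\<Sum>l\<in>UNIV. pmf p l * ln \<bar>a l\<bar>)" "a_coef p A = a"
    using Diag_structure[OF assms(2), of p] unfolding u_def by blast
  interpret diagonal_cocycle p A u v a b "lyap p A"
    by unfold_locales (use assms d in auto)
  have H: "Sigma_H p A = {i. exp (lyap p A) \<le> \<bar>a i\<bar>}" by (simp add: Sigma_H_def d)
  \<comment> \<open>The mean of \<open>ln \<bar>a i\<bar>\<close> is the Lyapunov exponent, so some
    letter reaches it; otherwise the maximum in \<open>rho_minus\<close> would be over an empty
    set.\<close>
  have H_ne: "Sigma_H p A \<noteq> {}"
  proof
    assume "Sigma_H p A = {}"
    then have less: "\<bar>a i\<bar> < exp (lyap p A)" for i by (auto simp: H not_le)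
    have ln_less: "ln \<bar>a i\<bar> < lyap p A" for i
    proof -
      have "0 < \<bar>a i\<bar>" using d(5)[of i] by auto
      then show ?thesis using less[of i] by (metis exp_less_cancel_iff exp_ln)
    qed
    have "(\<Sum>l\<in>UNIV. pmf p l * ln \<bar>a l\<bar>) < (\<Sum>l\<in>UNIV. pmf p l * lyap p A)"
      using assms(1) ln_less by (intro sum_strict_mono mult_strict_left_mono pmf_positive) auto
    then show False using d(6) by (simp add: sum_pmf_UNIV flip: sum_distrib_right)
  qed
  obtain \<epsilon> c where \<epsilon>: "0 < \<epsilon>" "0 < c" and main: "\<forall>B\<in>cocycles. (\<forall>l. norm (B l - A l) < \<epsilon>) \<longrightarrow>
     (\<forall>i. exp (lyap p A) \<le> \<bar>a i\<bar> \<longrightarrow> hyperbolic (B i)) \<and>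
     (\<forall>i j \<rho> n. exp (lyap p A) \<le> \<bar>a i\<bar> \<longrightarrow> (\<forall>l. proj_dist (B l *v e_minus (B i)) (e_minus (B i)) \<le> \<rho>) \<longrightarrow>
        proj_dist (B j *v e_minus (B i)) (e_minus (B i)) = \<rho> \<longrightarrow> 0 < \<rho> \<longrightarrow>
        1 \<le> n \<longrightarrow> ((1 / c) * ln (1 / \<rho>)) ^ 54 \<le> real n \<longrightarrow>
        measure (bernoulli p) {x \<in> space (bernoulli p).
          \<bar>ln (opnorm (cocycle_iter B x n)) / real n - lyap p B\<bar> > real n powr (- 1 / 6)}
        < exp (- (real n powr (1 / 6))))"
    using near_large_deviation by (elim exE conjE) (rule that)
  show ?thesis
  proof (rule exI[of _ "{B. \<forall>l. norm (B l - A l) < \<epsilon>}"], rule exI[of _ c], intro conjI ballI impI allI)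
    show "open {B. \<forall>l. norm (B l - A l) < \<epsilon>}" by (rule open_uniform_neighbourhood)
    show "A \<in> {B. \<forall>l. norm (B l - A l) < \<epsilon>}" using \<epsilon> by simp
    show "c > 0" by (rule \<epsilon>)
  next
    fix B i assume "B \<in> {B. \<forall>l. norm (B l - A l) < \<epsilon>} \<inter> cocycles" "i \<in> Sigma_H p A"
    then show "hyperbolic (B i)" using main by (auto simp: H)
  next
    fix B and n :: nat
    assume B: "B \<in> {B. \<forall>l. norm (B l - A l) < \<epsilon>} \<inter> cocycles" and \<rho>: "rho_minus p A B > 0"
      and n: "n \<ge> 1 \<and> real n \<ge> ((1 / c) * ln (1 / rho_minus p A B)) ^ 54"
    let ?d = "\<lambda>i j. proj_dist (B j *v e_minus (B i)) (e_minus (B i))"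
    let ?R = "{?d i j | i j. i \<in> Sigma_H p A}"
    have R: "?R = (\<lambda>(i, j). ?d i j) ` (Sigma_H p A \<times> UNIV)" by auto
    have fin: "finite ?R" unfolding R by (intro finite_imageI) auto
    have ne: "?R \<noteq> {}" using H_ne by auto
    \<comment> \<open>The pair attaining the maximum provides both bounds: all letters move the line
      \<open>e_minus (B i)\<close> by at most \<rho>, and \<open>j\<close> moves it by exactly
      \<rho>.\<close>
    obtain i j where ij: "i \<in> Sigma_H p A" "?d i j = rho_minus p A B"
      using Max_in[OF fin ne] unfolding rho_minus_def by auto
    have le: "\<forall>l. ?d i l \<le> rho_minus p A B"
      unfolding rho_minus_def using ij(1) by (intro allI Max_ge[OF fin]) blast
    from B have B1: "B \<in> cocycles" and B2: "\<forall>l. norm (B l - A l) < \<epsilon>" by auto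
    have iH: "exp (lyap p A) \<le> \<bar>a i\<bar>" using ij(1) by (simp add: H)
    have "\<forall>i j \<rho> n. exp (lyap p A) \<le> \<bar>a i\<bar> \<longrightarrow> (\<forall>l. ?d i l \<le> \<rho>) \<longrightarrow> ?d i j = \<rho> \<longrightarrow> 0 < \<rho> \<longrightarrow>
        1 \<le> n \<longrightarrow> ((1 / c) * ln (1 / \<rho>)) ^ 54 \<le> real n \<longrightarrow>
        measure (bernoulli p) {x \<in> space (bernoulli p).
          \<bar>ln (opnorm (cocycle_iter B x n)) / real n - lyap p B\<bar> > real n powr (- 1 / 6)}
        < exp (- (real n powr (1 / 6)))"
      using bspec[OF main B1] B2 by (elim impE conjE)
    from this[rule_format, OF iH le[rule_format] ij(2) \<rho>] n
    show "measure (bernoulli p) {x \<in> space (bernoulli p).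
          \<bar>ln (opnorm (cocycle_iter B x n)) / real n - lyap p B\<bar> > real n powr (-1/6)}
        < exp (- (real n powr (1/6)))" by blast
  qed
qed

end
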